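(* For $\xi\in\mathbb{R}$ let $F_\xi$ be the extreme value distribution function defined by $F_0(x)=e^{-e^{-x}}$ for $x\in\mathbb{R}$; $F_\xi(x)=1-e^{-x^{1/\xi}}$ for $x>0$ and $F_\xi(x)=0$ for $x\le 0$ if $\xi>0$; and $F_\xi(x)=e^{-x^{1/\xi}}$ for $x>0$ and $F_\xi(x)=0$ for $x\le 0$ if $\xi<0$. Then: (i) all Fr\'echet distributions are self-decomposable, that is, $F_\xi$ is self-decomposable for every $\xi<0$; (ii) for $\xi\in\mathbb{R}$, the extreme value distribution $F_\xi$ is infinitely divisible if and only if $\xi\notin(0,1)$.
   Context: The distribution $F_0$ is called the Gumbel distribution, $F_\xi$ with $\xi>0$ a Weibull distribution, and $F_\xi$ with $\xi<0$ a Fr\'echet distribution. A probability distribution on $\mathbb{R}$ is infinitely divisible if for every integer $n\ge1$ it is the $n$-fold convolution of some probability distribution on $\mathbb{R}$. The distribution of a real random variable $X$ is self-decomposable if for every $c\in(0,1)$ there exists a random variable $X_c$, independent of $X$, such that $X$ has the same distribution as $cX+X_c$. *)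

theory Defs
  imports "HOL-Probability.Probability" "HOL-Real_Asymp.Real_Asymp"
begin

definition extreme_value_cdf :: "real \<Rightarrow> real \<Rightarrow> real" where
  "extreme_value_cdf \<xi> x =
    (if \<xi> = 0 then exp (- exp (- x))
     else if x \<le> 0 then 0
     else if \<xi> > 0 then 1 - exp (- (x powr (1 / \<xi>)))
     else exp (- (x powr (1 / \<xi>))))"

definition extreme_value_distribution :: "real \<Rightarrow> real measure" where
  "extreme_value_distribution \<xi> = interval_measure (extreme_value_cdf \<xi>)"

fun convolution_power :: "real measure \<Rightarrow> nat \<Rightarrow> real measure" where
  "convolution_power N 0 = return borel 0"
| "convolution_power N (Suc n) = convolution N (convolution_power N n)"

definition infinitely_divisible :: "real measure \<Rightarrow> bool" where
  "infinitely_divisible M \<longleftrightarrow>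
    real_distribution M \<and>
    (\<forall>n::nat. n \<ge> 1 \<longrightarrow> (\<exists>N. real_distribution N \<and> M = convolution_power N n))"

text \<open>The random variables \<open>X\<close> and \<open>Xc\<close> below may live on any probability space. Since the
  condition depends only on their joint law, which is a measure on the plane, it is no restriction
  to take the points of that space from the type of pairs of reals.\<close>

definition self_decomposable :: "real measure \<Rightarrow> bool" where
  "self_decomposable M \<longleftrightarrow>
    real_distribution M \<and>
    (\<forall>c::real. 0 < c \<and> c < 1 \<longrightarrow>
      (\<exists>(\<Omega> :: (real \<times> real) measure) X Xc.
        prob_space \<Omega> \<and>
        prob_space.indep_var \<Omega> borel X borel Xc \<and>
        distr \<Omega> borel X = M \<and>
        distr \<Omega> borel (\<lambda>\<omega>. c * X \<omega> + Xc \<omega>) = M))"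

lemma extreme_value_cdf_mono: "x \<le> y \<Longrightarrow> extreme_value_cdf \<xi> x \<le> extreme_value_cdf \<xi> y"
proof -
  assume xy: "x \<le> y"
  have "x powr (1 / \<xi>) \<le> y powr (1 / \<xi>)" if "\<xi> > 0" "x > 0"
    using that xy by (intro powr_mono2) auto
  moreover have "y powr (1 / \<xi>) \<le> x powr (1 / \<xi>)" if "\<xi> < 0" "x > 0"
    using that xy by (intro powr_mono2') auto
  ultimately show ?thesis
    using xy by (auto simp: extreme_value_cdf_def)
qed

lemma extreme_value_cdf_right_cont: "continuous (at_right a) (extreme_value_cdf \<xi>)"
proof -
  consider "\<xi> = 0" | "\<xi> \<noteq> 0" "a < 0" | "\<xi> > 0" "a = 0" | "\<xi> < 0" "a = 0" | "\<xi> \<noteq> 0" "a > 0"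
    by linarith
  then have "(extreme_value_cdf \<xi> \<longlongrightarrow> extreme_value_cdf \<xi> a) (at_right a)"
  proof cases
    case 1
    have "((\<lambda>x. exp (- exp (- x))) \<longlongrightarrow> exp (- exp (- a))) (at_right a)"
      by (intro tendsto_intros)
    with 1 show ?thesis by (simp add: extreme_value_cdf_def [abs_def])
  next
    case 2
    have "\<forall>\<^sub>F x in at_right a. x < 0"
      using 2 by (auto simp: eventually_at_right_field)
    then have "\<forall>\<^sub>F x in at_right a. 0 = extreme_value_cdf \<xi> x"
      by eventually_elim (use 2 in \<open>auto simp: extreme_value_cdf_def\<close>)
    from tendsto_cong [THEN iffD1, OF this tendsto_const] show ?thesis
      using 2 by (simp add: extreme_value_cdf_def [of _ a])
  next
    case 3
    have ev: "\<forall>\<^sub>F x in at_right a. 1 - exp (- (x powr (1 / \<xi>))) = extreme_value_cdf \<xi> x"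
      using 3 by (auto simp: extreme_value_cdf_def eventually_at_filter)
    have "((\<lambda>x. 1 - exp (- (x powr (1 / \<xi>)))) \<longlongrightarrow> 0) (at_right 0)"
      using \<open>\<xi> > 0\<close> by real_asymp
    with 3 tendsto_cong [OF ev] show ?thesis
      by (simp add: extreme_value_cdf_def [of _ 0])
  next
    case 4
    have ev: "\<forall>\<^sub>F x in at_right a. exp (- (x powr (1 / \<xi>))) = extreme_value_cdf \<xi> x"
      using 4 by (auto simp: extreme_value_cdf_def eventually_at_filter)
    have "((\<lambda>x. exp (- (x powr (1 / \<xi>)))) \<longlongrightarrow> 0) (at_right 0)"
      using \<open>\<xi> < 0\<close> by real_asymp
    with 4 tendsto_cong [OF ev] show ?thesis
      by (simp add: extreme_value_cdf_def [of _ 0])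
  next
    case 5
    define g where "g x = (if \<xi> > 0 then 1 - exp (- (x powr (1 / \<xi>))) else exp (- (x powr (1 / \<xi>))))"
      for x :: real
    have ev: "\<forall>\<^sub>F x in at_right a. g x = extreme_value_cdf \<xi> x"
      using 5 by (auto simp: extreme_value_cdf_def g_def eventually_at_filter)
    have "(g \<longlongrightarrow> g a) (at_right a)"
      using 5 unfolding g_def by (cases "\<xi> > 0") (auto intro!: tendsto_intros)
    with 5 tendsto_cong [OF ev] show ?thesis
      by (simp add: extreme_value_cdf_def [of _ a] g_def [of a])
  qed
  then show ?thesis by (simp add: continuous_within)
qed

lemma extreme_value_cdf_at_bot: "(extreme_value_cdf \<xi> \<longlongrightarrow> 0) at_bot"
proof (cases "\<xi> = 0")
  case True
  have "((\<lambda>x::real. exp (- exp (- x))) \<longlongrightarrow> 0) at_bot" by real_asymp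
  with True show ?thesis by (simp add: extreme_value_cdf_def [abs_def])
next
  case False
  then have "\<forall>\<^sub>F x in at_bot. 0 = extreme_value_cdf \<xi> x"
    by (intro eventually_mono [OF eventually_le_at_bot [of "0::real"]])
      (simp add: extreme_value_cdf_def)
  from tendsto_cong [THEN iffD1, OF this tendsto_const] show ?thesis .
qed

lemma extreme_value_cdf_at_top: "(extreme_value_cdf \<xi> \<longlongrightarrow> 1) at_top"
proof -
  consider "\<xi> = 0" | "\<xi> > 0" | "\<xi> < 0" by linarith
  then show ?thesis
  proof cases
    case 1
    have "((\<lambda>x::real. exp (- exp (- x))) \<longlongrightarrow> 1) at_top" by real_asymp
    with 1 show ?thesis by (simp add: extreme_value_cdf_def [abs_def])
  next
    case 2
    have ev: "\<forall>\<^sub>F x in at_top. 1 - exp (- (x powr (1 / \<xi>))) = extreme_value_cdf \<xi> x"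
      using eventually_gt_at_top [of "0::real"]
      by eventually_elim (use 2 in \<open>simp add: extreme_value_cdf_def\<close>)
    have "((\<lambda>x. 1 - exp (- (x powr (1 / \<xi>)))) \<longlongrightarrow> 1) at_top"
      using 2 by real_asymp
    with tendsto_cong [OF ev] show ?thesis by simp
  next
    case 3
    have ev: "\<forall>\<^sub>F x in at_top. exp (- (x powr (1 / \<xi>))) = extreme_value_cdf \<xi> x"
      using eventually_gt_at_top [of "0::real"]
      by eventually_elim (use 3 in \<open>simp add: extreme_value_cdf_def\<close>)
    have "((\<lambda>x. exp (- (x powr (1 / \<xi>)))) \<longlongrightarrow> 1) at_top"
      using 3 by real_asymp
    with tendsto_cong [OF ev] show ?thesis by simp
  qed
qed

lemma real_distribution_extreme_value: "real_distribution (extreme_value_distribution \<xi>)"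
  unfolding extreme_value_distribution_def
  by (intro real_distribution_interval_measure extreme_value_cdf_mono extreme_value_cdf_right_cont
      extreme_value_cdf_at_bot extreme_value_cdf_at_top)

lemma cdf_extreme_value: "cdf (extreme_value_distribution \<xi>) = extreme_value_cdf \<xi>"
  unfolding extreme_value_distribution_def
  by (intro cdf_interval_measure extreme_value_cdf_mono extreme_value_cdf_right_cont
      extreme_value_cdf_at_bot)

end

theory Submission
  imports Defs
begin

text \<open>Throughout, \<open>W\<close> is a standard exponential variable; for \<open>\<xi> \<noteq> 0\<close> the law of index \<open>\<xi>\<close> is that
of \<open>W powr \<xi>\<close>, and the Gumbel law is that of \<open>- ln W\<close>.

For laws on the half-line everything is expressed by Laplace transforms. Call \<open>F\<close> sub-Laplace if
\<open>F s = E (U powr s)\<close> for \<open>s > 0\<close> and some \<open>U\<close> in the unit interval; then \<open>U = exp (- X)\<close> for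
some \<open>X\<close> that may take the value infinity. As the unit interval is compact, this class is closed
under pointwise limits (\<open>sub_laplace_LIMSEQ\<close>); it is also closed under products, mixtures and
geometric or Poisson compounding. A law with transform \<open>F\<close> is self-decomposable as soon as all
quotients \<open>F s / F (c * s)\<close> are sub-Laplace, and it is infinitely divisible as soon as all powers
\<open>F s powr t\<close> are. The former implies the latter, because \<open>F s\<close> is a product of such
quotients along a geometric progression, and quotients close to \<open>1\<close> are almost compound Poisson
transforms (\<open>sub_laplace_powr_of_quotients\<close>).

Frechet laws. Put \<open>\<alpha> = - \<xi>\<close> and let \<open>F\<^sub>\<alpha>\<close> be the transform of \<open>W powr (- \<alpha>)\<close>. With an independent
copy \<open>V\<close> of \<open>W\<close>, \<open>F\<^sub>\<alpha> s\<close> is the probability of \<open>V * W powr \<alpha> > s\<close>, whence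
\<open>F\<^sub>\<alpha> s = F\<^sub>\<beta> (s powr \<beta>)\<close> with \<open>\<beta> = 1 / \<alpha>\<close>. So it suffices to treat \<open>\<alpha> \<le> 1\<close>, but with \<open>s powr \<beta>\<close> in place of
\<open>s\<close>, which is harmless since \<open>exp (- (p * s powr \<beta>))\<close> is sub-Laplace for \<open>\<beta> \<le> 1\<close>. For \<open>\<alpha> \<le> 1\<close> the
variable \<open>W powr (- \<alpha>)\<close> is the exponential functional of a Levy process that drifts to infinity
without upward jumps, and cutting the path at first passage times gives self-decomposability.
The proof below is a discrete version of this that avoids processes. Let \<open>0 < q < 1\<close> and \<open>c = q powr \<alpha>\<close>, and replace \<open>W\<close> by a
\<open>q\<close>-analogue on the lattice of the points \<open>q ^ j / (1 - q)\<close>, and the exponential function in the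
Laplace transform by Euler's \<open>q\<close>-exponential with base \<open>c\<close>. The resulting approximation of \<open>F\<^sub>\<alpha>\<close>
satisfies an exact linear difference equation on geometric progressions of ratio \<open>c\<close>
(\<open>qlaplace_equation\<close>), and the signs of its coefficients are those of a walk whose upward
steps have size one, precisely because \<open>q \<le> c\<close>, that is, \<open>\<alpha> \<le> 1\<close>. Hence the quotient of two
consecutive values solves a fixed point equation (\<open>qratio_fixpoint\<close>) whose right-hand side is
built from operations that preserve the class. Iteration converges to the quotient because the
equation is contracting (\<open>ratio_step_contraction\<close>), and \<open>q\<close> may then tend to \<open>1\<close>.

Weibull laws, \<open>\<xi> \<ge> 1\<close>. The survival function \<open>exp (- (x powr (1 / \<xi>)))\<close> is itself a Laplace
transform, so that its increments along an arithmetic progression form a log-convex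
sequence by Cauchy--Schwarz. By Kaluza's theorem a log-convex law on the naturals is compound
geometric, hence infinitely divisible; then the mesh of the lattice is sent to zero.

Weibull laws, \<open>0 < \<xi> < 1\<close>. If a nondegenerate law on the half-line has a convolution root of order \<open>n\<close>,
the root puts mass at least \<open>\<delta> / n\<close> on \<open>{\<epsilon>..}\<close>, with \<open>\<delta>, \<epsilon> > 0\<close> independent of \<open>n\<close>
(\<open>root_tail_lower_bound\<close>). So the law gives \<open>{n * \<epsilon>..}\<close> at least the mass \<open>(\<delta> / n) ^ n\<close>, which is
eventually larger than the Weibull tail \<open>exp (- ((n * \<epsilon>) powr (1 / \<xi>)))\<close>.

The Gumbel law is the weak limit of the laws of \<open>m * (W powr (- 1 / m) - 1)\<close>, and infinite
divisibility passes to weak limits of tight sequences.\<close>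

section \<open>Laplace transforms of laws on the extended half-line\<close>

text \<open>The mass of \<open>\<nu>\<close> at \<open>0\<close> is the mass at infinity of the law on the extended half-line that
corresponds to \<open>\<nu>\<close> under \<open>u = exp (- x)\<close>.\<close>
definition sub_laplace :: "(real \<Rightarrow> real) \<Rightarrow> bool" where
  "sub_laplace F \<longleftrightarrow> (\<exists>\<nu>. real_distribution \<nu> \<and> (AE u in \<nu>. 0 \<le> u \<and> u \<le> 1) \<and>
     (\<forall>s>0. F s = (\<integral>u. u powr s \<partial>\<nu>)))"

lemma powr_unit_bounds: "0 \<le> u \<Longrightarrow> u \<le> 1 \<Longrightarrow> 0 < s \<Longrightarrow> 0 \<le> u powr s \<and> u powr s \<le> (1::real)"
  by (auto intro: powr_le1)

lemma integrable_powr_unit: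
  assumes "real_distribution \<nu>" "AE u in \<nu>. 0 \<le> u \<and> u \<le> 1" "0 < s"
  shows "integrable \<nu> (\<lambda>u. u powr s :: real)"
proof -
  interpret real_distribution \<nu> by fact
  have "AE u in \<nu>. norm (u powr s) \<le> 1"
    using assms(2) by eventually_elim (use assms(3) powr_unit_bounds in auto)
  then show ?thesis by (intro integrable_const_bound) auto
qed

lemma sub_laplaceI:
  assumes "prob_space P" "Y \<in> borel_measurable P" "AE \<omega> in P. 0 \<le> Y \<omega> \<and> Y \<omega> \<le> 1"
    "\<And>s. s > 0 \<Longrightarrow> F s = (\<integral>\<omega>. Y \<omega> powr s \<partial>P)"
  shows "sub_laplace F"
proof -
  interpret prob_space P by fact
  have "real_distribution (distr P borel Y)"
    by (rule real_distribution_distr) fact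
  moreover have "AE u in distr P borel Y. 0 \<le> u \<and> u \<le> 1"
    using assms by (subst AE_distr_iff) auto
  moreover have "(\<integral>u. u powr s \<partial>distr P borel Y) = (\<integral>\<omega>. Y \<omega> powr s \<partial>P)" for s
    using assms by (subst integral_distr) auto
  ultimately show ?thesis
    unfolding sub_laplace_def using assms(4) by metis
qed

lemma sub_laplace_cong:
  "(\<And>s. s > 0 \<Longrightarrow> F s = G s) \<Longrightarrow> sub_laplace F \<Longrightarrow> sub_laplace G"
  unfolding sub_laplace_def by metis

lemma sub_laplace_exp:
  assumes "x \<ge> 0" shows "sub_laplace (\<lambda>s. exp (- (s * x)))"
proof (rule sub_laplaceI[of "return borel (exp (-x))" "\<lambda>u. u"])
  show "prob_space (return borel (exp (-x)))" by (rule prob_space_return) auto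
qed (use assms in \<open>auto simp: AE_return integral_return exp_powr_real mult_ac\<close>)

lemma sub_laplace_0: "sub_laplace (\<lambda>s. 0)"
proof (rule sub_laplaceI[of "return borel (0::real)" "\<lambda>u. u"])
  show "prob_space (return borel (0::real))" by (rule prob_space_return) auto
qed (auto simp: AE_return integral_return)

lemma sub_laplace_1: "sub_laplace (\<lambda>s. 1)"
  using sub_laplace_exp[of 0] by simp

lemma sub_laplace_bounds:
  assumes "sub_laplace F" "s > 0"
  shows "0 \<le> F s" "F s \<le> 1"
proof -
  obtain \<nu> where \<nu>: "real_distribution \<nu>" "AE u in \<nu>. 0 \<le> u \<and> u \<le> 1"
    "\<And>s. s > 0 \<Longrightarrow> F s = (\<integral>u. u powr s \<partial>\<nu>)"
    using assms(1) unfolding sub_laplace_def by metis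
  interpret real_distribution \<nu> by fact
  have 1: "AE u in \<nu>. u powr s \<le> 1"
    using \<nu>(2) by eventually_elim (use assms(2) powr_unit_bounds in auto)
  have i: "integrable \<nu> (\<lambda>u. u powr s)"
    using integrable_powr_unit[OF \<nu>(1,2) assms(2)] .
  show "0 \<le> F s" using \<nu>(3)[OF assms(2)] by simp
  have "(\<integral>u. u powr s \<partial>\<nu>) \<le> (\<integral>u. 1 \<partial>\<nu>)"
    by (rule integral_mono_AE[OF i _ 1]) auto
  then show "F s \<le> 1" using \<nu>(3)[OF assms(2)] prob_space by simp
qed

lemma sub_laplace_scale:
  assumes "sub_laplace F" "a > 0"
  shows "sub_laplace (\<lambda>s. F (a * s))"
proof -
  obtain \<nu> where \<nu>: "real_distribution \<nu>" "AE u in \<nu>. 0 \<le> u \<and> u \<le> 1"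
    "\<And>s. s > 0 \<Longrightarrow> F s = (\<integral>u. u powr s \<partial>\<nu>)"
    using assms(1) unfolding sub_laplace_def by metis
  interpret real_distribution \<nu> by fact
  show ?thesis
  proof (rule sub_laplaceI)
    show "prob_space \<nu>" by (rule prob_space_axioms)
    show "(\<lambda>u. u powr a) \<in> borel_measurable \<nu>" by simp
    show "AE u in \<nu>. 0 \<le> u powr a \<and> u powr a \<le> 1"
      using \<nu>(2) by eventually_elim (use assms(2) powr_unit_bounds in auto)
    show "F (a * s) = (\<integral>u. (u powr a) powr s \<partial>\<nu>)" if "s > 0" for s
      using \<nu>(3)[of "a * s"] that assms by (simp add: powr_powr)
  qed
qed

lemma sub_laplace_mult:
  assumes "sub_laplace F" "sub_laplace G"
  shows "sub_laplace (\<lambda>s. F s * G s)"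
proof -
  obtain \<nu> where \<nu>: "real_distribution \<nu>" "AE u in \<nu>. 0 \<le> u \<and> u \<le> 1"
    "\<And>s. s > 0 \<Longrightarrow> F s = (\<integral>u. u powr s \<partial>\<nu>)"
    using assms(1) unfolding sub_laplace_def by metis
  obtain \<mu> where \<mu>: "real_distribution \<mu>" "AE u in \<mu>. 0 \<le> u \<and> u \<le> 1"
    "\<And>s. s > 0 \<Longrightarrow> G s = (\<integral>u. u powr s \<partial>\<mu>)"
    using assms(2) unfolding sub_laplace_def by metis
  interpret N: real_distribution \<nu> by fact
  interpret M: real_distribution \<mu> by fact
  interpret pair_prob_space \<nu> \<mu> ..
  have ae: "AE z in \<nu> \<Otimes>\<^sub>M \<mu>. (0 \<le> fst z \<and> fst z \<le> 1) \<and> (0 \<le> snd z \<and> snd z \<le> 1)"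
  proof (rule AE_pair_measure)
    show "AE x in \<nu>. AE y in \<mu>. (0 \<le> fst (x, y) \<and> fst (x, y) \<le> 1) \<and> (0 \<le> snd (x, y) \<and> snd (x, y) \<le> 1)"
      using \<nu>(2)
    proof eventually_elim
      case (elim x)
      show ?case using \<mu>(2) by eventually_elim (use elim in simp)
    qed
  qed measurable
  show ?thesis
  proof (rule sub_laplaceI)
    show "prob_space (\<nu> \<Otimes>\<^sub>M \<mu>)" by (rule prob_space_axioms)
    show "(\<lambda>z. fst z * snd z) \<in> borel_measurable (\<nu> \<Otimes>\<^sub>M \<mu>)" by simp
    show "AE z in \<nu> \<Otimes>\<^sub>M \<mu>. 0 \<le> fst z * snd z \<and> fst z * snd z \<le> 1"
      using ae by eventually_elim (simp add: mult_le_one)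
    fix s :: real assume s: "s > 0"
    have "(\<integral>z. (fst z * snd z) powr s \<partial>(\<nu> \<Otimes>\<^sub>M \<mu>)) = (\<integral>z. fst z powr s * snd z powr s \<partial>(\<nu> \<Otimes>\<^sub>M \<mu>))"
    proof (rule integral_cong_AE)
      show "AE z in \<nu> \<Otimes>\<^sub>M \<mu>. (fst z * snd z) powr s = fst z powr s * snd z powr s"
        using ae by eventually_elim (simp add: powr_mult)
    qed simp_all
    also have "\<dots> = (\<integral>x. (\<integral>y. x powr s * y powr s \<partial>\<mu>) \<partial>\<nu>)"
    proof (subst integral_fst'[symmetric])
      show "integrable (\<nu> \<Otimes>\<^sub>M \<mu>) (\<lambda>z. fst z powr s * snd z powr s)"
      proof (rule integrable_const_bound[where B=1])
        show "AE z in \<nu> \<Otimes>\<^sub>M \<mu>. norm (fst z powr s * snd z powr s) \<le> 1"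
          using ae by eventually_elim (use s in \<open>simp add: abs_mult powr_le1 mult_le_one\<close>)
      qed simp
    qed simp
    also have "\<dots> = F s * G s" unfolding \<nu>(3)[OF s] \<mu>(3)[OF s] by simp
    finally show "F s * G s = (\<integral>z. (fst z * snd z) powr s \<partial>(\<nu> \<Otimes>\<^sub>M \<mu>))" ..
  qed
qed

lemma sub_laplace_prod:
  "(\<And>i. i \<in> I \<Longrightarrow> sub_laplace (F i)) \<Longrightarrow> sub_laplace (\<lambda>s. \<Prod>i\<in>I. F i s)"
  by (induction I rule: infinite_finite_induct) (auto intro: sub_laplace_mult sub_laplace_1)

lemma sub_laplace_power: "sub_laplace F \<Longrightarrow> sub_laplace (\<lambda>s. F s ^ n)"
  by (induction n) (auto intro: sub_laplace_mult sub_laplace_1)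

lemma pmf_of_sums:
  fixes p :: "nat \<Rightarrow> real"
  assumes p: "\<And>k. 0 \<le> p k" "p sums 1"
  shows "pmf (embed_pmf p) k = p k"
proof -
  have "(\<integral>\<^sup>+ x. ennreal (p x) \<partial>count_space UNIV) = 1"
    using p by (subst nn_integral_count_space_nat) (metis ennreal_1 suminf_ennreal_eq)
  then show ?thesis by (rule pmf_embed_pmf[OF p(1)])
qed

lemma pmf_nat_expectation:
  fixes f :: "nat \<Rightarrow> real" and P :: "nat pmf"
  assumes "\<And>j. \<bar>f j\<bar> \<le> B"
  shows "(\<lambda>j. pmf P j * f j) sums (\<integral>j. f j \<partial>P)"
proof -
  have i: "integrable (measure_pmf P) f"
    using assms by (intro measure_pmf.integrable_const_bound[where B = B]) auto
  then have "integrable (count_space UNIV) (\<lambda>j. pmf P j * f j)"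
    by (simp add: measure_pmf_eq_density integrable_density)
  then have "(\<lambda>j. pmf P j * f j) sums (\<integral>j. pmf P j * f j \<partial>count_space UNIV)"
    by (rule sums_integral_count_space_nat)
  also have "(\<integral>j. pmf P j * f j \<partial>count_space UNIV) = (\<integral>j. f j \<partial>P)"
    by (simp add: measure_pmf_eq_density integral_density)
  finally show ?thesis .
qed

lemma sub_laplace_mixture_1:
  fixes p :: "nat \<Rightarrow> real"
  assumes F: "\<And>k. sub_laplace (F k)" and p: "\<And>k. 0 \<le> p k" "p sums 1"
  shows "sub_laplace (\<lambda>s. \<Sum>k. p k * F k s)"
proof -
  define P where "P = embed_pmf p"
  have pmf: "pmf P k = p k" for k
    unfolding P_def by (rule pmf_of_sums[OF p])
  have "\<exists>\<nu>. real_distribution \<nu> \<and> (AE u in \<nu>. 0 \<le> u \<and> u \<le> 1) \<and>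
     (\<forall>s>0. F k s = (\<integral>u. u powr s \<partial>\<nu>))" for k
    using F[of k] unfolding sub_laplace_def .
  then obtain \<nu> where \<nu>: "\<And>k. real_distribution (\<nu> k)" "\<And>k. AE u in \<nu> k. 0 \<le> u \<and> u \<le> 1"
     "\<And>k s. s > 0 \<Longrightarrow> F k s = (\<integral>u. u powr s \<partial>\<nu> k)" by metis
  have s\<nu>: "\<nu> k \<in> space (subprob_algebra borel)" for k
    using \<nu>(1)[of k] by (auto simp: space_subprob_algebra real_distribution_def
      real_distribution_axioms_def prob_space_imp_subprob_space)
  have m[measurable]: "\<nu> \<in> measure_pmf P \<rightarrow>\<^sub>M subprob_algebra borel"
    using s\<nu> by auto
  define Q where "Q = measure_pmf P \<bind> \<nu>"
  have "prob_space Q" unfolding Q_def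
    by (rule measure_pmf.prob_space_bind[OF _ m])
      (use \<nu>(1) in \<open>auto simp: real_distribution_def\<close>)
  moreover have sQ[measurable_cong]: "sets Q = sets borel"
    unfolding Q_def by (rule sets_bind) (use s\<nu> in \<open>auto simp: space_subprob_algebra\<close>)
  moreover have ae: "AE u in Q. 0 \<le> u \<and> u \<le> 1"
    unfolding Q_def by (subst AE_bind[OF m]) (use \<nu>(2) in auto)
  moreover have "(\<Sum>k. p k * F k s) = (\<integral>u. u powr s \<partial>Q)" if s: "s > 0" for s
  proof -
    have b: "0 \<le> F k s" "F k s \<le> 1" for k using sub_laplace_bounds[OF F s] by auto
    have "(\<integral>u. u powr s \<partial>Q) = (\<integral>u. (min 1 (max 0 u)) powr s \<partial>Q)"
      by (rule integral_cong_AE) (use ae in \<open>auto simp: max_def min_def\<close>)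
    also have "\<dots> = (\<integral>k. (\<integral>u. (min 1 (max 0 u)) powr s \<partial>\<nu> k) \<partial>measure_pmf P)"
      unfolding Q_def
    proof (rule integral_bind[where K = borel and B=1 and B' = 1])
      show "\<And>u::real. \<bar>min 1 (max 0 u) powr s\<bar> \<le> 1"
        using s by (auto intro!: powr_le1)
      show "AE x in measure_pmf P. emeasure (\<nu> x) (space (\<nu> x)) \<le> ennreal 1"
        using s\<nu> by (auto simp: space_subprob_algebra subprob_space.emeasure_space_le_1)
    qed (use s\<nu> in \<open>auto intro: measure_pmf.finite_measure_axioms\<close>)
    also have "\<dots> = (\<integral>k. F k s \<partial>measure_pmf P)"
    proof (rule Bochner_Integration.integral_cong[OF refl])
      fix k
      interpret real_distribution "\<nu> k" by (rule \<nu>)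
      show "(\<integral>u. (min 1 (max 0 u)) powr s \<partial>\<nu> k) = F k s"
        unfolding \<nu>(3)[OF s]
        by (rule integral_cong_AE) (use \<nu>(2)[of k] in \<open>auto simp: max_def min_def\<close>)
    qed
    also have "\<dots> = (\<Sum>k. p k * F k s)"
      using pmf_nat_expectation[of "\<lambda>k. F k s" 1 P] b by (simp add: sums_iff pmf)
    finally show ?thesis ..
  qed
  ultimately show ?thesis
    by (intro sub_laplaceI[of Q "\<lambda>u. u"]) auto
qed

lemma sub_laplace_mixture:
  fixes p :: "nat \<Rightarrow> real"
  assumes F: "\<And>k. sub_laplace (F k)" and p: "\<And>k. 0 \<le> p k" "summable p" "(\<Sum>k. p k) \<le> 1"
  shows "sub_laplace (\<lambda>s. \<Sum>k. p k * F k s)"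
proof -
  define p' where "p' = case_nat (1 - (\<Sum>k. p k)) p"
  define F' where "F' = case_nat (\<lambda>s::real. 0::real) F"
  have "(\<lambda>k. p' (Suc k)) sums (1 - p' 0)"
    using p by (simp add: p'_def summable_sums)
  then have "p' sums 1" by (subst (asm) sums_Suc_iff) simp
  moreover have "p' k \<ge> 0" "sub_laplace (F' k)" for k
    using p F sub_laplace_0 by (auto simp: p'_def F'_def split: nat.split)
  ultimately have 1: "sub_laplace (\<lambda>s. \<Sum>k. p' k * F' k s)"
    by (intro sub_laplace_mixture_1)
  show ?thesis
  proof (rule sub_laplace_cong[OF _ 1])
    fix s :: real assume s: "s > 0"
    have "summable (\<lambda>k. p k * F k s)"
      by (rule summable_comparison_test'[OF p(2), of 0])
        (use p sub_laplace_bounds[OF F s] in \<open>auto simp: abs_mult intro!: mult_left_le\<close>)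
    then have "summable (\<lambda>k. p' k * F' k s)"
      by (subst summable_Suc_iff[symmetric]) (simp add: p'_def F'_def)
    from suminf_split_head[OF this] show "(\<Sum>k. p' k * F' k s) = (\<Sum>k. p k * F k s)"
      by (simp add: p'_def F'_def)
  qed
qed

lemma sub_laplace_convex:
  assumes "sub_laplace F" "sub_laplace G" "0 \<le> a" "0 \<le> b" "a + b \<le> 1"
  shows "sub_laplace (\<lambda>s. a * F s + b * G s)"
proof -
  define p where "p = (\<lambda>k::nat. if k = 0 then a else if k = 1 then b else 0)"
  define H where "H = (\<lambda>k::nat. if k = 0 then F else G)"
  have s: "(\<lambda>k. p k * c k) sums (a * c 0 + b * c 1)" for c
    using sums_finite[of "{0,1::nat}" "\<lambda>k. p k * c k"] by (simp add: p_def)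
  from s[of "\<lambda>_. 1"] have "p sums (a + b)" by simp
  then have "sub_laplace (\<lambda>s. \<Sum>k. p k * H k s)"
    by (intro sub_laplace_mixture) (use assms in \<open>auto simp: p_def H_def sums_iff\<close>)
  moreover have "(\<Sum>k. p k * H k s) = a * F s + b * G s" for s
    using sums_unique[OF s[of "\<lambda>k. H k s"]] by (simp add: H_def)
  ultimately show ?thesis by simp
qed

text \<open>Laws on the unit interval form a tight family, so a subsequence converges weakly, and \<open>u powr s\<close>
is a bounded continuous function there since \<open>s > 0\<close>. Mass of the underlying laws on the
half-line may escape to infinity, which is why the class contains defective transforms.\<close>
lemma sub_laplace_LIMSEQ:
  assumes F: "\<And>k. sub_laplace (F k)" and lim: "\<And>s. s > 0 \<Longrightarrow> (\<lambda>k. F k s) \<longlonglongrightarrow> G s"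
  shows "sub_laplace G"
proof -
  have "\<exists>\<nu>. real_distribution \<nu> \<and> (AE u in \<nu>. 0 \<le> u \<and> u \<le> 1) \<and>
     (\<forall>s>0. F k s = (\<integral>u. u powr s \<partial>\<nu>))" for k
    using F[of k] unfolding sub_laplace_def .
  then obtain \<nu> where \<nu>: "\<And>k. real_distribution (\<nu> k)" "\<And>k. AE u in \<nu> k. 0 \<le> u \<and> u \<le> 1"
     "\<And>k s. s > 0 \<Longrightarrow> F k s = (\<integral>u. u powr s \<partial>\<nu> k)" by metis
  have "measure (\<nu> k) {-1<..1} = 1" for k
  proof -
    interpret real_distribution "\<nu> k" by (rule \<nu>)
    show ?thesis
      by (subst prob_eq_1) (use \<nu>(2)[of k] in \<open>auto elim!: eventually_mono\<close>)
  qed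
  then have "tight \<nu>"
    unfolding tight_def using \<nu>(1)
    by (intro conjI allI impI exI[of _ "-1::real"] exI[of _ "1::real"]) auto
  from tight_imp_convergent_subsubsequence[OF this strict_mono_id]
  obtain r N where r: "strict_mono (r :: nat \<Rightarrow> nat)" and N: "real_distribution N"
    and w: "weak_conv_m (\<lambda>k. \<nu> (r k)) N" by (auto simp: comp_def)
  interpret N: real_distribution N by fact
  have conv: "(\<lambda>k. \<integral>u. h u \<partial>\<nu> (r k)) \<longlonglongrightarrow> (\<integral>u. h u \<partial>N)"
    if "\<And>x. isCont h x" "\<And>x. norm (h x) \<le> 1" for h :: "real \<Rightarrow> real"
    by (rule weak_conv_imp_integral_bdd_continuous_conv[OF \<nu>(1) N w that])
  \<comment> \<open>The distance to the unit interval, used to show that the limit law still lives there.\<close>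
  define d :: "real \<Rightarrow> real" where "d u = \<bar>u - min 1 (max 0 u)\<bar>" for u
  have "(\<lambda>k. \<integral>u. min 1 (d u) \<partial>\<nu> (r k)) \<longlonglongrightarrow> (\<integral>u. min 1 (d u) \<partial>N)"
    by (rule conv) (auto simp: d_def intro!: continuous_intros)
  moreover have "(\<integral>u. min 1 (d u) \<partial>\<nu> k) = 0" for k
  proof -
    interpret real_distribution "\<nu> k" by (rule \<nu>)
    have "(\<integral>u. min 1 (d u) \<partial>\<nu> k) = (\<integral>u. 0 \<partial>\<nu> k)"
      by (rule integral_cong_AE) (use \<nu>(2)[of k] in \<open>auto simp: d_def\<close>)
    then show ?thesis by simp
  qed
  ultimately have "(\<integral>u. min 1 (d u) \<partial>N) = 0" by (simp add: LIMSEQ_const_iff)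
  moreover have "integrable N (\<lambda>u. min 1 (d u))"
    by (rule N.integrable_const_bound[where B=1]) (auto simp: d_def)
  ultimately have "AE u in N. min 1 (d u) = 0"
    by (subst (asm) integral_nonneg_eq_0_iff_AE) (auto simp: d_def)
  then have ae: "AE u in N. 0 \<le> u \<and> u \<le> 1"
    by eventually_elim (auto simp: d_def min_def max_def split: if_splits)
  have "G s = (\<integral>u. u powr s \<partial>N)" if s: "s > 0" for s
  proof -
    have "(\<lambda>k. \<integral>u. (min 1 (max 0 u)) powr s \<partial>\<nu> (r k)) \<longlonglongrightarrow> (\<integral>u. (min 1 (max 0 u)) powr s \<partial>N)"
      using s by (intro conv) (auto intro!: continuous_intros powr_le1)
    moreover have "(\<integral>u. (min 1 (max 0 u)) powr s \<partial>\<nu> k) = F k s" for k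
    proof -
      interpret real_distribution "\<nu> k" by (rule \<nu>)
      show ?thesis
        unfolding \<nu>(3)[OF s]
        by (rule integral_cong_AE) (use \<nu>(2)[of k] in \<open>auto simp: max_def min_def\<close>)
    qed
    moreover have "(\<integral>u. (min 1 (max 0 u)) powr s \<partial>N) = (\<integral>u. u powr s \<partial>N)"
      by (rule integral_cong_AE) (use ae in \<open>auto simp: max_def min_def\<close>)
    moreover have "(\<lambda>k. F (r k) s) \<longlonglongrightarrow> G s"
      using LIMSEQ_subseq_LIMSEQ[OF lim[OF s] r] by (simp add: comp_def)
    ultimately show ?thesis using LIMSEQ_unique by fastforce
  qed
  then show ?thesis unfolding sub_laplace_def using N ae by auto
qed

lemma sub_laplace_compound_geometric:
  assumes "sub_laplace G" "0 < p" "p \<le> 1"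
  shows "sub_laplace (\<lambda>s. p / (1 - (1 - p) * G s))"
proof (rule sub_laplace_cong)
  have "(\<lambda>k. p * (1 - p) ^ k) sums (p * (1 / (1 - (1 - p))))"
    by (intro sums_mult geometric_sums) (use assms in auto)
  then have "(\<lambda>k. p * (1 - p) ^ k) sums 1" using assms by simp
  then show "sub_laplace (\<lambda>s. \<Sum>k. p * (1 - p) ^ k * G s ^ k)"
    using assms by (intro sub_laplace_mixture sub_laplace_power) (auto simp: sums_iff)
  fix s :: real assume s: "s > 0"
  have b: "0 \<le> G s" "G s \<le> 1" using sub_laplace_bounds[OF assms(1) s] by auto
  have "(1 - p) * G s \<le> 1 - p" using b assms by (intro mult_left_le) auto
  then have "(\<lambda>k. p * ((1 - p) * G s) ^ k) sums (p * (1 / (1 - (1 - p) * G s)))"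
    by (intro sums_mult geometric_sums) (use assms b in auto)
  then show "(\<Sum>k. p * (1 - p) ^ k * G s ^ k) = p / (1 - (1 - p) * G s)"
    by (simp add: sums_iff power_mult_distrib mult_ac)
qed

text \<open>The transform at an independent exponential time of a compound Poisson process with rate \<open>g\<close>
plus a subordinator with exponent \<open>b\<close>. It is a limit of geometric compounds, in which one step of
length \<open>p\<close> runs the subordinator or, with probability \<open>g * p\<close>, makes a jump.\<close>
lemma sub_laplace_inverse:
  assumes G: "sub_laplace G" and b: "\<And>p. p > 0 \<Longrightarrow> sub_laplace (\<lambda>s. exp (- (p * b s)))"
    and g: "g \<ge> 0"
  shows "sub_laplace (\<lambda>s. 1 / (1 + g * (1 - G s) + b s))"
proof -
  define p where "p n = 1 / (real (Suc n) + g)" for n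
  have p0: "0 < p n" "p n \<le> 1" "g * p n \<le> 1" "0 \<le> g * p n" for n
    using g by (auto simp: p_def field_simps)
  define H where "H n s = (1 - g * p n) * exp (- (p n * b s)) + (g * p n) * G s" for n s
  have "sub_laplace (H n)" for n
    unfolding H_def using p0[of n] by (intro sub_laplace_convex b G) auto
  then have 1: "sub_laplace (\<lambda>s. p n / (1 - (1 - p n) * H n s))" for n
    using p0[of n] by (intro sub_laplace_compound_geometric) auto
  show ?thesis
  proof (rule sub_laplace_LIMSEQ[OF 1])
    fix s :: real assume s: "s > 0"
    have bs: "b s \<ge> 0"
      using sub_laplace_bounds(2)[OF b[of 1] s] by simp
    have Gs: "G s \<le> 1" using sub_laplace_bounds[OF G s] by simp
    have "filterlim p (at_right 0) sequentially"
    proof -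
      have "p \<longlonglongrightarrow> 0" unfolding p_def by real_asymp
      then show ?thesis using p0(1) by (auto simp: filterlim_at less_imp_neq[THEN not_sym])
    qed
    moreover have "((\<lambda>x. (1 - exp (- (x * b s))) / x) \<longlongrightarrow> b s) (at_right 0)"
    proof -
      have "((\<lambda>x. 1 - exp (- (x * b s))) has_field_derivative b s) (at 0)"
        by (auto intro!: derivative_eq_intros)
      then have "((\<lambda>x. (1 - exp (- (x * b s))) / x) \<longlongrightarrow> b s) (at 0)"
        by (simp add: DERIV_def)
      then show ?thesis by (rule tendsto_within_subset) auto
    qed
    ultimately have e: "(\<lambda>n. (1 - exp (- (p n * b s))) / p n) \<longlonglongrightarrow> b s"
      by (rule filterlim_compose[rotated])
    have pl: "p \<longlonglongrightarrow> 0" unfolding p_def by real_asymp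
    have "(\<lambda>n. 1 / (1 + (1 - p n) * (g * (1 - G s) + (1 - g * p n) * ((1 - exp (- (p n * b s))) / p n))))
       \<longlonglongrightarrow> 1 / (1 + (1 - 0) * (g * (1 - G s) + (1 - g * 0) * b s))"
      using g bs Gs by (intro tendsto_intros e pl) (auto simp: add_nonneg_eq_0_iff add_pos_nonneg
        intro!: add_pos_nonneg[THEN less_imp_neq, THEN not_sym])
    also have "(\<lambda>n. 1 / (1 + (1 - p n) * (g * (1 - G s) + (1 - g * p n) * ((1 - exp (- (p n * b s))) / p n))))
      = (\<lambda>n. p n / (1 - (1 - p n) * H n s))"
    proof
      fix n
      have "p n * (1 + (1 - p n) * (g * (1 - G s) + (1 - g * p n) * ((1 - exp (- (p n * b s))) / p n)))
        = 1 - (1 - p n) * H n s"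
        using p0[of n] by (simp add: H_def field_simps)
      then show "1 / (1 + (1 - p n) * (g * (1 - G s) + (1 - g * p n) * ((1 - exp (- (p n * b s))) / p n)))
        = p n / (1 - (1 - p n) * H n s)"
        using p0[of n] by (metis mult_cancel_left1 mult_divide_mult_cancel_left_if less_irrefl)
    qed
    finally show "(\<lambda>n. p n / (1 - (1 - p n) * H n s)) \<longlonglongrightarrow> 1 / (1 + g * (1 - G s) + b s)"
      by (simp add: add.assoc)
  qed
qed

lemma sub_laplace_compound_poisson:
  assumes "sub_laplace G" "0 \<le> l"
  shows "sub_laplace (\<lambda>s. exp (- (l * (1 - G s))))"
proof (rule sub_laplace_cong)
  have e: "(\<lambda>k. exp (- l) * (x ^ k / fact k)) sums (exp (- l) * exp x)" for x
    using exp_converges[of x] by (intro sums_mult) (simp add: divide_inverse mult.commute)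
  from e[of l] have "(\<lambda>k. exp (- l) * (l ^ k / fact k)) sums 1" by (simp add: exp_minus)
  then show "sub_laplace (\<lambda>s. \<Sum>k. exp (- l) * (l ^ k / fact k) * G s ^ k)"
    using assms by (intro sub_laplace_mixture sub_laplace_power) (auto simp: sums_iff)
  fix s :: real assume s: "s > 0"
  show "(\<Sum>k. exp (- l) * (l ^ k / fact k) * G s ^ k) = exp (- (l * (1 - G s)))"
    using e[of "l * G s"] by (simp add: sums_iff power_mult_distrib mult_ac exp_add[symmetric] algebra_simps)
qed

text \<open>Abel's theorem for nonnegative coefficients.\<close>
lemma nonneg_power_series_bound:
  fixes c :: "nat \<Rightarrow> real"
  assumes c: "\<And>k. c k \<ge> 0" and S: "\<And>z. 0 < z \<Longrightarrow> z < 1 \<Longrightarrow> (\<lambda>k. c k * z ^ k) sums S z"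
    and B: "\<And>z. 0 < z \<Longrightarrow> z < 1 \<Longrightarrow> S z \<le> B"
  shows "summable c" "suminf c \<le> B"
proof -
  have part: "(\<Sum>k<n. c k) \<le> B" for n
  proof (rule tendsto_upperbound)
    have "((\<lambda>z. \<Sum>k<n. c k * z ^ k) \<longlongrightarrow> (\<Sum>k<n. c k * 1 ^ k)) (at_left 1)"
      by (intro tendsto_intros)
    then show "((\<lambda>z. \<Sum>k<n. c k * z ^ k) \<longlongrightarrow> (\<Sum>k<n. c k)) (at_left 1)" by simp
    have "\<forall>\<^sub>F z in at_left (1::real). 0 < z \<and> z < 1"
      using eventually_at_left_real[of 0 1] by simp
    then show "\<forall>\<^sub>F z in at_left (1::real). (\<Sum>k<n. c k * z ^ k) \<le> B"
    proof eventually_elim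
      case (elim z)
      then have "(\<Sum>k<n. c k * z ^ k) \<le> S z"
        using sum_le_suminf[of "\<lambda>k. c k * z ^ k" "{..<n}"] S[of z] c by (auto simp: sums_iff)
      also have "\<dots> \<le> B" using B elim by auto
      finally show ?case .
    qed
  qed auto
  show s: "summable c"
    by (rule summableI_nonneg_bounded[OF c part])
  show "suminf c \<le> B" by (rule suminf_le_const[OF s part])
qed

text \<open>One-sided stable laws. For \<open>\<beta> < 1\<close> the function \<open>1 - (1 - z) powr \<beta>\<close> is the probability
generating function of Sibuya's law; Poisson compounds of this law, placed on a lattice of mesh
\<open>h\<close> and taken at rate \<open>x * h powr (- \<beta>)\<close>, converge to the stable law.\<close>
lemma sub_laplace_stable:
  assumes \<beta>: "0 < \<beta>" "\<beta> \<le> 1" and x: "x \<ge> 0"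
  shows "sub_laplace (\<lambda>s. exp (- (x * s powr \<beta>)))"
proof (cases "\<beta> = 1")
  case True
  show ?thesis by (rule sub_laplace_cong[OF _ sub_laplace_exp[OF x]]) (simp add: True mult.commute)
next
  case False
  with \<beta> have \<beta>1: "\<beta> < 1" by simp
  define c where "c k = (if k = 0 then 0 else - ((-1) ^ k * (\<beta> gchoose k)))" for k
  have c0: "c k \<ge> 0" for k
  proof (cases k)
    case (Suc m)
    have "(-1) ^ k * (\<beta> gchoose k) = pochhammer (- \<beta>) k / fact k"
      by (simp add: gbinomial_pochhammer power_mult_distrib[symmetric] flip: mult.assoc)
    also have "pochhammer (- \<beta>) k = - \<beta> * pochhammer (1 - \<beta>) m"
      by (simp add: Suc pochhammer_rec)
    finally show ?thesis
      using \<beta> \<beta>1 by (simp add: c_def Suc pochhammer_nonneg)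
  qed (simp add: c_def)
  have S: "(\<lambda>k. c k * z ^ k) sums (1 - (1 - z) powr \<beta>)" if "0 < z" "z < 1" for z
  proof -
    have "(\<lambda>k. (\<beta> gchoose k) * (- z) ^ k) sums (1 + - z) powr \<beta>"
      by (rule Generalised_Binomial_Theorem.gen_binomial_real) (use that in auto)
    then have "(\<lambda>k. (if k = 0 then 1 else 0) - (\<beta> gchoose k) * (- z) ^ k) sums (1 - (1 + - z) powr \<beta>)"
      by (intro sums_diff) (use sums_single[of 0 "\<lambda>_. 1::real"] in auto)
    also have "(\<lambda>k. (if k = 0 then 1 else 0) - (\<beta> gchoose k) * (- z) ^ k) = (\<lambda>k. c k * z ^ k)"
      by (auto simp: c_def fun_eq_iff power_minus[of z])
    finally show ?thesis by simp
  qed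
  have sm: "summable c" "suminf c \<le> 1"
    using nonneg_power_series_bound[OF c0 S, of 1] by simp_all
  define h where "h n = 1 / real (Suc n)" for n
  have h0: "h n > 0" for n by (simp add: h_def)
  have H: "sub_laplace (\<lambda>s. 1 - (1 - exp (- (h n * s))) powr \<beta>)" for n
  proof (rule sub_laplace_cong)
    show "sub_laplace (\<lambda>s. \<Sum>k. c k * exp (- (s * (h n * real k))))"
      by (intro sub_laplace_mixture sub_laplace_exp c0 sm) (use h0[of n] in auto)
    fix s :: real assume "s > 0"
    then show "(\<Sum>k. c k * exp (- (s * (h n * real k)))) = 1 - (1 - exp (- (h n * s))) powr \<beta>"
      using S[of "exp (- (h n * s))"] h0[of n]
      by (simp add: sums_iff exp_of_nat_mult[symmetric] mult_ac)
  qed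
  have 1: "sub_laplace (\<lambda>s. exp (- (x * h n powr (- \<beta>) * (1 - (1 - (1 - exp (- (h n * s))) powr \<beta>)))))" for n
    using x by (intro sub_laplace_compound_poisson H) auto
  show ?thesis
  proof (rule sub_laplace_LIMSEQ[OF 1])
    fix s :: real assume s: "s > 0"
    have "(\<lambda>n. (1 - exp (- (h n * s))) / h n) \<longlonglongrightarrow> s"
      unfolding h_def using s by real_asymp
    then have "(\<lambda>n. exp (- (x * ((1 - exp (- (h n * s))) / h n) powr \<beta>))) \<longlonglongrightarrow> exp (- (x * s powr \<beta>))"
      using s by (intro tendsto_intros) auto
    also have "(\<lambda>n. exp (- (x * ((1 - exp (- (h n * s))) / h n) powr \<beta>)))
       = (\<lambda>n. exp (- (x * h n powr (- \<beta>) * (1 - (1 - (1 - exp (- (h n * s))) powr \<beta>)))))"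
      using h0 s by (auto simp: fun_eq_iff powr_divide powr_minus divide_simps less_imp_le)
    finally show "\<dots> \<longlonglongrightarrow> exp (- (x * s powr \<beta>))" .
  qed
qed

section \<open>Products of laws and convolution powers\<close>

lemma pair_real_distribution:
  assumes "real_distribution M" "real_distribution N"
  shows "prob_space (M \<Otimes>\<^sub>M N)" "distr (M \<Otimes>\<^sub>M N) borel fst = M" "distr (M \<Otimes>\<^sub>M N) borel snd = N"
    "prob_space.indep_var (M \<Otimes>\<^sub>M N) borel fst borel snd"
proof -
  interpret M: real_distribution M by fact
  interpret N: real_distribution N by fact
  interpret pair_prob_space M N ..
  show "prob_space (M \<Otimes>\<^sub>M N)" by (rule prob_space_axioms)
  show fst: "distr (M \<Otimes>\<^sub>M N) borel fst = M"
    using N.distr_pair_fst[of M] by (metis M.events_eq_borel distr_cong)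
  show snd: "distr (M \<Otimes>\<^sub>M N) borel snd = N"
  proof (rule measure_eqI)
    fix A assume "A \<in> sets (distr (M \<Otimes>\<^sub>M N) borel snd)"
    then have A: "A \<in> sets borel" by simp
    have "emeasure (distr (M \<Otimes>\<^sub>M N) borel snd) A = emeasure (M \<Otimes>\<^sub>M N) (space M \<times> A)"
      using A by (subst emeasure_distr) (auto simp: space_pair_measure intro!: arg_cong[where f = "emeasure (M \<Otimes>\<^sub>M N)"])
    also have "\<dots> = emeasure N A"
      using A M.emeasure_space_1 by (subst N.emeasure_pair_measure_Times) auto
    finally show "emeasure (distr (M \<Otimes>\<^sub>M N) borel snd) A = emeasure N A" .
  qed simp
  show "indep_var borel fst borel snd"
    unfolding indep_var_distribution_eq fst snd
    by (auto intro!: distr_id2[symmetric] sets_pair_measure_cong)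
qed

lemma convolution_conv_distr: "M \<star> N = distr (M \<Otimes>\<^sub>M N) borel (\<lambda>z. fst z + snd z)"
  by (simp add: convolution_def split_beta')

lemma real_distribution_convolution:
  assumes "real_distribution M" "real_distribution N" shows "real_distribution (M \<star> N)"
proof -
  interpret M: real_distribution M by fact
  interpret N: real_distribution N by fact
  show ?thesis
    unfolding convolution_conv_distr
    by (rule prob_space.real_distribution_distr[OF pair_real_distribution(1)[OF assms]]) simp
qed

lemma real_distribution_return: "real_distribution (return borel (x::real))"
  by (simp add: real_distribution_def real_distribution_axioms_def prob_space_return)

lemma real_distribution_convolution_power:
  "real_distribution N \<Longrightarrow> real_distribution (convolution_power N n)"
  by (induction n) (auto intro: real_distribution_convolution real_distribution_return)

text \<open>Independent summands that lie in \<open>A\<close> and \<open>B\<close> have their sum in \<open>C\<close>.\<close>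
lemma measure_convolution_ge:
  assumes M: "real_distribution M" and N: "real_distribution N"
    and AB: "A \<in> sets borel" "B \<in> sets borel" "C \<in> sets borel" "\<And>x y. x \<in> A \<Longrightarrow> y \<in> B \<Longrightarrow> x + y \<in> C"
  shows "measure M A * measure N B \<le> measure (M \<star> N) C"
proof -
  interpret M: real_distribution M by fact
  interpret N: real_distribution N by fact
  interpret pair_prob_space M N ..
  have "measure M A * measure N B = measure (M \<Otimes>\<^sub>M N) (A \<times> B)"
    using AB by (simp add: measure_def N.emeasure_pair_measure_Times enn2real_mult)
  also have "\<dots> \<le> measure (M \<Otimes>\<^sub>M N) ((\<lambda>z. fst z + snd z) -` C \<inter> space (M \<Otimes>\<^sub>M N))"
    using AB by (intro finite_measure_mono measurable_sets[of _ _ borel]) (auto simp: space_pair_measure)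
  also have "\<dots> = measure (M \<star> N) C"
    unfolding convolution_conv_distr using AB by (subst measure_distr) auto
  finally show ?thesis .
qed

lemma convolution_power_tails:
  assumes N: "real_distribution N"
  shows "measure N {x..} ^ n \<le> measure (convolution_power N n) {real n * x..}"
    "measure N {..x} ^ n \<le> measure (convolution_power N n) {..real n * x}"
proof (induction n)
  case (Suc n)
  have P: "real_distribution (convolution_power N n)" by (rule real_distribution_convolution_power[OF N])
  have "measure N {x..} * measure N {x..} ^ n \<le> measure N {x..} * measure (convolution_power N n) {real n * x..}"
    by (intro mult_left_mono Suc) auto
  also have "\<dots> \<le> measure (convolution_power N (Suc n)) {real (Suc n) * x..}"
    unfolding convolution_power.simps
    by (intro measure_convolution_ge N P) (auto simp: algebra_simps)
  finally show "measure N {x..} ^ Suc n \<le> measure (convolution_power N (Suc n)) {real (Suc n) * x..}" by simp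
  have "measure N {..x} * measure N {..x} ^ n \<le> measure N {..x} * measure (convolution_power N n) {..real n * x}"
    by (intro mult_left_mono Suc) auto
  also have "\<dots> \<le> measure (convolution_power N (Suc n)) {..real (Suc n) * x}"
    unfolding convolution_power.simps
    by (intro measure_convolution_ge N P) (auto simp: algebra_simps)
  finally show "measure N {..x} ^ Suc n \<le> measure (convolution_power N (Suc n)) {..real (Suc n) * x}" by simp
qed (auto simp: measure_return)

section \<open>Laws on the half-line and their transforms\<close>

text \<open>The integer values of \<open>s\<close> give all moments. By Bernstein's approximation theorem the moments of a law on
the unit interval determine its integrals of continuous functions, in particular its
characteristic function.\<close>
lemma moments_unique:
  assumes M: "real_distribution M" "AE u in M. 0 \<le> u \<and> u \<le> 1"
    and N: "real_distribution N" "AE u in N. 0 \<le> u \<and> u \<le> 1"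
    and eq: "\<And>s. s > 0 \<Longrightarrow> (\<integral>u. u powr s \<partial>M) = (\<integral>u. u powr s \<partial>N)"
  shows "M = N"
proof -
  interpret M: real_distribution M by fact
  interpret N: real_distribution N by fact
  have intg: "integrable P h" if "real_distribution P" "AE u in P. 0 \<le> u \<and> u \<le> 1"
    "continuous_on UNIV h" for P and h :: "real \<Rightarrow> real"
  proof -
    interpret real_distribution P by fact
    have "compact (h ` {0..1})"
      using that(3) by (intro compact_continuous_image continuous_on_subset[OF that(3)]) auto
    then obtain B where B: "\<And>u. 0 \<le> u \<Longrightarrow> u \<le> 1 \<Longrightarrow> norm (h u) \<le> B"
      by (fastforce dest!: compact_imp_bounded simp: bounded_iff)
    have [measurable]: "h \<in> borel_measurable borel"
      using that(3) by (rule borel_measurable_continuous_onI)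
    show ?thesis
    proof (rule integrable_const_bound[where B = B])
      show "AE u in P. norm (h u) \<le> B"
        using that(2) by eventually_elim (use B in auto)
    qed simp
  qed
  have iM: "integrable M h" and iN: "integrable N h" if "continuous_on UNIV h" for h :: "real \<Rightarrow> real"
    using intg[OF M that] intg[OF N that] .
  have pw: "(\<integral>u. u ^ n \<partial>M) = (\<integral>u. u ^ n \<partial>N)" for n
  proof (cases "n = 0")
    case True
    then show ?thesis using M.prob_space N.prob_space by simp
  next
    case False
    have "(\<integral>u. u ^ n \<partial>P) = (\<integral>u. u powr (real n) \<partial>P)"
      if "real_distribution P" "AE u in P. 0 \<le> u \<and> u \<le> 1" for P
    proof -
      interpret real_distribution P by fact
      show ?thesis
      proof (rule integral_cong_AE)
        show "AE u in P. u ^ n = u powr real n"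
          using that(2) by eventually_elim (use False in \<open>simp add: powr_realpow'\<close>)
      qed auto
    qed
    from this[OF M] this[OF N] eq[of n] False show ?thesis by simp
  qed
  have bern: "(\<integral>u. u ^ k * (1 - u) ^ m \<partial>M) = (\<integral>u. u ^ k * (1 - u) ^ m \<partial>N)" for k m
  proof (induction m arbitrary: k)
    case (Suc m)
    have "(\<integral>u. u ^ k * (1 - u) ^ Suc m \<partial>P) = (\<integral>u. u ^ k * (1 - u) ^ m \<partial>P) - (\<integral>u. u ^ Suc k * (1 - u) ^ m \<partial>P)"
      if "real_distribution P" "AE u in P. 0 \<le> u \<and> u \<le> 1" for P
    proof -
      have "(\<integral>u. u ^ k * (1 - u) ^ Suc m \<partial>P) = (\<integral>u. u ^ k * (1 - u) ^ m - u ^ Suc k * (1 - u) ^ m \<partial>P)"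
        by (rule Bochner_Integration.integral_cong) (auto simp: algebra_simps)
      also have "\<dots> = (\<integral>u. u ^ k * (1 - u) ^ m \<partial>P) - (\<integral>u. u ^ Suc k * (1 - u) ^ m \<partial>P)"
        by (intro Bochner_Integration.integral_diff intg that continuous_intros)
      finally show ?thesis .
    qed
    from this[OF M] this[OF N] Suc[of k] Suc[of "Suc k"] show ?case by simp
  qed (use pw in simp)
  have cont: "(\<integral>u. f u \<partial>M) = (\<integral>u. f u \<partial>N)" if f: "continuous_on UNIV f" for f :: "real \<Rightarrow> real"
  proof -
    have "\<bar>(\<integral>u. f u \<partial>M) - (\<integral>u. f u \<partial>N)\<bar> \<le> 2 * e" if e: "e > 0" for e
    proof -
      from Bernstein_Weierstrass[OF continuous_on_subset[OF f] e]
      obtain n where n: "\<And>x. 0 \<le> x \<Longrightarrow> x \<le> 1 \<Longrightarrow> \<bar>f x - (\<Sum>k\<le>n. f (k / n) * Bernstein n k x)\<bar> < e"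
        by fastforce
      define b where "b x = (\<Sum>k\<le>n. f (k / n) * Bernstein n k x)" for x
      have bc: "continuous_on UNIV b"
        unfolding b_def Bernstein_def by (intro continuous_intros)
      have B: "(\<integral>u. Bernstein n k u \<partial>M) = (\<integral>u. Bernstein n k u \<partial>N)" for k
        unfolding Bernstein_def using bern[of k "n - k"] by (simp add: mult.assoc)
      have bk: "continuous_on UNIV (Bernstein n k)" for k
        unfolding Bernstein_def by (intro continuous_intros)
      have "(\<integral>u. b u \<partial>M) = (\<integral>u. b u \<partial>N)"
        unfolding b_def
        by (subst (1 2) Bochner_Integration.integral_sum)
          (auto simp: B intro!: iM iN continuous_intros bk)
      moreover have "\<bar>(\<integral>u. f u \<partial>P) - (\<integral>u. b u \<partial>P)\<bar> \<le> e"
        if P: "real_distribution P" "AE u in P. 0 \<le> u \<and> u \<le> 1" for P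
      proof -
        interpret real_distribution P by fact
        have "\<bar>(\<integral>u. f u \<partial>P) - (\<integral>u. b u \<partial>P)\<bar> = \<bar>\<integral>u. f u - b u \<partial>P\<bar>"
          by (subst Bochner_Integration.integral_diff) (auto intro!: intg P f bc)
        also have "\<dots> \<le> (\<integral>u. \<bar>f u - b u\<bar> \<partial>P)" by (rule integral_abs_bound)
        also have "\<dots> \<le> (\<integral>u. e \<partial>P)"
        proof (rule integral_mono_AE)
          show "AE u in P. \<bar>f u - b u\<bar> \<le> e"
            using P(2) by eventually_elim (use n in \<open>auto simp: b_def less_imp_le\<close>)
        qed (auto intro!: intg P continuous_intros f bc)
        finally show ?thesis using prob_space by simp
      qed
      from this[OF M] this[OF N] show ?thesis using calculation by linarith
    qed
    then have "\<bar>(\<integral>u. f u \<partial>M) - (\<integral>u. f u \<partial>N)\<bar> \<le> 0 + e" if "e > 0" for e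
      using that by (metis add_0 field_sum_of_halves mult_2 half_gt_zero)
    then show ?thesis using field_le_epsilon[of "\<bar>(\<integral>u. f u \<partial>M) - (\<integral>u. f u \<partial>N)\<bar>" 0] by simp
  qed
  have ch: "char P t = Complex (\<integral>u. cos (t * u) \<partial>P) (\<integral>u. sin (t * u) \<partial>P)"
    if "real_distribution P" for P t
  proof -
    interpret real_distribution P by fact
    have "integrable P (\<lambda>u. iexp (t * u))" using integrable_iexp by simp
    then show ?thesis
      unfolding char_def
      by (intro complex_eqI) (simp_all add: Re_exp Im_exp flip: integral_Re integral_Im)
  qed
  have "char M = char N"
    by (rule ext, subst (1 2) ch) (auto simp: M N intro!: arg_cong2[where f = Complex] cont continuous_intros)
  then show "M = N" by (rule Levy_uniqueness[OF M(1) N(1)])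
qed

text \<open>Transforms are compared at \<open>s > 0\<close> only, to match \<open>sub_laplace\<close>.\<close>
definition has_laplace :: "real measure \<Rightarrow> (real \<Rightarrow> real) \<Rightarrow> bool" where
  "has_laplace M F \<longleftrightarrow> real_distribution M \<and> (AE x in M. 0 \<le> x) \<and>
     (\<forall>s>0. F s = (\<integral>x. exp (- (s * x)) \<partial>M))"

lemma has_laplace_integrable:
  assumes "real_distribution M" "AE x in M. 0 \<le> x" "0 \<le> s"
  shows "integrable M (\<lambda>x. exp (- (s * x)) :: real)"
proof -
  interpret real_distribution M by fact
  show ?thesis
  proof (rule integrable_const_bound)
    show "AE x in M. norm (exp (- (s * x))) \<le> 1"
      using assms(2) by eventually_elim (use assms(3) in auto)
  qed auto
qed

lemma has_laplace_unique:
  assumes M: "has_laplace M F" and N: "has_laplace N G" and eq: "\<And>s. s > 0 \<Longrightarrow> F s = G s"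
  shows "M = N"
proof -
  define E where "E P = distr P borel (\<lambda>x::real. exp (- x))" for P :: "real measure"
  have 1: "real_distribution (E P)" "AE u in E P. 0 \<le> u \<and> u \<le> 1"
    "\<And>s. (\<integral>u. u powr s \<partial>E P) = (\<integral>x. exp (- (s * x)) \<partial>P)"
    "distr (E P) borel (\<lambda>u. - ln u) = P"
    if P: "real_distribution P" "AE x in P. 0 \<le> x" for P
  proof -
    interpret real_distribution P by fact
    show "real_distribution (E P)" unfolding E_def by (rule real_distribution_distr) simp
    show "AE u in E P. 0 \<le> u \<and> u \<le> 1"
      unfolding E_def using P(2) by (subst AE_distr_iff) auto
    show "(\<integral>u. u powr s \<partial>E P) = (\<integral>x. exp (- (s * x)) \<partial>P)" for s
      unfolding E_def by (subst integral_distr) (auto simp: exp_powr_real mult.commute)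
    show "distr (E P) borel (\<lambda>u. - ln u) = P"
      unfolding E_def by (subst distr_distr) (auto simp: comp_def distr_id2)
  qed
  have M': "real_distribution M" "AE x in M. 0 \<le> x" and N': "real_distribution N" "AE x in N. 0 \<le> x"
    using M N by (auto simp: has_laplace_def)
  have "E M = E N"
    using M N eq by (intro moments_unique 1 M' N') (auto simp: 1(3)[OF M'] 1(3)[OF N'] has_laplace_def)
  then show ?thesis using 1(4)[OF M'] 1(4)[OF N'] by metis
qed

lemma has_laplace_tendsto_1:
  assumes M: "has_laplace M F" shows "(F \<longlongrightarrow> 1) (at_right 0)"
proof -
  interpret real_distribution M using M by (simp add: has_laplace_def)
  have ae: "AE x in M. 0 \<le> x" using M by (simp add: has_laplace_def)
  have "((\<lambda>s. \<integral>x. exp (- (s * x)) \<partial>M) \<longlongrightarrow> (\<integral>x. 1 \<partial>M)) (at_right 0)"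
    unfolding tendsto_at_iff_sequentially
  proof (intro allI impI)
    fix S :: "nat \<Rightarrow> real" assume S: "\<forall>i. S i \<in> {0<..} - {0}" "S \<longlonglongrightarrow> 0"
    have "(\<lambda>i. \<integral>x. exp (- (S i * x)) \<partial>M) \<longlonglongrightarrow> (\<integral>x. 1 \<partial>M)"
    proof (rule integral_dominated_convergence[where w = "\<lambda>_. 1"])
      show "AE x in M. (\<lambda>i. exp (- (S i * x))) \<longlonglongrightarrow> 1"
      proof (intro AE_I2)
        fix x
        have "(\<lambda>i. exp (- (S i * x))) \<longlonglongrightarrow> exp (- (0 * x))" by (intro tendsto_intros S)
        then show "(\<lambda>i. exp (- (S i * x))) \<longlonglongrightarrow> 1" by simp
      qed
      show "AE x in M. norm (exp (- (S i * x))) \<le> 1" for i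
        using ae by eventually_elim (use S in \<open>auto simp: less_imp_le\<close>)
    qed auto
    then show "((\<lambda>s. \<integral>x. exp (- (s * x)) \<partial>M) \<circ> S) \<longlonglongrightarrow> (\<integral>x. 1 \<partial>M)" by (simp add: comp_def)
  qed
  also have "(\<integral>x. 1 \<partial>M) = (1::real)" using prob_space by simp
  finally show ?thesis
    by (rule Lim_transform_eventually)
      (use M in \<open>auto simp: has_laplace_def eventually_at_filter\<close>)
qed

text \<open>The limit at \<open>0\<close> is the mass of \<open>{0<..}\<close> under the law of \<open>U\<close>, that is, the mass that
is not at infinity.\<close>
lemma sub_laplace_imp_has_laplace:
  assumes F: "sub_laplace F" and lim: "(F \<longlongrightarrow> 1) (at_right 0)"
  shows "\<exists>M. has_laplace M F"
proof -
  obtain \<nu> where \<nu>: "real_distribution \<nu>" "AE u in \<nu>. 0 \<le> u \<and> u \<le> 1"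
    "\<And>s. s > 0 \<Longrightarrow> F s = (\<integral>u. u powr s \<partial>\<nu>)"
    using F unfolding sub_laplace_def by metis
  interpret real_distribution \<nu> by fact
  have "F s \<le> measure \<nu> {0<..}" if s: "0 < s" for s
  proof -
    have "(\<integral>u. u powr s \<partial>\<nu>) \<le> (\<integral>u. indicator {0<..} u \<partial>\<nu>)"
    proof (rule integral_mono_AE)
      show "AE u in \<nu>. u powr s \<le> indicator {0<..} u"
        using \<nu>(2) by eventually_elim (use s in \<open>auto simp: indicator_def powr_le1\<close>)
      show "integrable \<nu> (\<lambda>u. indicator {0<..} u :: real)"
        by (rule integrable_const_bound[where B = 1]) auto
    qed (rule integrable_powr_unit[OF \<nu>(1,2) s])
    then show ?thesis using \<nu>(3)[OF s] by simp
  qed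
  then have "1 \<le> measure \<nu> {0<..}"
    by (intro tendsto_upperbound[OF lim]) (auto simp: eventually_at_filter)
  then have "measure \<nu> {0<..} = 1" using prob_le_1[of "{0<..}"] by simp
  then have "AE u in \<nu>. u \<in> {0<..}" by (subst (asm) prob_eq_1) auto
  then have ae: "AE u in \<nu>. 0 < u \<and> u \<le> 1"
    using \<nu>(2) by eventually_elim auto
  define M where "M = distr \<nu> borel (\<lambda>u. - ln u)"
  have "real_distribution M" unfolding M_def by (rule real_distribution_distr) simp
  moreover have "AE x in M. 0 \<le> x"
    unfolding M_def
  proof (subst AE_distr_iff)
    show "AE u in \<nu>. 0 \<le> - ln u" using ae by eventually_elim simp
  qed auto
  moreover have "F s = (\<integral>x. exp (- (s * x)) \<partial>M)" if s: "0 < s" for s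
  proof -
    have "(\<integral>x. exp (- (s * x)) \<partial>M) = (\<integral>u. exp (s * ln u) \<partial>\<nu>)"
      unfolding M_def by (subst integral_distr) auto
    also have "\<dots> = (\<integral>u. u powr s \<partial>\<nu>)"
    proof (rule integral_cong_AE)
      show "AE u in \<nu>. exp (s * ln u) = u powr s"
        using ae by eventually_elim (simp add: powr_def)
    qed auto
    finally show ?thesis using \<nu>(3)[OF s] by simp
  qed
  ultimately show ?thesis unfolding has_laplace_def by blast
qed

lemma has_laplace_imp_sub_laplace:
  assumes "has_laplace M F" shows "sub_laplace F"
proof -
  interpret real_distribution M using assms by (simp add: has_laplace_def)
  show ?thesis
  proof (rule sub_laplaceI)
    show "prob_space M" by (rule prob_space_axioms)
    show "AE x in M. 0 \<le> exp (- x) \<and> exp (- x) \<le> 1"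
      using assms by (auto simp: has_laplace_def)
  qed (use assms in \<open>auto simp: has_laplace_def exp_powr_real mult.commute\<close>)
qed

lemma has_laplace_convolution:
  assumes M: "has_laplace M F" and N: "has_laplace N G"
  shows "has_laplace (M \<star> N) (\<lambda>s. F s * G s)"
proof -
  interpret M: real_distribution M using M by (simp add: has_laplace_def)
  interpret N: real_distribution N using N by (simp add: has_laplace_def)
  interpret pair_prob_space M N ..
  have aeM: "AE x in M. 0 \<le> x" and aeN: "AE x in N. 0 \<le> x"
    using M N by (auto simp: has_laplace_def)
  have ae: "AE z in M \<Otimes>\<^sub>M N. 0 \<le> fst z \<and> 0 \<le> snd z"
  proof (rule AE_pair_measure)
    show "AE x in M. AE y in N. 0 \<le> fst (x, y) \<and> 0 \<le> snd (x, y)"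
      using aeM
    proof eventually_elim
      case (elim x)
      show ?case using aeN by eventually_elim (use elim in simp)
    qed
  qed measurable
  have "real_distribution (M \<star> N)"
    using M N by (auto simp: has_laplace_def intro: real_distribution_convolution)
  moreover have "AE x in M \<star> N. 0 \<le> x"
    unfolding convolution_conv_distr
  proof (subst AE_distr_iff)
    show "AE z in M \<Otimes>\<^sub>M N. 0 \<le> fst z + snd z" using ae by eventually_elim simp
  qed auto
  moreover have "F s * G s = (\<integral>x. exp (- (s * x)) \<partial>(M \<star> N))" if s: "0 < s" for s
  proof -
    have "(\<integral>x. exp (- (s * x)) \<partial>(M \<star> N)) = (\<integral>z. exp (- (s * fst z)) * exp (- (s * snd z)) \<partial>(M \<Otimes>\<^sub>M N))"
      unfolding convolution_conv_distr by (subst integral_distr) (auto simp: exp_add[symmetric] algebra_simps)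
    also have "\<dots> = (\<integral>x. (\<integral>y. exp (- (s * x)) * exp (- (s * y)) \<partial>N) \<partial>M)"
    proof (subst integral_fst'[symmetric])
      show "integrable (M \<Otimes>\<^sub>M N) (\<lambda>z. exp (- (s * fst z)) * exp (- (s * snd z)))"
      proof (rule integrable_const_bound[where B=1])
        show "AE z in M \<Otimes>\<^sub>M N. norm (exp (- (s * fst z)) * exp (- (s * snd z))) \<le> 1"
          using ae
        proof eventually_elim
          case (elim z)
          then have "0 \<le> s * fst z" "0 \<le> s * snd z" using s by auto
          then show ?case by (simp add: exp_add[symmetric])
        qed
      qed measurable
    qed simp
    also have "\<dots> = F s * G s" using M N s by (simp add: has_laplace_def)
    finally show ?thesis ..
  qed
  ultimately show ?thesis unfolding has_laplace_def by blast
qed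

lemma has_laplace_scale:
  assumes M: "has_laplace M F" and c: "0 < c"
  shows "has_laplace (distr M borel (\<lambda>x. c * x)) (\<lambda>s. F (c * s))"
proof -
  interpret real_distribution M using M by (simp add: has_laplace_def)
  have "real_distribution (distr M borel (\<lambda>x. c * x))" by (rule real_distribution_distr) simp
  moreover have "AE x in distr M borel (\<lambda>x. c * x). 0 \<le> x"
    using M c by (subst AE_distr_iff) (auto simp: has_laplace_def zero_le_mult_iff)
  moreover have "F (c * s) = (\<integral>x. exp (- (s * x)) \<partial>distr M borel (\<lambda>x. c * x))" if "0 < s" for s
    using M c that by (subst integral_distr) (auto simp: has_laplace_def mult_ac)
  ultimately show ?thesis unfolding has_laplace_def by blast
qed

lemma has_laplace_convolution_power:
  assumes "has_laplace N F" shows "has_laplace (convolution_power N n) (\<lambda>s. F s ^ n)"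
proof (induction n)
  case 0
  show ?case by (simp add: has_laplace_def AE_return integral_return real_distribution_return)
next
  case (Suc n)
  then show ?case using has_laplace_convolution[OF assms Suc] by simp
qed

lemma has_laplace_pos:
  assumes M: "has_laplace M F" and s: "0 < s" shows "0 < F s"
proof -
  interpret real_distribution M using M by (simp add: has_laplace_def)
  have ae: "AE x in M. 0 \<le> x" and Fs: "F s = (\<integral>x. exp (- (s * x)) \<partial>M)"
    using M s by (auto simp: has_laplace_def)
  have i: "integrable M (\<lambda>x. exp (- (s * x)))"
    by (rule has_laplace_integrable[OF real_distribution_axioms ae]) (use s in simp)
  have "F s \<noteq> 0"
  proof
    assume "F s = 0"
    then have "AE x in M. exp (- (s * x)) = 0"
      unfolding Fs using i by (subst (asm) integral_nonneg_eq_0_iff_AE) auto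
    then have "AE x in M. False" by eventually_elim simp
    then show False using AE_False by simp
  qed
  moreover have "0 \<le> F s" unfolding Fs by simp
  ultimately show ?thesis by simp
qed

text \<open>The variance of \<open>exp (- X)\<close>, whose positivity detects that \<open>X\<close> is not constant.\<close>
lemma has_laplace_variance:
  assumes M: "has_laplace M F"
  shows "integrable M (\<lambda>x. (exp (- x) - F 1)\<^sup>2)"
    and "(\<integral>x. (exp (- x) - F 1)\<^sup>2 \<partial>M) = F 2 - F 1 ^ 2"
proof -
  interpret real_distribution M using M by (simp add: has_laplace_def)
  have ae: "AE x in M. 0 \<le> x" using M by (simp add: has_laplace_def)
  have i: "integrable M (\<lambda>x. exp (- x))" "integrable M (\<lambda>x. exp (- (2 * x)))"
    using has_laplace_integrable[OF real_distribution_axioms ae, of 1]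
      has_laplace_integrable[OF real_distribution_axioms ae, of 2] by simp_all
  have F: "F 1 = (\<integral>x. exp (- x) \<partial>M)" "F 2 = (\<integral>x. exp (- (2 * x)) \<partial>M)"
    using M by (auto simp: has_laplace_def)
  have eq: "(\<lambda>x. (exp (- x) - F 1)\<^sup>2) = (\<lambda>x. exp (- (2 * x)) - 2 * F 1 * exp (- x) + F 1 ^ 2)"
    by (auto simp: power2_eq_square algebra_simps exp_add[symmetric])
  show "integrable M (\<lambda>x. (exp (- x) - F 1)\<^sup>2)" unfolding eq using i by simp
  show "(\<integral>x. (exp (- x) - F 1)\<^sup>2 \<partial>M) = F 2 - F 1 ^ 2"
    unfolding eq using i prob_space by (simp add: F(2)) (simp add: F(1)[symmetric] power2_eq_square)
qed

section \<open>Self-decomposability and infinite divisibility from the transform\<close>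

text \<open>The quotient is the transform of the innovation \<open>X\<^sub>c\<close>; the probability space is the product
of the two laws.\<close>
lemma self_decomposable_laplace:
  assumes M: "has_laplace M F" and pos: "\<And>s. 0 < s \<Longrightarrow> 0 < F s"
    and quot: "\<And>c. 0 < c \<Longrightarrow> c < 1 \<Longrightarrow> sub_laplace (\<lambda>s. F s / F (c * s))"
  shows "self_decomposable M"
  unfolding self_decomposable_def
proof (intro conjI allI impI)
  show dM: "real_distribution M" using M by (simp add: has_laplace_def)
  then interpret M: real_distribution M .
  fix c :: real assume c: "0 < c \<and> c < 1"
  have "filterlim (\<lambda>s. c * s) (at_right 0) (at_right 0)"
    using c by real_asymp
  from filterlim_compose[OF has_laplace_tendsto_1[OF M] this]
  have "((\<lambda>s. F s / F (c * s)) \<longlongrightarrow> 1 / 1) (at_right 0)"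
    by (intro tendsto_divide has_laplace_tendsto_1[OF M]) auto
  then obtain N where N: "has_laplace N (\<lambda>s. F s / F (c * s))"
    using sub_laplace_imp_has_laplace[OF quot, of c] c by auto
  have dN: "real_distribution N" using N by (simp add: has_laplace_def)
  interpret N: real_distribution N by (rule dN)
  let ?\<Omega> = "M \<Otimes>\<^sub>M N"
  have "has_laplace (distr M borel (\<lambda>x. c * x) \<star> N) (\<lambda>s. F (c * s) * (F s / F (c * s)))"
    using c by (intro has_laplace_convolution has_laplace_scale M N) auto
  then have "distr M borel (\<lambda>x. c * x) \<star> N = M"
    by (rule has_laplace_unique[OF _ M]) (use pos c in \<open>simp add: less_imp_neq[THEN not_sym]\<close>)
  moreover have "distr M borel (\<lambda>x. c * x) \<star> N = distr ?\<Omega> borel (\<lambda>z. c * fst z + snd z)"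
  proof -
    have N': "distr N borel (\<lambda>x. x) = N" by (rule distr_id2) simp
    have "distr M borel (\<lambda>x. c * x) \<Otimes>\<^sub>M distr N borel (\<lambda>x. x) = distr ?\<Omega> (borel \<Otimes>\<^sub>M borel) (\<lambda>(x, y). (c * x, y))"
      by (rule pair_measure_distr) (auto simp: N' N.sigma_finite_measure)
    then show ?thesis
      unfolding convolution_def N' by (simp add: distr_distr comp_def split_beta')
  qed
  ultimately have "distr ?\<Omega> borel (\<lambda>z. c * fst z + snd z) = M" by simp
  moreover note pair_real_distribution[OF dM dN]
  ultimately show "\<exists>(\<Omega> :: (real \<times> real) measure) X Xc. prob_space \<Omega> \<and>
        prob_space.indep_var \<Omega> borel X borel Xc \<and> distr \<Omega> borel X = M \<and>
        distr \<Omega> borel (\<lambda>\<omega>. c * X \<omega> + Xc \<omega>) = M" by blast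
qed

lemma infinitely_divisible_laplace:
  assumes M: "has_laplace M F" and pos: "\<And>s. 0 < s \<Longrightarrow> 0 < F s"
    and root: "\<And>t. 0 < t \<Longrightarrow> sub_laplace (\<lambda>s. F s powr t)"
  shows "infinitely_divisible M"
  unfolding infinitely_divisible_def
proof (intro conjI allI impI)
  show "real_distribution M" using M by (simp add: has_laplace_def)
  fix n :: nat assume n: "1 \<le> n"
  have "((\<lambda>s. F s powr (1 / n)) \<longlongrightarrow> 1 powr (1 / n)) (at_right 0)"
    by (intro tendsto_powr tendsto_const has_laplace_tendsto_1[OF M]) auto
  then obtain N where N: "has_laplace N (\<lambda>s. F s powr (1 / n))"
    using sub_laplace_imp_has_laplace[OF root, of "1 / n"] n by auto
  have "M = convolution_power N n"
  proof (rule has_laplace_unique[OF M has_laplace_convolution_power[OF N]])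
    fix s :: real assume "0 < s"
    then show "F s = (F s powr (1 / n)) ^ n"
      using pos[of s] n by (simp add: powr_realpow[symmetric] powr_powr)
  qed
  then show "\<exists>N. real_distribution N \<and> M = convolution_power N n"
    using N by (auto simp: has_laplace_def)
qed

text \<open>A modulus of continuity on the multiplicative scale that does not depend on \<open>u\<close>, because
\<open>y * exp (- y) \<le> 1\<close>.\<close>
lemma sub_laplace_diff_bound:
  assumes F: "sub_laplace F" and c: "0 < c" "c \<le> 1" and u: "0 < u"
  shows "F (c * u) - F u \<le> (1 - c) / c"
proof -
  obtain \<nu> where \<nu>: "real_distribution \<nu>" "AE u in \<nu>. 0 \<le> u \<and> u \<le> 1"
    "\<And>s. s > 0 \<Longrightarrow> F s = (\<integral>u. u powr s \<partial>\<nu>)"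
    using F unfolding sub_laplace_def by metis
  interpret real_distribution \<nu> by fact
  have cu: "0 < c * u" using c u by simp
  have i: "integrable \<nu> (\<lambda>x. x powr (c * u))" "integrable \<nu> (\<lambda>x. x powr u)"
    using integrable_powr_unit[OF \<nu>(1,2)] cu u by auto
  have "F (c * u) - F u = (\<integral>x. x powr (c * u) - x powr u \<partial>\<nu>)"
    using i \<nu>(3)[OF cu] \<nu>(3)[OF u] by simp
  also have "\<dots> \<le> (\<integral>x. (1 - c) / c \<partial>\<nu>)"
  proof (rule integral_mono_AE)
    show "AE x in \<nu>. x powr (c * u) - x powr u \<le> (1 - c) / c"
      using \<nu>(2)
    proof eventually_elim
      case (elim x)
      show ?case
      proof (cases "x = 0")
        case False
        define y where "y = - (u * ln x)"
        have y: "0 \<le> y" using elim False u by (simp add: y_def mult_le_0_iff)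
        have e: "x powr (c * u) = exp (- (c * y))" "x powr u = exp (- y)"
          using False by (auto simp: powr_def y_def mult_ac)
        have "exp (- (c * y)) - exp (- y) = exp (- (c * y)) * (1 - exp (- ((1 - c) * y)))"
          by (simp add: algebra_simps exp_add[symmetric])
        also have "\<dots> \<le> exp (- (c * y)) * ((1 - c) * y)"
          using exp_ge_add_one_self[of "- ((1 - c) * y)"] by (intro mult_left_mono) auto
        also have "\<dots> = (1 - c) / c * (exp (- (c * y)) * (c * y))" using c by simp
        also have "\<dots> \<le> (1 - c) / c * 1"
        proof (rule mult_left_mono)
          show "exp (- (c * y)) * (c * y) \<le> 1"
          proof -
            have "c * y \<le> exp (c * y)" using exp_ge_add_one_self[of "c * y"] by linarith
            then show ?thesis by (simp add: exp_minus field_simps)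
          qed
        qed (use c in auto)
        finally show ?thesis unfolding e by simp
      qed (use c in auto)
    qed
  qed (use i in auto)
  finally show ?thesis using prob_space by simp
qed

text \<open>Let \<open>c\<close> tend to \<open>1\<close> and let \<open>\<rho> j\<close> be the quotients \<open>F (c ^ j * s) / F (c ^ Suc j * s)\<close>. Their
product over sufficiently many \<open>j\<close> tends to \<open>F s\<close>, and they tend to \<open>1\<close> uniformly in \<open>j\<close>, so
the sum of \<open>1 - \<rho> j\<close> has the same limit as the sum of \<open>- ln (\<rho> j)\<close>. Hence \<open>F s powr t\<close> is the limit of
products of the compound Poisson transforms \<open>exp (- (t * (1 - \<rho> j)))\<close>.\<close>
lemma sub_laplace_powr_of_quotients:
  assumes F: "sub_laplace F" and lim0: "(F \<longlongrightarrow> 1) (at_right 0)" and pos: "\<And>s. 0 < s \<Longrightarrow> 0 < F s"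
    and quot: "\<And>c. 0 < c \<Longrightarrow> c < 1 \<Longrightarrow> sub_laplace (\<lambda>s. F s / F (c * s))"
    and t: "0 < t"
  shows "sub_laplace (\<lambda>s. F s powr t)"
proof -
  define c where "c m = exp (- (1 / real (Suc m)))" for m
  have c: "0 < c m" "c m < 1" for m by (auto simp: c_def)
  define \<rho> where "\<rho> m j s = F (c m ^ j * s) / F (c m ^ Suc j * s)" for m j s
  \<comment> \<open>The power \<open>c m ^ K m = exp (- real (Suc m))\<close> still tends to \<open>0\<close>.\<close>
  define K where "K m = Suc m * Suc m" for m
  have r: "sub_laplace (\<rho> m j)" for m j
  proof -
    have "sub_laplace (\<lambda>s. F (c m ^ j * s) / F (c m * (c m ^ j * s)))"
      using sub_laplace_scale[OF quot[OF c], of "c m ^ j" m] c[of m] by simp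
    then show ?thesis unfolding \<rho>_def by (simp add: mult.assoc)
  qed
  have 1: "sub_laplace (\<lambda>s. \<Prod>j<K m. exp (- (t * (1 - \<rho> m j s))))" for m
    using t by (intro sub_laplace_prod sub_laplace_compound_poisson r) auto
  show ?thesis
  proof (rule sub_laplace_LIMSEQ[OF 1])
    fix s :: real assume s: "0 < s"
    have cs: "0 < c m ^ j * s" for m j using c[of m] s by simp
    have F1: "F (c m ^ j * s) \<le> 1" "0 < F (c m ^ j * s)" for m j
      using sub_laplace_bounds(2)[OF F cs] pos[OF cs] by auto
    have \<rho>01: "0 < \<rho> m j s" "\<rho> m j s \<le> 1" for m j
      using sub_laplace_bounds(2)[OF r s, of m j] F1(2)[of m j] F1(2)[of m "Suc j"] by (auto simp: \<rho>_def)
    have Fs: "F s \<le> F (c m ^ j * s)" for m j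
    proof (induction j)
      case (Suc j)
      have "F (c m ^ j * s) \<le> F (c m ^ Suc j * s)"
        using \<rho>01(2)[of m j] F1(2)[of m "Suc j"] by (simp add: \<rho>_def)
      with Suc show ?case by (rule order_trans)
    qed simp
    define \<eta> where "\<eta> m = (1 - c m) / c m / F s" for m
    have \<rho>\<eta>: "1 - \<rho> m j s \<le> \<eta> m" for m j
    proof -
      have "1 - \<rho> m j s = (F (c m * (c m ^ j * s)) - F (c m ^ j * s)) / F (c m ^ Suc j * s)"
        using F1(2)[of m "Suc j"] by (simp add: \<rho>_def diff_divide_distrib mult.assoc)
      also have "\<dots> \<le> ((1 - c m) / c m) / F s"
        using sub_laplace_diff_bound[OF F c(1) less_imp_le[OF c(2)] cs, of m m j] Fs[of m "Suc j"] pos[OF s] c[of m]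
        by (intro frac_le) auto
      finally show ?thesis by (simp add: \<eta>_def)
    qed
    have clim: "c \<longlonglongrightarrow> 1" unfolding c_def by real_asymp
    have \<eta>0: "\<eta> \<longlonglongrightarrow> 0"
    proof -
      have "\<eta> \<longlonglongrightarrow> (1 - 1) / 1 / F s"
        unfolding \<eta>_def using pos[OF s] by (intro tendsto_intros clim) auto
      then show ?thesis by simp
    qed
    define S where "S m = (\<Sum>j<K m. 1 - \<rho> m j s)" for m
    define L where "L m = (\<Sum>j<K m. - ln (\<rho> m j s))" for m
    have L: "L m = ln (F (c m ^ K m * s)) - ln (F s)" for m
    proof -
      have "- ln (\<rho> m j s) = ln (F (c m ^ Suc j * s)) - ln (F (c m ^ j * s))" for j
        using F1(2)[of m j] F1(2)[of m "Suc j"] unfolding \<rho>_def by (subst ln_divide_pos) auto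
      then show ?thesis
        using sum_lessThan_telescope[of "\<lambda>j. ln (F (c m ^ j * s))" "K m"] by (simp only: L_def) simp
    qed
    have "L \<longlonglongrightarrow> ln 1 - ln (F s)"
    proof -
      have "c m ^ K m = exp (- real (Suc m))" for m
      proof -
        have "c m ^ K m = exp (real (K m) * - (1 / real (Suc m)))"
          unfolding c_def by (rule exp_of_nat_mult[symmetric])
        also have "real (K m) * - (1 / real (Suc m)) = - real (Suc m)"
          by (simp only: K_def of_nat_mult) simp
        finally show ?thesis .
      qed
      then have "filterlim (\<lambda>m. c m ^ K m * s) (at_right 0) sequentially"
        using s by simp real_asymp
      from filterlim_compose[OF lim0 this]
      show ?thesis unfolding L by (intro tendsto_intros) auto
    qed
    then have Llim: "L \<longlonglongrightarrow> - ln (F s)" by simp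
    have SL: "S m \<le> L m" for m
      unfolding S_def L_def using \<rho>01 ln_le_minus_one by (intro sum_mono) (metis minus_diff_eq neg_le_iff_le)
    have LS: "(1 - \<eta> m) * L m \<le> S m" for m
      unfolding S_def L_def sum_distrib_left
    proof (rule sum_mono)
      fix j
      have "- ln (\<rho> m j s) = ln (1 / \<rho> m j s)" using \<rho>01 by (simp add: ln_div)
      also have "\<dots> \<le> 1 / \<rho> m j s - 1" using \<rho>01[of m j] by (intro ln_le_minus_one) auto
      finally have "\<rho> m j s * - ln (\<rho> m j s) \<le> \<rho> m j s * (1 / \<rho> m j s - 1)"
        using \<rho>01[of m j] by (intro mult_left_mono) auto
      also have "\<dots> = 1 - \<rho> m j s" using \<rho>01(1)[of m j] by (simp add: field_simps)
      also have "(1 - \<eta> m) * - ln (\<rho> m j s) \<le> \<rho> m j s * - ln (\<rho> m j s)"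
        using \<rho>\<eta>[of m j] \<rho>01[of m j] by (intro mult_right_mono) auto
      finally (xtrans) show "(1 - \<eta> m) * - ln (\<rho> m j s) \<le> 1 - \<rho> m j s" by simp
    qed
    have "S \<longlonglongrightarrow> - ln (F s)"
    proof (rule tendsto_sandwich[OF _ _ _ Llim])
      have "(\<lambda>m. (1 - \<eta> m) * L m) \<longlonglongrightarrow> (1 - 0) * - ln (F s)" by (intro tendsto_intros \<eta>0 Llim)
      then show "(\<lambda>m. (1 - \<eta> m) * L m) \<longlonglongrightarrow> - ln (F s)" by simp
    qed (use SL LS in auto)
    then have "(\<lambda>m. exp (- (t * S m))) \<longlonglongrightarrow> exp (- (t * - ln (F s)))" by (intro tendsto_intros)
    moreover have "exp (- (t * S m)) = (\<Prod>j<K m. exp (- (t * (1 - \<rho> m j s))))" for m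
      by (simp add: S_def exp_sum[symmetric] sum_distrib_left sum_negf)
    ultimately show "(\<lambda>m. \<Prod>j<K m. exp (- (t * (1 - \<rho> m j s)))) \<longlonglongrightarrow> F s powr t"
      using pos[OF s] by (simp add: powr_def)
  qed
qed

section \<open>A lattice approximation of the Frechet transform\<close>

definition qexp_partial :: "real \<Rightarrow> nat \<Rightarrow> real \<Rightarrow> real" where
  "qexp_partial c n s = (\<Prod>j<n. 1 / (1 + s * (1 - c) * c ^ j))"

text \<open>Euler's \<open>q\<close>-exponential function at \<open>- s\<close>, with base \<open>c\<close>. It satisfies the difference equation
\<open>qexp_mult\<close> in place of the differential equation of \<open>exp (- s)\<close>.\<close>
definition qexp :: "real \<Rightarrow> real \<Rightarrow> real" where
  "qexp c s = lim (\<lambda>n. qexp_partial c n s)"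

lemma one_minus_mult_sum_power: "(1 - c) * (\<Sum>j<n. c ^ j) = 1 - (c::real) ^ n"
  by (simp add: one_diff_power_eq)

context
  fixes c s :: real
  assumes c: "0 < c" "c < 1" and s: "0 \<le> s"
begin

lemma qexp_partial_ge: "exp (- s) \<le> qexp_partial c n s"
proof -
  have "exp (- s) \<le> exp (- (s * (1 - c ^ n)))"
    using c s by (auto intro!: mult_left_le power_le_one)
  also have "s * (1 - c ^ n) = (\<Sum>j<n. s * (1 - c) * c ^ j)"
    by (simp add: sum_distrib_left[symmetric] one_minus_mult_sum_power mult.assoc)
  also have "exp (- \<dots>) = (\<Prod>j<n. exp (- (s * (1 - c) * c ^ j)))"
    by (simp add: exp_sum[symmetric] sum_negf)
  also have "\<dots> \<le> (\<Prod>j<n. 1 / (1 + s * (1 - c) * c ^ j))"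
  proof (intro prod_mono conjI)
    fix j
    define x where "x = s * (1 - c) * c ^ j"
    have "0 \<le> x" using c s by (simp add: x_def)
    then have "exp (- x) \<le> 1 / (1 + x)"
      using exp_ge_add_one_self[of x] by (simp add: exp_minus field_simps)
    then show "exp (- (s * (1 - c) * c ^ j)) \<le> 1 / (1 + s * (1 - c) * c ^ j)"
      by (simp add: x_def)
  qed auto
  finally show ?thesis by (simp add: qexp_partial_def)
qed

lemma qexp_partial_le: "qexp_partial c n s \<le> exp (- (s * (1 - c ^ n) / (1 + s * (1 - c))))"
proof -
  have "qexp_partial c n s \<le> (\<Prod>j<n. exp (- (s * (1 - c) * c ^ j / (1 + s * (1 - c)))))"
    unfolding qexp_partial_def
  proof (intro prod_mono conjI)
    fix j
    define x where "x = s * (1 - c) * c ^ j"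
    have x: "0 \<le> x" "x \<le> s * (1 - c)" using c s by (auto simp: x_def intro!: mult_left_le power_le_one)
    then show "0 \<le> 1 / (1 + s * (1 - c) * c ^ j)" by (simp add: x_def)
    have "1 / (1 + x) = 1 + - (x / (1 + x))" using x by (simp add: field_simps)
    also have "\<dots> \<le> exp (- (x / (1 + x)))" by (rule exp_ge_add_one_self)
    also have "\<dots> \<le> exp (- (x / (1 + s * (1 - c))))" using x by (simp add: frac_le)
    finally show "1 / (1 + s * (1 - c) * c ^ j) \<le> exp (- (s * (1 - c) * c ^ j / (1 + s * (1 - c))))"
      by (simp add: x_def)
  qed
  also have "\<dots> = exp (- ((\<Sum>j<n. s * (1 - c) * c ^ j) / (1 + s * (1 - c))))"
    by (simp add: exp_sum[symmetric] sum_negf sum_divide_distrib)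
  also have "(\<Sum>j<n. s * (1 - c) * c ^ j) = s * (1 - c ^ n)"
    by (simp add: sum_distrib_left[symmetric] one_minus_mult_sum_power mult.assoc)
  finally show ?thesis .
qed

lemma qexp_partial_LIMSEQ: "(\<lambda>n. qexp_partial c n s) \<longlonglongrightarrow> qexp c s"
proof -
  have "decseq (\<lambda>n. qexp_partial c n s)"
  proof (rule decseq_SucI)
    fix n
    have "0 \<le> s * (1 - c) * c ^ n" using c s by simp
    then have "1 / (1 + s * (1 - c) * c ^ n) \<le> 1" by (simp add: field_simps)
    moreover have "0 \<le> qexp_partial c n s" using qexp_partial_ge[of n] exp_ge_zero by (rule order_trans[rotated])
    ultimately show "qexp_partial c (Suc n) s \<le> qexp_partial c n s"
      unfolding qexp_partial_def prod.lessThan_Suc by (rule mult_left_le)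
  qed
  then obtain L where "(\<lambda>n. qexp_partial c n s) \<longlonglongrightarrow> L"
    using decseq_convergent[of _ "exp (- s)"] qexp_partial_ge by blast
  then show ?thesis by (simp add: qexp_def limI)
qed

lemma qexp_ge: "exp (- s) \<le> qexp c s"
  by (rule LIMSEQ_le_const[OF qexp_partial_LIMSEQ]) (use qexp_partial_ge in auto)

lemma qexp_le: "qexp c s \<le> exp (- (s / (1 + s * (1 - c))))"
proof -
  have "0 \<le> s * (1 - c)" using c s by simp
  then have nz: "1 + s * (1 - c) \<noteq> 0" by linarith
  have "(\<lambda>n. exp (- (s * (1 - c ^ n) / (1 + s * (1 - c))))) \<longlonglongrightarrow> exp (- (s * (1 - 0) / (1 + s * (1 - c))))"
    using c nz by (intro tendsto_intros LIMSEQ_power_zero) auto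
  from LIMSEQ_le[OF qexp_partial_LIMSEQ this] qexp_partial_le show ?thesis by auto
qed

lemma qexp_pos: "0 < qexp c s"
  using qexp_ge exp_gt_zero by (rule less_le_trans[rotated])

lemma qexp_le_1: "qexp c s \<le> 1"
proof -
  have "0 \<le> s / (1 + s * (1 - c))" using c s by (intro divide_nonneg_nonneg) auto
  then show ?thesis by (intro order_trans[OF qexp_le]) simp
qed

text \<open>Put \<open>y = s / (1 + s * (1 - c))\<close>; the gap is at most \<open>exp (- y) - exp (- s)\<close>. If
\<open>s * (1 - c) \<le> 1\<close>, then \<open>s / 2 \<le> y\<close> and \<open>s - y \<le> (1 - c) * s\<^sup>2\<close>, so the gap is at most
\<open>(1 - c) * s\<^sup>2 * exp (- s / 2)\<close>. For larger \<open>s\<close> even \<open>exp (- y)\<close> is at most \<open>2 * (1 - c)\<close>.\<close>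
lemma qexp_minus_exp: "\<bar>qexp c s - exp (- s)\<bar> \<le> 8 * (1 - c)"
proof -
  define \<delta> where "\<delta> = 1 - c"
  have \<delta>: "0 < \<delta>" "0 \<le> s * \<delta>" using c s by (auto simp: \<delta>_def)
  define y where "y = s / (1 + s * \<delta>)"
  have "qexp c s - exp (- s) \<le> 8 * \<delta>"
  proof (cases "s * \<delta> \<le> 1")
    case True
    have "0 < 1 + s * \<delta>" using \<delta> by linarith
    then have "s / 2 \<le> y" unfolding y_def using True s by (intro divide_left_mono mult_pos_pos) auto
    have "s * (1 + s * \<delta>) - s = s * s * \<delta>" by (simp add: algebra_simps)
    then have sy: "s - y = s * s * \<delta> / (1 + s * \<delta>)"
      unfolding y_def using \<delta> by (simp add: field_simps)
    then have "0 \<le> s - y" using \<delta> s by simp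
    have sy': "s - y \<le> s * s * \<delta>"
      using divide_left_mono[of 1 "1 + s * \<delta>" "s * s * \<delta>"] \<delta> s \<open>0 < 1 + s * \<delta>\<close>
      unfolding sy by simp
    have "1 - (s - y) \<le> exp (- (s - y))" using exp_ge_add_one_self[of "- (s - y)"] by linarith
    then have "exp (- y) * (1 - exp (- (s - y))) \<le> exp (- y) * (s - y)"
      by (intro mult_left_mono) auto
    also have "exp (- y) * (1 - exp (- (s - y))) = exp (- y) - exp (- s)"
      by (simp add: algebra_simps exp_add[symmetric])
    also have "exp (- y) * (s - y) \<le> exp (- (s / 2)) * (s * s * \<delta>)"
      using sy' \<open>s / 2 \<le> y\<close> \<open>0 \<le> s - y\<close> \<delta> s by (intro mult_mono) auto
    also have "\<dots> \<le> 8 * \<delta>"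
    proof -
      have "1 + s / 2 + (s / 2)\<^sup>2 / 2 \<le> exp (s / 2)" using s by (intro exp_lower_Taylor_quadratic) auto
      then have "s * s \<le> 8 * exp (s / 2)" using s by (simp add: power2_eq_square field_simps)
      then have "exp (- (s / 2)) * (s * s) \<le> 8" by (simp add: exp_minus field_simps)
      then have "exp (- (s / 2)) * (s * s) * \<delta> \<le> 8 * \<delta>" using \<delta> by (intro mult_right_mono) auto
      then show ?thesis by (simp add: mult.assoc)
    qed
    finally show ?thesis using qexp_le by (simp add: y_def \<delta>_def)
  next
    case False
    then have "1 / (2 * \<delta>) \<le> y"
      unfolding y_def using \<delta> s by (simp add: field_simps)
    then have "exp (- y) \<le> exp (- (1 / (2 * \<delta>)))" by simp
    also have "\<dots> \<le> 2 * \<delta>"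
      using exp_ge_add_one_self[of "1 / (2 * \<delta>)"] \<delta> by (simp add: exp_minus field_simps)
    finally have "exp (- y) \<le> 2 * \<delta>" .
    with qexp_le have "qexp c s \<le> 2 * \<delta>" unfolding y_def \<delta>_def by (rule order_trans)
    then show ?thesis using \<delta>(1) exp_gt_zero[of "- s"] by linarith
  qed
  then show ?thesis using qexp_ge by (simp add: \<delta>_def)
qed

lemma qexp_mult: "qexp c (c * s) = (1 + s * (1 - c)) * qexp c s"
proof -
  have "0 \<le> s * (1 - c)" using c s by simp
  then have nz: "1 + s * (1 - c) \<noteq> 0" by linarith
  have "(\<lambda>n. (1 + s * (1 - c)) * qexp_partial c (Suc n) s) \<longlonglongrightarrow> (1 + s * (1 - c)) * qexp c s"
    by (intro tendsto_intros LIMSEQ_Suc qexp_partial_LIMSEQ)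
  also have "(\<lambda>n. (1 + s * (1 - c)) * qexp_partial c (Suc n) s) = (\<lambda>n. qexp_partial c n (c * s))"
    using nz by (auto simp: qexp_partial_def prod.lessThan_Suc_shift fun_eq_iff mult_ac simp del: prod.lessThan_Suc)
  finally show ?thesis
    unfolding qexp_def[of c "c * s"] by (metis limI)
qed

end

text \<open>All terms are nonnegative, so the order of summation can be exchanged in the extended
nonnegative reals.\<close>
lemma suminf_shifted_convolution:
  fixes a w x :: "nat \<Rightarrow> real"
  assumes a: "\<And>n. 0 \<le> a n" "summable a" and w: "\<And>n. 0 \<le> w n" "summable w"
    and x: "\<And>n. 0 \<le> x n" "\<And>n. x n \<le> B"
  shows "(\<lambda>m. x m * (\<Sum>n<m. a n * w (m - Suc n))) sums (\<Sum>n. a n * (\<Sum>j. w j * x (j + Suc n)))"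
proof -
  have B: "0 \<le> B" using x(1)[of 0] x(2)[of 0] by simp
  define g where "g n m = (if n < m then a n * w (m - Suc n) * x m else 0)" for n m
  have g0: "g n m \<ge> 0" for n m using a w x by (simp add: g_def)
  have sw: "summable (\<lambda>j. w j * x (j + k))" for k
    by (rule summable_comparison_test'[OF summable_mult[OF w(2), of B], of 0])
      (use w x B in \<open>auto simp: abs_mult mult.commute[of B] intro!: mult_left_mono\<close>)
  have inner: "(\<lambda>m. g n m) sums (a n * (\<Sum>j. w j * x (j + Suc n)))" for n
  proof -
    have "(\<lambda>j. a n * (w j * x (j + Suc n))) sums (a n * (\<Sum>j. w j * x (j + Suc n)))"
      by (intro sums_mult summable_sums sw)
    also have "(\<lambda>j. a n * (w j * x (j + Suc n))) = (\<lambda>j. g n (j + Suc n))"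
      by (simp add: g_def mult.assoc)
    finally have "(\<lambda>j. g n (j + Suc n)) sums (a n * (\<Sum>j. w j * x (j + Suc n)))" .
    moreover have "(\<Sum>m<Suc n. g n m) = 0" by (simp add: g_def)
    ultimately show ?thesis unfolding sums_iff_shift by simp
  qed
  define S where "S n = a n * (\<Sum>j. w j * x (j + Suc n))" for n
  have S0: "0 \<le> S n" for n unfolding S_def using a w x by (intro mult_nonneg_nonneg suminf_nonneg sw) auto
  have sS: "summable S"
  proof (rule summable_comparison_test'[OF summable_mult2[OF a(2), of "suminf w * B"], of 0])
    fix n
    have "(\<Sum>j. w j * x (j + Suc n)) \<le> (\<Sum>j. w j * B)"
      using w x by (intro suminf_le sw summable_mult2 mult_left_mono) auto
    then show "norm (S n) \<le> a n * (suminf w * B)"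
      using S0[of n] a w(2) by (auto simp: S_def suminf_mult2[symmetric] intro!: mult_left_mono)
  qed
  have col: "(\<lambda>n. g n m) sums (x m * (\<Sum>n<m. a n * w (m - Suc n)))" for m
  proof -
    have "(\<lambda>n. g n m) sums (\<Sum>n<m. g n m)"
      by (rule sums_finite) (auto simp: g_def)
    then show ?thesis by (simp add: g_def sum_distrib_left mult_ac)
  qed
  have "(\<Sum>m. ennreal (x m * (\<Sum>n<m. a n * w (m - Suc n)))) = (\<Sum>m. \<Sum>n. ennreal (g n m))"
    using col g0 by (intro suminf_cong suminf_ennreal_eq[symmetric])
  also have "\<dots> = (\<integral>\<^sup>+m. (\<Sum>n. ennreal (g n m)) \<partial>count_space UNIV)"
    by (simp add: nn_integral_count_space_nat)
  also have "\<dots> = (\<Sum>n. \<integral>\<^sup>+m. ennreal (g n m) \<partial>count_space UNIV)"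
    by (rule nn_integral_suminf) simp
  also have "\<dots> = (\<Sum>n. \<Sum>m. ennreal (g n m))"
    by (simp add: nn_integral_count_space_nat)
  also have "\<dots> = (\<Sum>n. ennreal (S n))"
    using inner g0 unfolding S_def by (intro suminf_cong suminf_ennreal_eq)
  also have "\<dots> = ennreal (suminf S)"
    by (intro suminf_ennreal2 S0 sS)
  finally have e: "(\<Sum>m. ennreal (x m * (\<Sum>n<m. a n * w (m - Suc n)))) = ennreal (suminf S)" .
  have p0: "0 \<le> x m * (\<Sum>n<m. a n * w (m - Suc n))" for m
    using a w x by (intro mult_nonneg_nonneg sum_nonneg) auto
  have "(\<lambda>m. x m * (\<Sum>n<m. a n * w (m - Suc n))) sums suminf S"
  proof -
    have "summable (\<lambda>m. x m * (\<Sum>n<m. a n * w (m - Suc n)))"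
      by (rule summable_suminf_not_top[OF p0]) (simp add: e)
    then show ?thesis
      using e p0 by (simp add: suminf_ennreal2 suminf_nonneg S0 sS sums_iff)
  qed
  then show ?thesis unfolding S_def[abs_def] .
qed

definition qfact :: "real \<Rightarrow> nat \<Rightarrow> real" where
  "qfact q n = (\<Prod>i<n. 1 - q ^ Suc i)"

definition qweight :: "real \<Rightarrow> nat \<Rightarrow> real" where
  "qweight q j = q ^ j / qfact q j"

lemma qfact_0 [simp]: "qfact q 0 = 1" by (simp add: qfact_def)

lemma qfact_Suc: "qfact q (Suc n) = qfact q n * (1 - q ^ Suc n)"
  by (simp add: qfact_def)

lemma qweight_0 [simp]: "qweight q 0 = 1" by (simp add: qweight_def)

locale q_parameter =
  fixes q :: real
  assumes q: "0 < q" "q < 1"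
begin

lemma q_power: "0 < q ^ n" "q ^ Suc n < 1" "q ^ n \<le> 1"
  using q by (auto intro: power_Suc_less_one power_le_one simp del: power_Suc)

lemma qfact_pos: "0 < qfact q n"
  unfolding qfact_def using q_power(2) by (intro prod_pos) (simp del: power_Suc)

lemma qweight_pos: "0 < qweight q j"
  using q qfact_pos by (simp add: qweight_def)

lemma qweight_Suc: "(1 - q ^ Suc j) * qweight q (Suc j) = q * qweight q j"
  using q_power(2)[of j] qfact_pos[of j] by (simp add: qweight_def qfact_Suc)

lemma sum_qweight: "(\<Sum>i\<le>j. qweight q i) = 1 / qfact q j"
proof (induction j)
  case (Suc j)
  have "1 / qfact q j + qweight q (Suc j) = 1 / qfact q (Suc j)"
    using q_power(2)[of j] qfact_pos[of j] by (simp add: qweight_def qfact_Suc field_simps)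
  with Suc show ?case by simp
qed simp

text \<open>The infinite product of the factors \<open>1 - q ^ i\<close> over \<open>i > j\<close>. It is the \<open>q\<close>-analogue of
\<open>exp (- x)\<close> at \<open>x = q ^ Suc j / (1 - q)\<close>, as \<open>qtail_le\<close> and \<open>qtail_ge\<close> show.\<close>
definition qtail :: "nat \<Rightarrow> real" where
  "qtail j = lim (\<lambda>n. qfact q n / qfact q j)"

lemma qfact_quotient: "j \<le> n \<Longrightarrow> qfact q n / qfact q j = (\<Prod>i=j..<n. 1 - q ^ Suc i)"
proof (induction n)
  case (Suc n)
  show ?case
  proof (cases "j = Suc n")
    case True
    then show ?thesis using qfact_pos[of "Suc n"] by simp
  next
    case False
    then have "qfact q n / qfact q j = (\<Prod>i=j..<n. 1 - q ^ Suc i)" using Suc by simp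
    moreover have "qfact q (Suc n) / qfact q j = qfact q n / qfact q j * (1 - q ^ Suc n)"
      by (simp add: qfact_Suc)
    ultimately show ?thesis using False Suc.prems by (simp only: prod.atLeastLessThan_Suc)
  qed
qed simp

lemma sum_power_from: "j \<le> n \<Longrightarrow> (\<Sum>i=j..<n. q ^ Suc i) = (q ^ Suc j - q ^ Suc n) / (1 - q)"
proof (induction n)
  case (Suc n)
  show ?case
  proof (cases "j = Suc n")
    case False
    then have "(\<Sum>i=j..<n. q ^ Suc i) = (q ^ Suc j - q ^ Suc n) / (1 - q)" using Suc by simp
    moreover have "(q ^ Suc j - q ^ Suc n) / (1 - q) + q ^ Suc n = (q ^ Suc j - q ^ Suc (Suc n)) / (1 - q)"
      using q by (simp add: field_simps)
    ultimately show ?thesis using False Suc.prems by simp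
  qed simp
qed simp

lemma qfact_quotient_le:
  assumes "j \<le> n" shows "qfact q n / qfact q j \<le> exp (- ((q ^ Suc j - q ^ Suc n) / (1 - q)))"
proof -
  have "(\<Prod>i=j..<n. 1 - q ^ Suc i) \<le> (\<Prod>i=j..<n. exp (- (q ^ Suc i)))"
    using q_power(2) exp_ge_add_one_self[of "- (q ^ Suc _)"] by (intro prod_mono conjI) (auto simp: less_imp_le simp del: power_Suc)
  also have "\<dots> = exp (- (\<Sum>i=j..<n. q ^ Suc i))"
    by (simp add: exp_sum[symmetric] sum_negf)
  finally show ?thesis unfolding qfact_quotient[OF assms] sum_power_from[OF assms] .
qed

lemma qfact_quotient_ge:
  assumes "j \<le> n"
  shows "exp (- (q ^ Suc j / (1 - q) / (1 - q ^ Suc j))) \<le> qfact q n / qfact q j"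
proof -
  have q1: "0 < 1 - q ^ Suc i" for i using q_power(2)[of i] by simp
  have "exp (- (q ^ Suc j / (1 - q) / (1 - q ^ Suc j))) \<le> exp (- ((q ^ Suc j - q ^ Suc n) / (1 - q) / (1 - q ^ Suc j)))"
    using q q1[of j] by (simp add: divide_right_mono del: power_Suc)
  also have "(q ^ Suc j - q ^ Suc n) / (1 - q) / (1 - q ^ Suc j) = (\<Sum>i=j..<n. q ^ Suc i / (1 - q ^ Suc j))"
    unfolding sum_power_from[OF assms, symmetric] by (simp only: sum_divide_distrib)
  also have "exp (- \<dots>) = (\<Prod>i=j..<n. exp (- (q ^ Suc i / (1 - q ^ Suc j))))"
    by (simp add: exp_sum[symmetric] sum_negf)
  also have "\<dots> \<le> (\<Prod>i=j..<n. 1 - q ^ Suc i)"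
  proof (intro prod_mono conjI)
    fix i assume i: "i \<in> {j..<n}"
    define y where "y = q ^ Suc i"
    have y: "0 < y" "y < 1" using q_power[of i] q q1[of i] by (auto simp: y_def)
    have "1 / (1 - y) = 1 + y / (1 - y)" using y by (simp add: field_simps)
    also have "\<dots> \<le> exp (y / (1 - y))" by (rule exp_ge_add_one_self)
    also have "\<dots> \<le> exp (y / (1 - q ^ Suc j))"
    proof -
      have "y \<le> q ^ Suc j" unfolding y_def using q i by (intro power_decreasing) auto
      then show ?thesis using y q1[of j] by (simp add: frac_le)
    qed
    finally have "exp (- (y / (1 - q ^ Suc j))) \<le> 1 - y"
      using y unfolding exp_minus inverse_eq_divide
      by (simp add: pos_divide_le_eq mult.commute del: power_Suc)
    then show "exp (- (q ^ Suc i / (1 - q ^ Suc j))) \<le> 1 - q ^ Suc i"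
      by (simp only: y_def)
  qed simp
  finally show ?thesis unfolding qfact_quotient[OF assms] .
qed

lemma qtail_LIMSEQ: "(\<lambda>n. qfact q n / qfact q j) \<longlonglongrightarrow> qtail j"
proof -
  have "decseq (\<lambda>n. qfact q n / qfact q j)"
  proof (rule decseq_SucI)
    fix n
    have "qfact q (Suc n) \<le> qfact q n"
      using qfact_pos[of n] q_power[of "Suc n"] by (simp add: qfact_Suc mult_left_le del: power_Suc)
    then show "qfact q (Suc n) / qfact q j \<le> qfact q n / qfact q j"
      using qfact_pos[of j] by (simp add: divide_right_mono)
  qed
  then obtain L where "(\<lambda>n. qfact q n / qfact q j) \<longlonglongrightarrow> L"
    using decseq_convergent[of _ 0] qfact_pos by (metis divide_pos_pos less_imp_le)
  then show ?thesis by (simp add: qtail_def limI)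
qed

lemma qtail_le: "qtail j \<le> exp (- (q ^ Suc j / (1 - q)))"
proof (rule LIMSEQ_le[OF qtail_LIMSEQ])
  have "(\<lambda>n. q ^ Suc n) \<longlonglongrightarrow> 0" using q by (intro LIMSEQ_Suc LIMSEQ_power_zero) auto
  then have "(\<lambda>n. exp (- ((q ^ Suc j - q ^ Suc n) / (1 - q)))) \<longlonglongrightarrow> exp (- ((q ^ Suc j - 0) / (1 - q)))"
    using q by (intro tendsto_intros) auto
  then show "(\<lambda>n. exp (- ((q ^ Suc j - q ^ Suc n) / (1 - q)))) \<longlonglongrightarrow> exp (- (q ^ Suc j / (1 - q)))" by simp
  show "\<exists>N. \<forall>n\<ge>N. qfact q n / qfact q j \<le> exp (- ((q ^ Suc j - q ^ Suc n) / (1 - q)))"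
    using qfact_quotient_le by blast
qed

lemma qtail_ge: "exp (- (q ^ Suc j / (1 - q) / (1 - q ^ Suc j))) \<le> qtail j"
  by (rule LIMSEQ_le_const[OF qtail_LIMSEQ]) (use qfact_quotient_ge in blast)

lemma qtail_pos: "0 < qtail j"
  using qtail_ge exp_gt_zero by (rule less_le_trans[rotated])

lemma qtail_conv_qtail_0: "qtail j = qtail 0 / qfact q j"
proof -
  have "(\<lambda>n. qfact q n / qfact q 0 / qfact q j) \<longlonglongrightarrow> qtail 0 / qfact q j"
    using qfact_pos[of j] by (intro tendsto_intros qtail_LIMSEQ) auto
  then show ?thesis using qtail_LIMSEQ[of j] LIMSEQ_unique by fastforce
qed

text \<open>The weight at \<open>q ^ j / (1 - q)\<close> of the \<open>q\<close>-analogue of the exponential law.\<close>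
definition qprob :: "nat \<Rightarrow> real" where
  "qprob j = qtail 0 * qweight q j"

lemma qprob_pos: "0 < qprob j"
  using qtail_pos qweight_pos by (simp add: qprob_def)

lemma sum_qprob: "(\<Sum>i\<le>j. qprob i) = qtail j"
  unfolding qprob_def sum_distrib_left[symmetric] sum_qweight by (subst qtail_conv_qtail_0) simp

lemma qprob_sums: "qprob sums 1"
proof -
  have "qtail \<longlonglongrightarrow> 1"
  proof (rule tendsto_sandwich)
    have l: "(\<lambda>n. q ^ Suc n) \<longlonglongrightarrow> 0" using q by (intro LIMSEQ_Suc LIMSEQ_power_zero) auto
    have "(\<lambda>j. exp (- (q ^ Suc j / (1 - q) / (1 - q ^ Suc j)))) \<longlonglongrightarrow> exp (- (0 / (1 - q) / (1 - 0)))"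
      using q by (intro tendsto_intros l) auto
    then show "(\<lambda>j. exp (- (q ^ Suc j / (1 - q) / (1 - q ^ Suc j)))) \<longlonglongrightarrow> 1" by simp
    have "qtail j \<le> 1" for j
      using order_trans[OF qtail_le, of j 1] q q_power(1)[of "Suc j"] by simp
    then show "\<forall>\<^sub>F j in sequentially. qtail j \<le> 1" by simp
  qed (use qtail_ge in auto)
  then show ?thesis unfolding sums_def_le sum_qprob .
qed

end

text \<open>The parameter \<open>c\<close> stands for \<open>q powr \<alpha>\<close>, so \<open>q \<le> c\<close> encodes \<open>\<alpha> \<le> 1\<close>, and \<open>b\<close> is a scale,
later \<open>(1 - q) powr \<alpha>\<close>.\<close>
locale q_weights = q_parameter +
  fixes c b :: real
  assumes qc: "q \<le> c" "c < 1" and b: "0 < b"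
begin

lemma c0: "0 < c" using q qc by simp

text \<open>By the \<open>q\<close>-binomial theorem these are the coefficients of the power series of the quotient of
the infinite products of \<open>1 - q ^ i * z\<close> and \<open>1 - c * q ^ i * z\<close> over \<open>i \<ge> 1\<close>. Multiplying this
series by the generating function of the weights \<open>qweight q\<close>, which is the reciprocal of the first
product, replaces \<open>z\<close> by \<open>c * z\<close>.\<close>
definition gen_coeff :: "nat \<Rightarrow> real" where
  "gen_coeff n = (\<Prod>i<n. (c * q - q ^ Suc i) / (1 - q ^ Suc i))"

text \<open>The tail of the downward part of the jump measure of the underlying lattice walk.\<close>
definition jump_tail :: "nat \<Rightarrow> real" where
  "jump_tail n = - gen_coeff (Suc n)"

lemma gen_coeff_0: "gen_coeff 0 = 1" by (simp add: gen_coeff_def)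

lemma gen_coeff_Suc: "(1 - q ^ Suc n) * gen_coeff (Suc n) = (c * q - q ^ Suc n) * gen_coeff n"
  using q_power(2)[of n] by (simp add: gen_coeff_def)

text \<open>Both generating functions satisfy a first order \<open>q\<close>-difference equation, which is given
coefficientwise by \<open>gen_coeff_Suc\<close> and \<open>qweight_Suc\<close>. Their product then satisfies the equation
of \<open>c ^ m * qweight q m\<close>, whose solution is determined by the value at \<open>0\<close>.\<close>
lemma sum_gen_coeff_qweight: "(\<Sum>n\<le>m. gen_coeff n * qweight q (m - n)) = c ^ m * qweight q m"
proof (induction m)
  case (Suc m)
  let ?w = "qweight q"
  have "(1 - q ^ Suc m) * (\<Sum>n\<le>Suc m. gen_coeff n * ?w (Suc m - n))
      = (\<Sum>n\<le>Suc m. (1 - q ^ n) * gen_coeff n * ?w (Suc m - n))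
        + (\<Sum>n\<le>Suc m. q ^ n * gen_coeff n * ((1 - q ^ (Suc m - n)) * ?w (Suc m - n)))"
    unfolding sum_distrib_left sum.distrib[symmetric]
  proof (rule sum.cong[OF refl])
    fix n assume "n \<in> {..Suc m}"
    then have e: "q ^ Suc m = q ^ n * q ^ (Suc m - n)"
      by (metis atMost_iff le_add_diff_inverse power_add)
    show "(1 - q ^ Suc m) * (gen_coeff n * ?w (Suc m - n)) = (1 - q ^ n) * gen_coeff n * ?w (Suc m - n) +
        q ^ n * gen_coeff n * ((1 - q ^ (Suc m - n)) * ?w (Suc m - n))"
      unfolding e by (simp add: algebra_simps del: power_Suc)
  qed
  also have "(\<Sum>n\<le>Suc m. (1 - q ^ n) * gen_coeff n * ?w (Suc m - n)) = (\<Sum>n\<le>m. (1 - q ^ Suc n) * gen_coeff (Suc n) * ?w (m - n))"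
    by (subst sum.atMost_Suc_shift) simp
  also have "\<dots> = (\<Sum>n\<le>m. (c * q - q ^ Suc n) * gen_coeff n * ?w (m - n))"
    by (simp only: gen_coeff_Suc)
  also have "(\<Sum>n\<le>Suc m. q ^ n * gen_coeff n * ((1 - q ^ (Suc m - n)) * ?w (Suc m - n)))
      = (\<Sum>n\<le>m. q ^ n * gen_coeff n * ((1 - q ^ Suc (m - n)) * ?w (Suc (m - n))))"
    by (subst sum.atMost_Suc) (simp add: Suc_diff_le del: power_Suc)
  also have "\<dots> = (\<Sum>n\<le>m. q ^ Suc n * gen_coeff n * ?w (m - n))"
    by (simp only: qweight_Suc) (simp add: mult_ac)
  also have "(\<Sum>n\<le>m. (c * q - q ^ Suc n) * gen_coeff n * ?w (m - n)) + (\<Sum>n\<le>m. q ^ Suc n * gen_coeff n * ?w (m - n))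
      = c * q * (\<Sum>n\<le>m. gen_coeff n * ?w (m - n))"
    unfolding sum_distrib_left sum.distrib[symmetric] by (rule sum.cong) (auto simp: algebra_simps)
  also have "\<dots> = c ^ Suc m * (q * ?w m)" by (simp add: Suc mult_ac)
  also have "\<dots> = (1 - q ^ Suc m) * (c ^ Suc m * ?w (Suc m))"
    by (subst qweight_Suc[symmetric]) (simp add: mult_ac)
  finally show ?case using q_power(2)[of m] by (simp del: power_Suc)
qed (simp add: gen_coeff_0)

lemma sum_jump_tail_qweight: "(\<Sum>n<m. jump_tail n * qweight q (m - Suc n)) = (1 - c ^ m) * qweight q m"
proof (cases m)
  case (Suc k)
  have "c ^ m * qweight q m = qweight q m + (\<Sum>n\<le>k. gen_coeff (Suc n) * qweight q (k - n))"
    using sum_gen_coeff_qweight[of m] unfolding Suc by (subst (asm) sum.atMost_Suc_shift) (simp add: gen_coeff_0)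
  then show ?thesis
    by (simp add: Suc jump_tail_def sum_negf lessThan_Suc_atMost algebra_simps)
qed simp

lemma jump_tail_Suc: "jump_tail (Suc n) = jump_tail n * ((c * q - q ^ Suc (Suc n)) / (1 - q ^ Suc (Suc n)))"
  by (simp add: jump_tail_def gen_coeff_def)

lemma jump_tail_0: "jump_tail 0 = (q - c * q) / (1 - q)"
  by (simp add: jump_tail_def gen_coeff_def divide_simps)

lemma jump_tail_0_pos: "0 < jump_tail 0"
  unfolding jump_tail_0 using q qc by simp

text \<open>The lower bound is where \<open>q \<le> c\<close> enters.\<close>
lemma jump_tail_factor: "0 \<le> (c * q - q ^ Suc (Suc n)) / (1 - q ^ Suc (Suc n))"
  "(c * q - q ^ Suc (Suc n)) / (1 - q ^ Suc (Suc n)) \<le> 1"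
proof -
  have 1: "q ^ Suc n \<le> c" using qc(1) q_power(3)[of n] q by (auto intro: order_trans[OF mult_left_le])
  have 2: "q ^ Suc (Suc n) < 1" by (rule q_power)
  from 1 have "q * q ^ Suc n \<le> q * c" using q by (intro mult_left_mono) auto
  then show "0 \<le> (c * q - q ^ Suc (Suc n)) / (1 - q ^ Suc (Suc n))"
    using 2 by (intro divide_nonneg_pos) (auto simp: mult_ac)
  have "c * q \<le> 1" using q qc c0 by (intro mult_le_one) auto
  then show "(c * q - q ^ Suc (Suc n)) / (1 - q ^ Suc (Suc n)) \<le> 1"
    using 2 by (simp add: divide_le_eq del: power_Suc)
qed

lemma jump_tail_nonneg: "0 \<le> jump_tail n"
proof (induction n)
  case 0 show ?case using jump_tail_0_pos by simp
next
  case (Suc n) then show ?case unfolding jump_tail_Suc using jump_tail_factor[of n] by (intro mult_nonneg_nonneg) auto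
qed

lemma jump_tail_decseq: "jump_tail (Suc n) \<le> jump_tail n"
  unfolding jump_tail_Suc using jump_tail_factor[of n] jump_tail_nonneg[of n] by (intro mult_left_le) auto

text \<open>The weights \<open>qweight q\<close> are eventually decreasing, so in \<open>sum_jump_tail_qweight\<close> with \<open>m\<close> large
each \<open>qweight q (m - Suc n)\<close> may be replaced by the smaller \<open>qweight q m\<close>.\<close>
lemma sum_jump_tail_le_1: "(\<Sum>n<N. jump_tail n) \<le> 1"
proof -
  have "(\<lambda>m. q ^ m) \<longlonglongrightarrow> 0" using q by (intro LIMSEQ_power_zero) auto
  then have "\<forall>\<^sub>F m in sequentially. q ^ m < 1 - q" using q by (intro order_tendstoD(2)) auto
  then obtain M where M: "\<And>m. m \<ge> M \<Longrightarrow> q ^ m < 1 - q" by (auto simp: eventually_sequentially)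
  have dec: "qweight q (Suc m) \<le> qweight q m" if "m \<ge> M" for m
  proof -
    have "q * qweight q (Suc m) \<le> (1 - q ^ Suc m) * qweight q (Suc m)"
      using M[of "Suc m"] that qweight_pos[of "Suc m"] by (intro mult_right_mono) (auto simp del: power_Suc)
    then show ?thesis unfolding qweight_Suc using q by simp
  qed
  have mono: "qweight q (m + k) \<le> qweight q m" if "m \<ge> M" for m k
  proof (induction k)
    case (Suc k)
    then show ?case using dec[of "m + k"] that by simp
  qed simp
  have "(\<Sum>n<N. jump_tail n) * qweight q (M + N) \<le> (\<Sum>n<N. jump_tail n * qweight q (M + N - Suc n))"
    unfolding sum_distrib_right
  proof (intro sum_mono mult_left_mono jump_tail_nonneg)
    fix n assume n: "n \<in> {..<N}"
    show "qweight q (M + N) \<le> qweight q (M + N - Suc n)"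
      using mono[of "M + N - Suc n" "Suc n"] n by simp
  qed
  also have "\<dots> \<le> (\<Sum>n<M + N. jump_tail n * qweight q (M + N - Suc n))"
    by (intro sum_mono2) (auto intro!: mult_nonneg_nonneg jump_tail_nonneg less_imp_le[OF qweight_pos])
  also have "\<dots> \<le> 1 * qweight q (M + N)"
    unfolding sum_jump_tail_qweight using c0 qweight_pos[of "M + N"] by (intro mult_right_mono) auto
  finally show ?thesis using qweight_pos[of "M + N"] by simp
qed

lemma jump_tail_summable: "summable jump_tail"
  by (rule summableI_nonneg_bounded[OF jump_tail_nonneg sum_jump_tail_le_1])

text \<open>The \<open>q\<close>-analogue of the transform of \<open>W powr (- \<alpha>)\<close>: the points \<open>b / c ^ j\<close> are the values of
\<open>w powr (- \<alpha>)\<close> at \<open>w = q ^ j / (1 - q)\<close>.\<close>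
definition qlaplace :: "real \<Rightarrow> real" where
  "qlaplace s = (\<Sum>j. qprob j * qexp c (s * b / c ^ j))"

lemma qprob_summable:
  assumes "\<And>j. \<bar>x j\<bar> \<le> 1" shows "summable (\<lambda>j. qprob j * x j)"
  by (rule summable_comparison_test'[OF sums_summable[OF qprob_sums], of 0])
    (use assms qprob_pos in \<open>auto simp: abs_mult less_imp_le intro!: mult_left_le\<close>)

lemma arg_nonneg: "0 \<le> s \<Longrightarrow> 0 \<le> s * b / c ^ j"
  using b c0 by simp

lemma abs_qexp: "0 \<le> s \<Longrightarrow> \<bar>qexp c (s * b / c ^ j)\<bar> \<le> 1"
  using qexp_le_1[OF c0 qc(2) arg_nonneg] qexp_pos[OF c0 qc(2) arg_nonneg] by (simp add: less_imp_le)

lemma qlaplace_sums: "0 \<le> s \<Longrightarrow> (\<lambda>j. qprob j * qexp c (s * b / c ^ j)) sums qlaplace s"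
  unfolding qlaplace_def by (intro summable_sums qprob_summable abs_qexp)

lemma qlaplace_pos: "0 \<le> s \<Longrightarrow> 0 < qlaplace s"
  unfolding qlaplace_def
  by (intro suminf_pos qprob_summable abs_qexp mult_pos_pos qprob_pos qexp_pos[OF c0 qc(2)] arg_nonneg)

lemma qlaplace_le_1: assumes "0 \<le> s" shows "qlaplace s \<le> 1"
proof -
  have "qlaplace s \<le> (\<Sum>j. qprob j)"
    unfolding qlaplace_def using qprob_pos qexp_le_1[OF c0 qc(2) arg_nonneg[OF assms]]
    by (intro suminf_le qprob_summable abs_qexp assms sums_summable[OF qprob_sums]) (simp add: mult_left_le less_imp_le)
  then show ?thesis using qprob_sums by (simp add: sums_iff)
qed

lemma qlaplace_mono: assumes "0 < s" shows "qlaplace s \<le> qlaplace (c * s)"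
proof -
  have s: "0 \<le> s" "0 \<le> c * s" using assms c0 by auto
  have "qexp c (s * b / c ^ j) \<le> qexp c (c * s * b / c ^ j)" for j
  proof -
    have "1 * qexp c (s * b / c ^ j) \<le> (1 + s * b / c ^ j * (1 - c)) * qexp c (s * b / c ^ j)"
    proof (rule mult_right_mono)
      have "0 \<le> s * b / c ^ j * (1 - c)"
        using arg_nonneg[OF s(1), of j] qc(2) by (intro mult_nonneg_nonneg) auto
      then show "1 \<le> 1 + s * b / c ^ j * (1 - c)" by linarith
    qed (rule less_imp_le[OF qexp_pos[OF c0 qc(2) arg_nonneg[OF s(1)]]])
    then show ?thesis
      using qexp_mult[OF c0 qc(2) arg_nonneg[OF s(1)], of j] by (simp add: mult.assoc)
  qed
  then show ?thesis
    unfolding qlaplace_def using qprob_pos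
    by (intro suminf_le qprob_summable abs_qexp s mult_left_mono) (auto simp: less_imp_le)
qed

text \<open>By the difference equation of \<open>qexp\<close>, the increments of \<open>qlaplace\<close> along a geometric progression
are averages of shifted copies of one sequence \<open>x\<close>. Exchanging the order of summation, the
convolution identity \<open>sum_jump_tail_qweight\<close> leaves a single sum in which \<open>x m\<close> has the factor
\<open>1 - c ^ m\<close>, and
\<open>c ^ m * x m\<close> is a multiple of \<open>s * qexp\<close>. In the limit this says that the generator of the
Levy process maps \<open>x \<mapsto> F\<^sub>\<alpha> (exp (- x))\<close> to its product with \<open>exp (- x)\<close>.\<close>
lemma qlaplace_equation:
  assumes s: "0 < s"
  shows "(\<lambda>n. jump_tail n * (qlaplace (s / c ^ n) - qlaplace (s / c ^ Suc n))) sums (qlaplace (c * s) - qlaplace s - (1 - c) * b * s * qlaplace s)"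
proof -
  define x where "x j = s * b / c ^ j * (1 - c) * qexp c (s * b / c ^ j)" for j
  have x_diff: "x j = qexp c (c * (s * b / c ^ j)) - qexp c (s * b / c ^ j)" for j
    using qexp_mult[OF c0 qc(2) arg_nonneg, of s j] s by (simp add: x_def algebra_simps)
  have x0: "0 \<le> x j" for j
    unfolding x_def using s b c0 qc qexp_pos[OF c0 qc(2) arg_nonneg, of s j] by (intro mult_nonneg_nonneg) auto
  have x1: "x j \<le> 1" for j
  proof -
    have "0 \<le> c * (s * b / c ^ j)" using s b c0 by simp
    from qexp_le_1[OF c0 qc(2) this] qexp_pos[OF c0 qc(2) arg_nonneg, of s j] s
    show ?thesis unfolding x_diff by linarith
  qed
  have diff: "(\<Sum>j. qprob j * x (j + n)) = qlaplace (c * s / c ^ n) - qlaplace (s / c ^ n)" for n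
  proof -
    have "0 \<le> s / c ^ n" "0 \<le> c * s / c ^ n" using s c0 by auto
    from sums_diff[OF qlaplace_sums[OF this(2)] qlaplace_sums[OF this(1)]]
    have "(\<lambda>j. qprob j * x (j + n)) sums (qlaplace (c * s / c ^ n) - qlaplace (s / c ^ n))"
      by (simp add: x_diff right_diff_distrib power_add mult_ac)
    then show ?thesis by (simp add: sums_iff)
  qed
  have "(\<lambda>m. x m * (\<Sum>n<m. jump_tail n * qprob (m - Suc n))) sums (\<Sum>n. jump_tail n * (\<Sum>j. qprob j * x (j + Suc n)))"
    by (rule suminf_shifted_convolution[OF jump_tail_nonneg jump_tail_summable _ sums_summable[OF qprob_sums] x0 x1])
      (simp add: less_imp_le qprob_pos)
  also have "(\<lambda>n. jump_tail n * (\<Sum>j. qprob j * x (j + Suc n))) = (\<lambda>n. jump_tail n * (qlaplace (s / c ^ n) - qlaplace (s / c ^ Suc n)))"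
    unfolding diff using c0 by simp
  also have "(\<lambda>m. x m * (\<Sum>n<m. jump_tail n * qprob (m - Suc n))) = (\<lambda>m. qprob m * x m - (1 - c) * b * s * (qprob m * qexp c (s * b / c ^ m)))"
  proof
    fix m
    have "(\<Sum>n<m. jump_tail n * qprob (m - Suc n)) = qtail 0 * (\<Sum>n<m. jump_tail n * qweight q (m - Suc n))"
      by (simp add: qprob_def sum_distrib_left mult_ac)
    also have "\<dots> = (1 - c ^ m) * qprob m" by (simp add: sum_jump_tail_qweight qprob_def)
    also have "x m * \<dots> = qprob m * x m - qprob m * (c ^ m * x m)" by (simp add: algebra_simps)
    also have "c ^ m * x m = (1 - c) * b * s * qexp c (s * b / c ^ m)"
      using c0 by (simp add: x_def)
    finally show "x m * (\<Sum>n<m. jump_tail n * qprob (m - Suc n)) = qprob m * x m - (1 - c) * b * s * (qprob m * qexp c (s * b / c ^ m))"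
      by (simp add: mult_ac)
  qed
  finally have 1: "(\<lambda>m. qprob m * x m - (1 - c) * b * s * (qprob m * qexp c (s * b / c ^ m)))
    sums (\<Sum>n. jump_tail n * (qlaplace (s / c ^ n) - qlaplace (s / c ^ Suc n)))" .
  have "(\<lambda>m. qprob m * x m) sums (qlaplace (c * s) - qlaplace s)"
    using diff[of 0] x0 x1 by (subst sums_iff) (auto intro!: qprob_summable)
  then have "(\<lambda>m. qprob m * x m - (1 - c) * b * s * (qprob m * qexp c (s * b / c ^ m)))
    sums (qlaplace (c * s) - qlaplace s - (1 - c) * b * s * qlaplace s)"
    using s by (intro sums_diff sums_mult qlaplace_sums) auto
  from sums_unique2[OF this 1]
  have e: "(\<Sum>n. jump_tail n * (qlaplace (s / c ^ n) - qlaplace (s / c ^ Suc n))) = qlaplace (c * s) - qlaplace s - (1 - c) * b * s * qlaplace s" ..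
  have "\<bar>qlaplace (s / c ^ n) - qlaplace (s / c ^ Suc n)\<bar> \<le> 1" for n
  proof -
    have "0 \<le> s / c ^ n" "0 \<le> s / c ^ Suc n" using s c0 by auto
    from qlaplace_pos[OF this(1)] qlaplace_pos[OF this(2)] qlaplace_le_1[OF this(1)] qlaplace_le_1[OF this(2)]
    show ?thesis by linarith
  qed
  then have "summable (\<lambda>n. jump_tail n * (qlaplace (s / c ^ n) - qlaplace (s / c ^ Suc n)))"
    using jump_tail_nonneg by (intro summable_comparison_test'[OF jump_tail_summable, of 0]) (simp add: abs_mult mult_left_le)
  then show ?thesis unfolding e[symmetric] by (rule summable_sums)
qed

text \<open>In terms of the walk, the transform of the part of the exponential functional that is collected
before the walk first gains one level.\<close>
definition qratio :: "real \<Rightarrow> real" where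
  "qratio s = qlaplace s / qlaplace (c * s)"

definition jump_weight :: "nat \<Rightarrow> real" where
  "jump_weight n = jump_tail n - jump_tail (Suc n)"

text \<open>A first step decomposition: after a jump \<open>Suc n\<close> levels down, the walk has to climb these levels
one at a time, which contributes one factor for each level; the equation is solved for the
factor of the starting level.\<close>
definition ratio_step :: "(real \<Rightarrow> real) \<Rightarrow> real \<Rightarrow> real" where
  "ratio_step \<rho> s = 1 / (1 + jump_tail 0 * (1 - (\<Sum>n. jump_weight n / jump_tail 0 * (\<Prod>i\<le>n. \<rho> (s / c ^ Suc i)))) + (1 - c) * b * s)"

lemma jump_weight_nonneg: "0 \<le> jump_weight n" using jump_tail_decseq[of n] by (simp add: jump_weight_def)

lemma jump_tail_tendsto_0: "jump_tail \<longlonglongrightarrow> 0"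
  by (rule summable_LIMSEQ_zero[OF jump_tail_summable])

lemma jump_weight_sums: "jump_weight sums jump_tail 0"
  using telescope_sums'[OF jump_tail_tendsto_0] by (simp add: jump_weight_def[abs_def])

lemma jump_weight_div_sums: "(\<lambda>n. jump_weight n / jump_tail 0) sums 1"
  using sums_divide[OF jump_weight_sums, of "jump_tail 0"] jump_tail_0_pos by simp

text \<open>The mean jump size, by summation by parts.\<close>
lemma sum_jump_weight_weighted: "(\<Sum>n<N. real (Suc n) * jump_weight n) \<le> 1"
proof -
  have "(\<Sum>n<N. real (Suc n) * jump_weight n) = (\<Sum>n<N. jump_tail n) - real N * jump_tail N"
    by (induction N) (auto simp: jump_weight_def algebra_simps)
  also have "\<dots> \<le> 1"
  proof -
    have "0 \<le> real N * jump_tail N" using jump_tail_nonneg[of N] by simp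
    then show ?thesis using sum_jump_tail_le_1[of N] by linarith
  qed
  finally show ?thesis .
qed

lemma jump_weight_weighted_summable: "summable (\<lambda>n. real (Suc n) * jump_weight n)"
  by (rule summableI_nonneg_bounded[OF _ sum_jump_weight_weighted]) (auto intro!: mult_nonneg_nonneg jump_weight_nonneg simp del: of_nat_Suc)

lemma qratio_pos: "0 \<le> s \<Longrightarrow> 0 < qratio s"
  using qlaplace_pos[of s] qlaplace_pos[of "c * s"] c0 by (simp add: qratio_def)

lemma qratio_le_1: "0 < s \<Longrightarrow> qratio s \<le> 1"
  using qlaplace_mono[of s] qlaplace_pos[of "c * s"] c0 by (simp add: qratio_def)

lemma qlaplace_quotient: assumes "0 < s" shows "qlaplace (s / c ^ n) / qlaplace s = (\<Prod>i<n. qratio (s / c ^ Suc i))"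
proof (induction n)
  case 0
  show ?case using qlaplace_pos[of s] assms by simp
next
  case (Suc n)
  have "0 \<le> s / c ^ n" using c0 assms by simp
  then show ?case
    using Suc qlaplace_pos[of "s / c ^ n"] c0 by (simp add: qratio_def divide_simps)
qed

text \<open>Divide \<open>qlaplace_equation\<close> by \<open>qlaplace s\<close> and sum by parts. The quotients
\<open>qlaplace (s / c ^ n) / qlaplace s\<close> are products of values of \<open>qratio\<close> at larger arguments.\<close>
lemma qratio_fixpoint:
  assumes s: "0 < s"
  shows "qratio s = ratio_step qratio s"
proof -
  define g where "g n = qlaplace (s / c ^ n) / qlaplace s" for n
  have fs: "0 < qlaplace s" using qlaplace_pos s by simp
  have g: "0 \<le> g n" "g n \<le> 1" for n
  proof -
    have "0 < qratio (s / c ^ Suc i) \<and> qratio (s / c ^ Suc i) \<le> 1" for i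
      using s c0 qratio_pos[of "s / c ^ Suc i"] qratio_le_1[of "s / c ^ Suc i"] by simp
    then show "0 \<le> g n" "g n \<le> 1"
      unfolding g_def qlaplace_quotient[OF s] by (auto intro!: prod_nonneg prod_le_1 simp: less_imp_le simp del: power_Suc)
  qed
  have g0: "g 0 = 1" using fs by (simp add: g_def)
  have "(\<lambda>n. jump_tail n * (g n - g (Suc n))) sums ((qlaplace (c * s) - qlaplace s - (1 - c) * b * s * qlaplace s) / qlaplace s)"
    using sums_divide[OF qlaplace_equation[OF s], of "qlaplace s"] by (simp add: g_def diff_divide_distrib right_diff_distrib)
  also have "(qlaplace (c * s) - qlaplace s - (1 - c) * b * s * qlaplace s) / qlaplace s = 1 / qratio s - 1 - (1 - c) * b * s"
    using fs by (simp add: qratio_def field_simps)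
  finally have 1: "(\<lambda>n. jump_tail n * (g n - g (Suc n))) sums (1 / qratio s - 1 - (1 - c) * b * s)" .
  have part: "(\<Sum>n<N. jump_tail n * (g n - g (Suc n))) = jump_tail 0 - (\<Sum>n<N. jump_weight n * g (Suc n)) - jump_tail N * g N" for N
    by (induction N) (auto simp: jump_weight_def algebra_simps g0)
  have sm: "summable (\<lambda>n. jump_weight n * g (Suc n))"
    by (rule summable_comparison_test'[OF sums_summable[OF jump_weight_sums], of 0])
      (use g jump_weight_nonneg in \<open>auto simp: abs_mult intro!: mult_left_le\<close>)
  have "(\<lambda>N. jump_tail N * g N) \<longlonglongrightarrow> 0"
  proof (rule tendsto_sandwich[OF _ _ tendsto_const jump_tail_tendsto_0])
    show "\<forall>\<^sub>F n in sequentially. 0 \<le> jump_tail n * g n" using jump_tail_nonneg g by simp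
    show "\<forall>\<^sub>F n in sequentially. jump_tail n * g n \<le> jump_tail n" using jump_tail_nonneg g by (simp add: mult_left_le)
  qed
  then have "(\<lambda>N. jump_tail 0 - (\<Sum>n<N. jump_weight n * g (Suc n)) - jump_tail N * g N) \<longlonglongrightarrow> jump_tail 0 - (\<Sum>n. jump_weight n * g (Suc n)) - 0"
    by (intro tendsto_intros summable_LIMSEQ sm)
  then have "(\<lambda>n. jump_tail n * (g n - g (Suc n))) sums (jump_tail 0 - (\<Sum>n. jump_weight n * g (Suc n)))"
    unfolding sums_def part by simp
  from sums_unique2[OF this 1] have "1 / qratio s = 1 + (jump_tail 0 - (\<Sum>n. jump_weight n * g (Suc n))) + (1 - c) * b * s" by simp
  also have "(\<Sum>n. jump_weight n * g (Suc n)) = jump_tail 0 * (\<Sum>n. jump_weight n / jump_tail 0 * (\<Prod>i\<le>n. qratio (s / c ^ Suc i)))"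
  proof -
    have "(\<lambda>n. jump_weight n / jump_tail 0 * (\<Prod>i\<le>n. qratio (s / c ^ Suc i))) = (\<lambda>n. jump_weight n * g (Suc n) / jump_tail 0)"
      by (simp only: g_def qlaplace_quotient[OF s] lessThan_Suc_atMost) simp
    then show ?thesis using suminf_divide[OF sm, of "jump_tail 0"] jump_tail_0_pos by simp
  qed
  also have "1 + (jump_tail 0 - jump_tail 0 * (\<Sum>n. jump_weight n / jump_tail 0 * (\<Prod>i\<le>n. qratio (s / c ^ Suc i)))) + (1 - c) * b * s = 1 / ratio_step qratio s"
    by (simp add: ratio_step_def right_diff_distrib)
  finally show ?thesis by simp
qed

lemma prod_bounds:
  assumes "\<And>s. 0 < s \<Longrightarrow> 0 \<le> \<rho> s \<and> \<rho> s \<le> 1" "0 < s"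
  shows "0 \<le> (\<Prod>i\<le>n. \<rho> (s / c ^ Suc i))" "(\<Prod>i\<le>n. \<rho> (s / c ^ Suc i)) \<le> (1::real)"
proof -
  have "0 < s / c ^ Suc i" for i using assms(2) c0 by simp
  then show "0 \<le> (\<Prod>i\<le>n. \<rho> (s / c ^ Suc i))" "(\<Prod>i\<le>n. \<rho> (s / c ^ Suc i)) \<le> (1::real)"
    using assms(1) by (auto intro!: prod_nonneg prod_le_1 simp del: power_Suc)
qed

lemma ratio_step_summable:
  assumes "\<And>s. 0 < s \<Longrightarrow> 0 \<le> \<rho> s \<and> \<rho> s \<le> 1" "0 < s"
  shows "summable (\<lambda>n. jump_weight n / jump_tail 0 * (\<Prod>i\<le>n. \<rho> (s / c ^ Suc i)))"
  by (rule summable_comparison_test'[OF sums_summable[OF jump_weight_div_sums], of 0])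
    (use prod_bounds[of \<rho> s, OF assms] jump_weight_nonneg jump_tail_0_pos in
      \<open>auto simp: abs_mult abs_of_nonneg intro!: mult_left_le divide_right_mono simp del: power_Suc\<close>)

lemma ratio_step_bounds:
  assumes "\<And>s. 0 < s \<Longrightarrow> 0 \<le> \<rho> s \<and> \<rho> s \<le> 1" "0 < s"
  shows "0 < ratio_step \<rho> s" "ratio_step \<rho> s \<le> 1 / (1 + (1 - c) * b * s)"
proof -
  have "(\<Sum>n. jump_weight n / jump_tail 0 * (\<Prod>i\<le>n. \<rho> (s / c ^ Suc i))) \<le> (\<Sum>n. jump_weight n / jump_tail 0)"
    using prod_bounds[of \<rho> s, OF assms] jump_weight_nonneg jump_tail_0_pos
    by (intro suminf_le ratio_step_summable[of \<rho> s, OF assms] sums_summable[OF jump_weight_div_sums] mult_left_le) auto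
  also have "\<dots> = 1" using jump_weight_div_sums by (simp add: sums_iff)
  finally have "0 \<le> jump_tail 0 * (1 - (\<Sum>n. jump_weight n / jump_tail 0 * (\<Prod>i\<le>n. \<rho> (s / c ^ Suc i))))"
    using jump_tail_0_pos by simp
  moreover have "0 \<le> (1 - c) * b * s" using qc b assms by simp
  ultimately show "0 < ratio_step \<rho> s" "ratio_step \<rho> s \<le> 1 / (1 + (1 - c) * b * s)"
    unfolding ratio_step_def by (auto intro!: divide_pos_pos divide_left_mono mult_pos_pos add_pos_nonneg)
qed

text \<open>The product over \<open>Suc n\<close> levels is Lipschitz with constant \<open>Suc n\<close>, and the mean jump size is at
most one, so the denominators differ by at most \<open>D\<close>. Both denominators are at least
\<open>1 + (1 - c) * b * s0\<close>, which makes the map a strict contraction on \<open>{s0..}\<close>.\<close>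
lemma ratio_step_contraction:
  assumes \<rho>: "\<And>s. 0 < s \<Longrightarrow> 0 \<le> \<rho> s \<and> \<rho> s \<le> 1" and \<sigma>: "\<And>s. 0 < s \<Longrightarrow> 0 \<le> \<sigma> s \<and> \<sigma> s \<le> 1"
    and D: "\<And>t. t \<ge> s0 \<Longrightarrow> \<bar>\<rho> t - \<sigma> t\<bar> \<le> D" and s0: "0 < s0" and s: "s0 \<le> s"
  shows "\<bar>ratio_step \<rho> s - ratio_step \<sigma> s\<bar> \<le> (1 / (1 + (1 - c) * b * s0))\<^sup>2 * D"
proof -
  define P where "P \<rho> = (\<lambda>n. \<Prod>i\<le>n. \<rho> (s / c ^ Suc i))" for \<rho> :: "real \<Rightarrow> real"
  define S where "S \<rho> = (\<Sum>n. jump_weight n / jump_tail 0 * P \<rho> n)" for \<rho>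
  have spos: "0 < s" using s s0 by simp
  have D0: "0 \<le> D" using D[of s0] by simp
  have P: "\<bar>P \<rho> n - P \<sigma> n\<bar> \<le> real (Suc n) * D" for n
  proof -
    have si: "s0 \<le> s / c ^ Suc i" "0 < s / c ^ Suc i" for i
    proof -
      have "s0 * c ^ Suc i \<le> s" using s s0 c0 qc by (auto intro!: order_trans[OF mult_left_le] power_le_one simp del: power_Suc)
      then show "s0 \<le> s / c ^ Suc i" using c0 by (simp add: pos_le_divide_eq del: power_Suc)
      then show "0 < s / c ^ Suc i" using s0 by simp
    qed
    have "norm (P \<rho> n - P \<sigma> n) \<le> (\<Sum>i\<le>n. norm (\<rho> (s / c ^ Suc i) - \<sigma> (s / c ^ Suc i)))"
      unfolding P_def by (rule norm_prod_diff) (use \<rho> \<sigma> si in \<open>auto simp del: power_Suc\<close>)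
    also have "\<dots> \<le> (\<Sum>i\<le>n. D)" using D si by (intro sum_mono) (simp del: power_Suc)
    finally show ?thesis by simp
  qed
  have sP: "summable (\<lambda>n. jump_weight n / jump_tail 0 * P \<tau> n)"
    if "\<And>s. 0 < s \<Longrightarrow> 0 \<le> \<tau> s \<and> \<tau> s \<le> 1" for \<tau>
    unfolding P_def using ratio_step_summable[of \<tau> s] that spos by blast
  have "\<bar>S \<rho> - S \<sigma>\<bar> \<le> D / jump_tail 0"
  proof -
    have sw: "summable (\<lambda>n. real (Suc n) * jump_weight n * (D / jump_tail 0))"
      by (intro summable_mult2 jump_weight_weighted_summable)
    have le: "norm (jump_weight n / jump_tail 0 * P \<rho> n - jump_weight n / jump_tail 0 * P \<sigma> n) \<le> real (Suc n) * jump_weight n * (D / jump_tail 0)" for n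
    proof -
      have "norm (jump_weight n / jump_tail 0 * P \<rho> n - jump_weight n / jump_tail 0 * P \<sigma> n) = jump_weight n / jump_tail 0 * \<bar>P \<rho> n - P \<sigma> n\<bar>"
        using jump_weight_nonneg[of n] jump_tail_0_pos by (simp add: right_diff_distrib[symmetric] abs_mult del: times_divide_eq_left)
      also have "\<dots> \<le> jump_weight n / jump_tail 0 * (real (Suc n) * D)"
        using P jump_weight_nonneg[of n] jump_tail_0_pos by (intro mult_left_mono) auto
      finally show ?thesis by (simp add: mult_ac)
    qed
    have "S \<rho> - S \<sigma> = (\<Sum>n. jump_weight n / jump_tail 0 * P \<rho> n - jump_weight n / jump_tail 0 * P \<sigma> n)"
      unfolding S_def by (rule suminf_diff[OF sP[OF \<rho>] sP[OF \<sigma>]])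
    also have "norm \<dots> \<le> (\<Sum>n. real (Suc n) * jump_weight n * (D / jump_tail 0))"
      using le sw by (rule norm_suminf_le)
    also have "\<dots> = (\<Sum>n. real (Suc n) * jump_weight n) * (D / jump_tail 0)"
      by (rule suminf_mult2[symmetric]) (rule jump_weight_weighted_summable)
    also have "\<dots> \<le> 1 * (D / jump_tail 0)"
      using D0 jump_tail_0_pos by (intro mult_right_mono suminf_le_const[OF jump_weight_weighted_summable sum_jump_weight_weighted]) auto
    finally show ?thesis by simp
  qed
  then have SD: "jump_tail 0 * \<bar>S \<rho> - S \<sigma>\<bar> \<le> D" using jump_tail_0_pos by (simp add: field_simps)
  define x y where "x = 1 / ratio_step \<rho> s" and "y = 1 / ratio_step \<sigma> s"
  have xy: "ratio_step \<rho> s = 1 / x" "ratio_step \<sigma> s = 1 / y" by (auto simp: x_def y_def)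
  have pos: "0 < 1 + (1 - c) * b * s0" using qc b s0 by (intro add_pos_nonneg mult_nonneg_nonneg) auto
  have bd: "0 < ratio_step \<rho> s" "ratio_step \<rho> s \<le> 1 / (1 + (1 - c) * b * s0)"
    if "\<And>s. 0 < s \<Longrightarrow> 0 \<le> \<rho> s \<and> \<rho> s \<le> 1" for \<rho>
  proof -
    have rb: "0 < ratio_step \<rho> s" "ratio_step \<rho> s \<le> 1 / (1 + (1 - c) * b * s)"
      using ratio_step_bounds[of \<rho> s] that spos by auto
    show "0 < ratio_step \<rho> s" by (rule rb)
    have "1 / (1 + (1 - c) * b * s) \<le> 1 / (1 + (1 - c) * b * s0)"
    proof (intro frac_le)
      show "1 + (1 - c) * b * s0 \<le> 1 + (1 - c) * b * s"
        using s qc b by (intro add_left_mono mult_left_mono) auto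
    qed (use pos in auto)
    with rb(2) show "ratio_step \<rho> s \<le> 1 / (1 + (1 - c) * b * s0)" by (rule order_trans)
  qed
  have x: "0 < 1 / x" "1 / x \<le> 1 / (1 + (1 - c) * b * s0)"
    and y: "0 < 1 / y" "1 / y \<le> 1 / (1 + (1 - c) * b * s0)"
    unfolding xy[symmetric] using bd[of \<rho>] bd[of \<sigma>] \<rho> \<sigma> by blast+
  have "y - x = jump_tail 0 * (S \<rho> - S \<sigma>)"
    unfolding x_def y_def ratio_step_def S_def P_def by (simp add: algebra_simps)
  then have "\<bar>y - x\<bar> \<le> D" using SD jump_tail_0_pos by (simp add: abs_mult)
  have "\<bar>1 / x - 1 / y\<bar> = (1 / x) * (1 / y) * \<bar>y - x\<bar>"
  proof -
    have "0 < x" "0 < y" using x(1) y(1) by simp_all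
    then have "1 / x - 1 / y = (1 / x) * (1 / y) * (y - x)" by (simp add: field_simps)
    then show ?thesis using x(1) y(1) by (simp only: abs_mult abs_of_pos)
  qed
  also have "\<dots> \<le> (1 / (1 + (1 - c) * b * s0)) * (1 / (1 + (1 - c) * b * s0)) * D"
    using x y \<open>\<bar>y - x\<bar> \<le> D\<close> pos by (intro mult_mono) auto
  finally show ?thesis unfolding xy by (simp add: power2_eq_square)
qed

text \<open>The start value \<open>1\<close> is sub-Laplace, and \<open>ratio_step\<close> preserves this property.\<close>
primrec ratio_iter :: "nat \<Rightarrow> real \<Rightarrow> real" where
  "ratio_iter 0 = (\<lambda>s. 1)"
| "ratio_iter (Suc k) = ratio_step (ratio_iter k)"

lemma ratio_iter_bounds: "0 < s \<Longrightarrow> 0 \<le> ratio_iter k s \<and> ratio_iter k s \<le> 1"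
proof (induction k arbitrary: s)
  case (Suc k)
  have "0 \<le> (1 - c) * b * s" using qc b Suc.prems by simp
  then have "1 / (1 + (1 - c) * b * s) \<le> 1" by simp
  then show ?case using ratio_step_bounds[of "ratio_iter k" s] Suc by fastforce
qed simp

lemma ratio_iter_LIMSEQ:
  assumes s: "0 < s" shows "(\<lambda>k. ratio_iter k s) \<longlonglongrightarrow> qratio s"
proof -
  define \<kappa> where "\<kappa> = (1 / (1 + (1 - c) * b * s))\<^sup>2"
  have "0 < (1 - c) * b * s" using qc b s by simp
  then have \<kappa>: "0 \<le> \<kappa>" "\<kappa> < 1" unfolding \<kappa>_def by (auto simp: power_less_one_iff)
  have rb: "0 \<le> qratio t \<and> qratio t \<le> 1" if "0 < t" for t using qratio_pos[of t] qratio_le_1[of t] that by simp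
  have le: "\<bar>ratio_iter k t - qratio t\<bar> \<le> \<kappa> ^ k" if "s \<le> t" for k t
    using that
  proof (induction k arbitrary: t)
    case 0
    then show ?case using rb[of t] s by simp
  next
    case (Suc k)
    have "\<bar>ratio_step (ratio_iter k) t - ratio_step qratio t\<bar> \<le> \<kappa> * \<kappa> ^ k"
      using ratio_step_contraction[of "ratio_iter k" qratio s "\<kappa> ^ k" t, OF ratio_iter_bounds rb Suc.IH s Suc.prems]
      by (simp only: \<kappa>_def[symmetric])
    then show ?case using qratio_fixpoint[of t] Suc.prems s by simp
  qed
  have "(\<lambda>k. \<kappa> ^ k) \<longlonglongrightarrow> 0" using \<kappa> by (intro LIMSEQ_power_zero) auto
  then have "(\<lambda>k. ratio_iter k s - qratio s) \<longlonglongrightarrow> 0"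
    by (rule Lim_null_comparison[rotated]) (use le in auto)
  then show ?thesis by (simp add: LIM_zero_iff)
qed

text \<open>The linear term of the denominator becomes \<open>(1 - c) * b * s powr \<beta>\<close>, the exponent of a stable
subordinator, and the shifts by powers of \<open>c\<close> become shifts by powers of \<open>c powr (1 / \<beta>)\<close>.\<close>
lemma sub_laplace_qratio:
  assumes \<beta>: "0 < \<beta>" "\<beta> \<le> 1"
  shows "sub_laplace (\<lambda>s. qratio (s powr \<beta>))"
proof (rule sub_laplace_LIMSEQ)
  show "sub_laplace (\<lambda>s. ratio_iter k (s powr \<beta>))" for k
  proof (induction k)
    case 0 show ?case by (simp add: sub_laplace_1)
  next
    case (Suc k)
    have shift: "sub_laplace (\<lambda>s. ratio_iter k (s powr \<beta> / c ^ Suc i))" for i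
    proof (rule sub_laplace_cong)
      define C where "C = (1 / c ^ Suc i) powr (1 / \<beta>)"
      have C: "0 < C" using c0 by (simp add: C_def)
      from sub_laplace_scale[OF Suc C] show "sub_laplace (\<lambda>s. ratio_iter k ((C * s) powr \<beta>))" .
      show "ratio_iter k ((C * s) powr \<beta>) = ratio_iter k (s powr \<beta> / c ^ Suc i)" if "0 < s" for s
        using that C c0 \<beta> by (simp add: powr_mult C_def powr_powr del: power_Suc)
    qed
    have "sub_laplace (\<lambda>s. \<Sum>n. jump_weight n / jump_tail 0 * (\<Prod>i\<le>n. ratio_iter k (s powr \<beta> / c ^ Suc i)))"
      using jump_weight_div_sums jump_weight_nonneg jump_tail_0_pos
      by (intro sub_laplace_mixture sub_laplace_prod shift) (auto simp: sums_iff)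
    moreover have "sub_laplace (\<lambda>s. exp (- (p * ((1 - c) * b * s powr \<beta>))))" if "p > 0" for p
      using sub_laplace_stable[OF \<beta>, of "p * ((1 - c) * b)"] that qc b by (simp add: mult.assoc)
    ultimately have "sub_laplace (\<lambda>s. 1 / (1 + jump_tail 0 * (1 - (\<Sum>n. jump_weight n / jump_tail 0 * (\<Prod>i\<le>n. ratio_iter k (s powr \<beta> / c ^ Suc i)))) + (1 - c) * b * s powr \<beta>))"
      using jump_tail_0_pos by (intro sub_laplace_inverse) auto
    then show ?case by (simp add: ratio_step_def)
  qed
  show "(\<lambda>k. ratio_iter k (s powr \<beta>)) \<longlonglongrightarrow> qratio (s powr \<beta>)" if "0 < s" for s
    using that by (intro ratio_iter_LIMSEQ) simp
qed

lemma sub_laplace_qlaplace_quotient: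
  assumes \<beta>: "0 < \<beta>" "\<beta> \<le> 1"
  shows "sub_laplace (\<lambda>s. qlaplace (s powr \<beta>) / qlaplace (c ^ n * s powr \<beta>))"
proof (rule sub_laplace_cong)
  have "sub_laplace (\<lambda>s. qratio (c ^ i * s powr \<beta>))" for i
  proof (rule sub_laplace_cong)
    define C where "C = (c ^ i) powr (1 / \<beta>)"
    have C: "0 < C" using c0 by (simp add: C_def)
    from sub_laplace_scale[OF sub_laplace_qratio[OF \<beta>] C] show "sub_laplace (\<lambda>s. qratio ((C * s) powr \<beta>))" .
    show "qratio ((C * s) powr \<beta>) = qratio (c ^ i * s powr \<beta>)" if "0 < s" for s
      using that C c0 \<beta> by (simp add: powr_mult C_def powr_powr)
  qed
  then show "sub_laplace (\<lambda>s. \<Prod>i<n. qratio (c ^ i * s powr \<beta>))" by (rule sub_laplace_prod)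
  fix s :: real assume "0 < s"
  then have "0 < qlaplace (c ^ i * s powr \<beta>)" for i using c0 by (intro qlaplace_pos) simp
  then have nz: "qlaplace (c ^ i * s powr \<beta>) \<noteq> 0" for i by (metis less_irrefl)
  show "(\<Prod>i<n. qratio (c ^ i * s powr \<beta>)) = qlaplace (s powr \<beta>) / qlaplace (c ^ n * s powr \<beta>)"
  proof (induction n)
    case 0 show ?case using nz[of 0] by simp
  next
    case (Suc n)
    then show ?case using nz[of n] nz[of "Suc n"] by (simp add: qratio_def mult.assoc)
  qed
qed

end

section \<open>Powers of the exponential law\<close>

definition std_exponential :: "real measure" where
  "std_exponential = density lborel (exponential_density 1)"

lemma sets_std_exponential [simp, measurable_cong]: "sets std_exponential = sets borel"
  by (simp add: std_exponential_def)

lemma space_std_exponential [simp]: "space std_exponential = UNIV"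
  by (simp add: std_exponential_def)

interpretation std_exponential: prob_space std_exponential
  unfolding std_exponential_def by (rule prob_space_exponential_density) simp

lemma real_distribution_std_exponential: "real_distribution std_exponential"
  by (simp add: real_distribution_def real_distribution_axioms_def std_exponential.prob_space_axioms)

lemma std_exponential_distributed:
  "distributed std_exponential lborel (\<lambda>x. x) (exponential_density 1)"
  unfolding distributed_def by (auto simp: std_exponential_def distr_id2)

lemma std_exponential_gt:
  assumes "0 \<le> x" shows "measure std_exponential {x<..} = exp (- x)"
proof -
  have "{x<..} = {w \<in> space std_exponential. x < w}" by auto
  then show ?thesis
    using std_exponential.exponential_distributedD_gt[OF std_exponential_distributed assms] by simp
qed

lemma AE_std_exponential_pos: "AE w in std_exponential. 0 < w"
proof -
  have "measure std_exponential {0<..} = 1" using std_exponential_gt[of 0] by simp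
  then show ?thesis by (subst (asm) std_exponential.prob_eq_1) auto
qed

lemma std_exponential_ge:
  assumes "0 \<le> x" shows "measure std_exponential {x..} = exp (- x)"
proof -
  have "AE w in lborel. w \<noteq> x" by (rule AE_lborel_singleton)
  then have "AE w in std_exponential. w \<noteq> x"
    unfolding std_exponential_def by (subst AE_density) auto
  then have "measure std_exponential {x..} = measure std_exponential {x<..}"
    by (intro std_exponential.finite_measure_eq_AE) auto
  then show ?thesis using std_exponential_gt[OF assms] by simp
qed

lemma cdf_std_exponential: "cdf std_exponential x = (if x \<le> 0 then 0 else 1 - exp (- x))"
proof -
  have "cdf std_exponential x = 1 - measure std_exponential {x<..}"
    unfolding cdf_def using std_exponential.prob_compl[of "{x<..}"]
    by (simp add: Compl_eq_Diff_UNIV[symmetric] Compl_greaterThan)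
  also have "\<dots> = (if x \<le> 0 then 0 else 1 - exp (- x))"
  proof (cases "x \<le> 0")
    case True
    have "measure std_exponential {x<..} = 1"
      by (subst std_exponential.prob_eq_1)
        (use AE_std_exponential_pos True in \<open>auto elim!: eventually_mono\<close>)
    then show ?thesis using True by simp
  qed (use std_exponential_gt[of x] in auto)
  finally show ?thesis .
qed

text \<open>For \<open>\<xi> < 0\<close> the map \<open>w \<mapsto> w powr \<xi>\<close> is decreasing, so lower tails come from upper tails of the
exponential law.\<close>
lemma extreme_value_distribution_conv_exponential:
  assumes \<xi>: "\<xi> \<noteq> 0"
  shows "extreme_value_distribution \<xi> = distr std_exponential borel (\<lambda>w. w powr \<xi>)"
proof (rule cdf_unique)
  show "real_distribution (extreme_value_distribution \<xi>)" by (rule real_distribution_extreme_value)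
  show "real_distribution (distr std_exponential borel (\<lambda>w. w powr \<xi>))"
    by (rule std_exponential.real_distribution_distr) simp
  show "cdf (extreme_value_distribution \<xi>) = cdf (distr std_exponential borel (\<lambda>w. w powr \<xi>))"
  proof
    fix x
    have eq: "cdf (distr std_exponential borel (\<lambda>w. w powr \<xi>)) x = measure std_exponential {w. w powr \<xi> \<le> x}"
      by (simp add: cdf_def measure_distr vimage_def)
    also have "\<dots> = extreme_value_cdf \<xi> x"
    proof (cases "x \<le> 0")
      case True
      have "measure std_exponential {w. w powr \<xi> \<le> x} = measure std_exponential {}"
      proof (rule std_exponential.finite_measure_eq_AE)
        show "AE w in std_exponential. (w \<in> {w. w powr \<xi> \<le> x}) = (w \<in> {})"
          using AE_std_exponential_pos
        proof eventually_elim
          case (elim w)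
          then have "0 < w powr \<xi>" by simp
          then have "x < w powr \<xi>" using True by linarith
          then show ?case by simp
        qed
      qed auto
      then show ?thesis using True \<xi> by (simp add: extreme_value_cdf_def)
    next
      case False
      then have x: "0 < x" by simp
      have iff: "w powr \<xi> \<le> x \<longleftrightarrow> (if \<xi> > 0 then w \<le> x powr (1 / \<xi>) else x powr (1 / \<xi>) \<le> w)" if "0 < w" for w
      proof -
        have "w powr \<xi> \<le> x \<longleftrightarrow> \<xi> * ln w \<le> ln x"
          using that x by (subst ln_le_cancel_iff[symmetric]) (auto simp: ln_powr)
        also have "\<dots> \<longleftrightarrow> (if \<xi> > 0 then ln w \<le> ln x / \<xi> else ln x / \<xi> \<le> ln w)"
          using \<xi> by (auto simp: pos_le_divide_eq neg_divide_le_eq mult.commute)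
        also have "\<dots> \<longleftrightarrow> (if \<xi> > 0 then w \<le> x powr (1 / \<xi>) else x powr (1 / \<xi>) \<le> w)"
          using that x ln_le_cancel_iff[of w "x powr (1 / \<xi>)"] ln_le_cancel_iff[of "x powr (1 / \<xi>)" w]
          by (simp add: ln_powr)
        finally show ?thesis .
      qed
      have "measure std_exponential {w. w powr \<xi> \<le> x}
          = measure std_exponential (if \<xi> > 0 then {..x powr (1 / \<xi>)} else {x powr (1 / \<xi>)..})"
      proof (rule std_exponential.finite_measure_eq_AE)
        show "AE w in std_exponential. (w \<in> {w. w powr \<xi> \<le> x}) = (w \<in> (if \<xi> > 0 then {..x powr (1 / \<xi>)} else {x powr (1 / \<xi>)..}))"
          using AE_std_exponential_pos by eventually_elim (use iff in auto)
      qed auto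
      also have "\<dots> = extreme_value_cdf \<xi> x"
        using x \<xi> cdf_std_exponential[of "x powr (1 / \<xi>)"] std_exponential_ge[of "x powr (1 / \<xi>)"]
        by (auto simp: extreme_value_cdf_def cdf_def)
      finally show ?thesis .
    qed
    finally show "cdf (extreme_value_distribution \<xi>) x = cdf (distr std_exponential borel (\<lambda>w. w powr \<xi>)) x"
      by (simp add: cdf_extreme_value)
  qed
qed

lemma AE_extreme_value_pos:
  assumes "\<xi> \<noteq> 0" shows "AE x in extreme_value_distribution \<xi>. 0 < x"
  unfolding extreme_value_distribution_conv_exponential[OF assms]
proof (subst AE_distr_iff)
  show "AE w in std_exponential. 0 < w powr \<xi>"
    using AE_std_exponential_pos by eventually_elim simp
qed auto

section \<open>The Frechet distributions\<close>

definition frechet_laplace :: "real \<Rightarrow> real \<Rightarrow> real" where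
  "frechet_laplace \<alpha> s = (\<integral>w. exp (- (s * w powr (- \<alpha>))) \<partial>std_exponential)"

text \<open>Both sides are the probability of \<open>V * W powr \<alpha> > s\<close> for independent standard exponential
variables \<open>V\<close> and \<open>W\<close>: conditioning on \<open>W\<close> gives the left-hand side, conditioning on \<open>V\<close> the
right-hand side.\<close>
lemma frechet_laplace_powr:
  assumes \<alpha>: "0 < \<alpha>" and s: "0 < s"
  shows "frechet_laplace \<alpha> s = frechet_laplace (1 / \<alpha>) (s powr (1 / \<alpha>))"
proof -
  let ?E = std_exponential
  interpret pair_sigma_finite ?E ?E
    by (simp add: pair_sigma_finite_def std_exponential.sigma_finite_measure)
  have tail: "(\<integral>\<^sup>+v. indicator {a<..} v \<partial>?E) = ennreal (exp (- a))" if "0 \<le> a" for a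
    using std_exponential_gt[OF that] by (simp add: std_exponential.emeasure_eq_measure)
  have repr: "ennreal (frechet_laplace \<gamma> t) = (\<integral>\<^sup>+w. \<integral>\<^sup>+v. indicator {t * w powr (- \<gamma>)<..} v \<partial>?E \<partial>?E)"
    if "0 < t" for \<gamma> t
  proof -
    have "ennreal (frechet_laplace \<gamma> t) = (\<integral>\<^sup>+w. ennreal (exp (- (t * w powr (- \<gamma>)))) \<partial>?E)"
      unfolding frechet_laplace_def
      by (intro nn_integral_eq_integral[symmetric] std_exponential.integrable_const_bound[where B = 1])
        (use that in auto)
    then show ?thesis using tail that by simp
  qed
  have iff: "s * w powr (- \<alpha>) < v \<longleftrightarrow> s powr (1 / \<alpha>) * v powr (- (1 / \<alpha>)) < w" if "0 < w" "0 < v" for v w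
  proof -
    have "s * w powr (- \<alpha>) < v \<longleftrightarrow> ln s - \<alpha> * ln w < ln v"
      using that s by (subst ln_less_cancel_iff[symmetric]) (auto simp: ln_mult ln_powr)
    also have "\<dots> \<longleftrightarrow> ln s / \<alpha> - ln v / \<alpha> < ln w"
      using \<alpha> by (auto simp: field_simps)
    also have "\<dots> \<longleftrightarrow> s powr (1 / \<alpha>) * v powr (- (1 / \<alpha>)) < w"
      using that s by (subst (2) ln_less_cancel_iff[symmetric]) (auto simp: ln_mult ln_powr)
    finally show ?thesis .
  qed
  have "ennreal (frechet_laplace \<alpha> s) = (\<integral>\<^sup>+w. \<integral>\<^sup>+v. indicator {s * w powr (- \<alpha>)<..} v \<partial>?E \<partial>?E)"
    by (rule repr[OF s])
  also have "\<dots> = (\<integral>\<^sup>+v. \<integral>\<^sup>+w. indicator {s * w powr (- \<alpha>)<..} v \<partial>?E \<partial>?E)"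
  proof (rule Fubini'[symmetric])
    have "(\<lambda>(v, w). indicator {x. s * snd x powr (- \<alpha>) < fst x} (w, v)::ennreal) \<in> borel_measurable (?E \<Otimes>\<^sub>M ?E)"
      by measurable
    then show "(\<lambda>(w, v). indicator {s * w powr (- \<alpha>)<..} v :: ennreal) \<in> borel_measurable (?E \<Otimes>\<^sub>M ?E)"
      by (simp add: indicator_def split_beta')
  qed
  also have "\<dots> = (\<integral>\<^sup>+v. \<integral>\<^sup>+w. indicator {s powr (1 / \<alpha>) * v powr (- (1 / \<alpha>))<..} w \<partial>?E \<partial>?E)"
  proof (rule nn_integral_cong_AE)
    show "AE v in ?E. (\<integral>\<^sup>+w. indicator {s * w powr (- \<alpha>)<..} v \<partial>?E) = (\<integral>\<^sup>+w. indicator {s powr (1 / \<alpha>) * v powr (- (1 / \<alpha>))<..} w \<partial>?E)"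
      using AE_std_exponential_pos
    proof eventually_elim
      case (elim v)
      show ?case
      proof (rule nn_integral_cong_AE)
        show "AE w in ?E. (indicator {s * w powr (- \<alpha>)<..} v :: ennreal) = indicator {s powr (1 / \<alpha>) * v powr (- (1 / \<alpha>))<..} w"
          using AE_std_exponential_pos by eventually_elim (use iff elim in \<open>auto simp: indicator_def\<close>)
      qed
    qed
  qed
  also have "\<dots> = ennreal (frechet_laplace (1 / \<alpha>) (s powr (1 / \<alpha>)))"
    using s by (intro repr[symmetric]) simp
  finally show ?thesis
    by (subst (asm) ennreal_inj) (auto simp: frechet_laplace_def)
qed

lemma has_laplace_frechet:
  assumes "\<xi> < 0" shows "has_laplace (extreme_value_distribution \<xi>) (frechet_laplace (- \<xi>))"
proof -
  have e: "extreme_value_distribution \<xi> = distr std_exponential borel (\<lambda>w. w powr \<xi>)"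
    using assms by (intro extreme_value_distribution_conv_exponential) simp
  have "(\<integral>x. exp (- (s * x)) \<partial>extreme_value_distribution \<xi>) = frechet_laplace (- \<xi>) s" for s
    unfolding e by (subst integral_distr) (auto simp: frechet_laplace_def)
  moreover have "AE x in extreme_value_distribution \<xi>. 0 \<le> x"
    using AE_extreme_value_pos[of \<xi>] assms by (auto simp: less_imp_le)
  ultimately show ?thesis
    by (simp add: has_laplace_def real_distribution_extreme_value)
qed

lemma frechet_laplace_pos: "0 < \<alpha> \<Longrightarrow> 0 < s \<Longrightarrow> 0 < frechet_laplace \<alpha> s"
  using has_laplace_pos[OF has_laplace_frechet[of "- \<alpha>"]] by simp

text \<open>If \<open>k\<close> is the last index with \<open>x < q ^ k / (1 - q)\<close>, the tail is \<open>qtail k\<close>, and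
\<open>q ^ Suc k / (1 - q)\<close> lies between \<open>q * x\<close> and \<open>x\<close>.\<close>
lemma (in q_parameter) qprob_tail:
  assumes x: "0 < x" "(1 - q) * x < 1"
  defines "T \<equiv> measure (embed_pmf qprob) {j. x < q ^ j / (1 - q)}"
  shows "exp (- (x / (1 - (1 - q) * x))) \<le> T" "T \<le> exp (- (q * x))"
proof -
  define j where "j = (LEAST i. q ^ i / (1 - q) \<le> x)"
  have "\<exists>i. q ^ i / (1 - q) \<le> x"
  proof -
    obtain i where "q ^ i < x * (1 - q)" using real_arch_pow_inv[of "x * (1 - q)" q] x q by auto
    then have "q ^ i / (1 - q) \<le> x" using q by (simp add: field_simps)
    then show ?thesis ..
  qed
  then have j: "q ^ j / (1 - q) \<le> x" unfolding j_def by (rule LeastI_ex)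
  have "j \<noteq> 0"
  proof
    assume "j = 0"
    then show False using j x q by (simp add: field_simps)
  qed
  then obtain k where k: "j = Suc k" by (cases j) auto
  have kx: "x < q ^ k / (1 - q)"
    using not_less_Least[of k "\<lambda>i. q ^ i / (1 - q) \<le> x"] k by (simp add: j_def[symmetric] not_le)
  have "{i. x < q ^ i / (1 - q)} = {..k}"
  proof (intro equalityI subsetI)
    fix i assume i: "i \<in> {i. x < q ^ i / (1 - q)}"
    show "i \<in> {..k}"
    proof (rule ccontr)
      assume "i \<notin> {..k}"
      then have "q ^ i \<le> q ^ j" using q k by (intro power_decreasing) auto
      then have "q ^ i / (1 - q) \<le> x" using j q by (intro order_trans[OF divide_right_mono j]) auto
      then show False using i by simp
    qed
  next
    fix i assume "i \<in> {..k}"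
    then have "q ^ k \<le> q ^ i" using q by (intro power_decreasing) auto
    then have "q ^ k / (1 - q) \<le> q ^ i / (1 - q)" using q by (intro divide_right_mono) auto
    then show "i \<in> {i. x < q ^ i / (1 - q)}" using kx by simp
  qed
  then have "T = (\<Sum>i\<le>k. qprob i)"
    unfolding T_def using pmf_of_sums[OF less_imp_le[OF qprob_pos] qprob_sums]
    by (simp add: measure_measure_pmf_finite)
  then have T: "T = qtail k" by (simp add: sum_qprob)
  define w where "w = q ^ Suc k / (1 - q)"
  have w: "q * x \<le> w" "w \<le> x" "q ^ Suc k = (1 - q) * w" "0 < w"
  proof -
    show "q * x \<le> w"
      using mult_left_mono[OF less_imp_le[OF kx], of q] q by (simp add: w_def)
  qed (use j k q in \<open>auto simp: w_def\<close>)
  have "T \<le> exp (- w)" using qtail_le[of k] by (simp add: T w_def)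
  then show "T \<le> exp (- (q * x))" using w by (simp add: order_trans[of T "exp (- w)"])
  have "(1 - q) * w \<le> (1 - q) * x" using w q by (intro mult_left_mono) auto
  then have "w / (1 - (1 - q) * w) \<le> x / (1 - (1 - q) * x)"
    using w x by (intro frac_le) auto
  then have "exp (- (x / (1 - (1 - q) * x))) \<le> exp (- (w / (1 - (1 - q) * w)))" by simp
  also have "\<dots> \<le> T"
    using qtail_ge[of k] q unfolding T w(3) by simp
  finally show "exp (- (x / (1 - (1 - q) * x))) \<le> T" .
qed

lemma qprob_weak_conv:
  fixes q :: "nat \<Rightarrow> real"
  assumes q: "\<And>m. q_parameter (q m)" and lim: "q \<longlonglongrightarrow> 1"
  shows "weak_conv_m (\<lambda>m. distr (measure_pmf (embed_pmf (q_parameter.qprob (q m)))) borel (\<lambda>j. q m ^ j / (1 - q m))) std_exponential"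
  unfolding weak_conv_m_def weak_conv_def
proof (intro allI impI)
  fix x
  let ?P = "\<lambda>m. measure_pmf (embed_pmf (q_parameter.qprob (q m)))"
  define T where "T m = measure (?P m) {j. x < q m ^ j / (1 - q m)}" for m
  have qm: "0 < q m" "q m < 1" for m using q[of m] by (simp_all add: q_parameter_def)
  have cdf: "cdf (distr (?P m) borel (\<lambda>j. q m ^ j / (1 - q m))) x = 1 - T m" for m
  proof -
    have "cdf (distr (?P m) borel (\<lambda>j. q m ^ j / (1 - q m))) x = measure (?P m) (UNIV - {j. x < q m ^ j / (1 - q m)})"
      by (auto simp: cdf_def measure_distr intro!: arg_cong[where f = "measure (?P m)"])
    then show ?thesis using measure_pmf.prob_compl[of "{j. x < q m ^ j / (1 - q m)}" "embed_pmf (q_parameter.qprob (q m))"]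
      by (simp add: T_def)
  qed
  show "(\<lambda>m. cdf (distr (?P m) borel (\<lambda>j. q m ^ j / (1 - q m))) x) \<longlonglongrightarrow> cdf std_exponential x"
  proof (cases "x \<le> 0")
    case True
    have "{j. x < q m ^ j / (1 - q m)} = UNIV" for m
      using True qm[of m] by (auto intro: le_less_trans)
    then have "T m = 1" for m by (simp add: T_def)
    then show ?thesis using True by (simp add: cdf cdf_std_exponential)
  next
    case False
    have "T \<longlonglongrightarrow> exp (- x)"
    proof (rule tendsto_sandwich)
      have "(\<lambda>m. (1 - q m) * x) \<longlonglongrightarrow> (1 - 1) * x" by (intro tendsto_intros lim)
      then have ev: "\<forall>\<^sub>F m in sequentially. (1 - q m) * x < 1" by (intro order_tendstoD(2)) auto
      show "\<forall>\<^sub>F m in sequentially. exp (- (x / (1 - (1 - q m) * x))) \<le> T m"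
        using ev by eventually_elim (use q_parameter.qprob_tail(1)[OF q] False in \<open>simp add: T_def\<close>)
      show "\<forall>\<^sub>F m in sequentially. T m \<le> exp (- (q m * x))"
        using ev by eventually_elim (use q_parameter.qprob_tail(2)[OF q] False in \<open>simp add: T_def\<close>)
      have "(\<lambda>m. exp (- (x / (1 - (1 - q m) * x)))) \<longlonglongrightarrow> exp (- (x / (1 - (1 - 1) * x)))"
        by (intro tendsto_intros lim) auto
      then show "(\<lambda>m. exp (- (x / (1 - (1 - q m) * x)))) \<longlonglongrightarrow> exp (- x)" by simp
      have "(\<lambda>m. exp (- (q m * x))) \<longlonglongrightarrow> exp (- (1 * x))" by (intro tendsto_intros lim)
      then show "(\<lambda>m. exp (- (q m * x))) \<longlonglongrightarrow> exp (- x)" by simp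
    qed
    then have "(\<lambda>m. 1 - T m) \<longlonglongrightarrow> 1 - exp (- x)" by (intro tendsto_intros)
    then show ?thesis using False by (simp add: cdf cdf_std_exponential)
  qed
qed

text \<open>Replacing \<open>qexp\<close> by the exponential function costs at most \<open>8 * (1 - c)\<close> uniformly; the rest
is weak convergence, tested with the function \<open>exp (- s * w powr (- \<alpha>))\<close>.\<close>
lemma qlaplace_LIMSEQ_frechet_laplace:
  fixes q c :: "nat \<Rightarrow> real"
  assumes \<alpha>: "0 < \<alpha>" and q: "\<And>m. q_parameter (q m)" "q \<longlonglongrightarrow> 1"
    and c: "\<And>m. c m = q m powr \<alpha>" and W: "\<And>m. q_weights (q m) (c m) ((1 - q m) powr \<alpha>)" and s: "0 < s"
  shows "(\<lambda>m. q_weights.qlaplace (q m) (c m) ((1 - q m) powr \<alpha>) s) \<longlonglongrightarrow> frechet_laplace \<alpha> s"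
proof -
  define P where "P m = embed_pmf (q_parameter.qprob (q m))" for m
  define N where "N m = distr (measure_pmf (P m)) borel (\<lambda>j. q m ^ j / (1 - q m))" for m
  define h :: "real \<Rightarrow> real" where "h w = (if w \<le> 0 then 0 else exp (- (s * w powr (- \<alpha>))))" for w
  have h1: "\<bar>h w\<bar> \<le> 1" for w using s by (simp add: h_def)
  have qm: "0 < q m" "q m < 1" for m using q(1)[of m] by (simp_all add: q_parameter_def)
  have clim: "c \<longlonglongrightarrow> 1"
  proof -
    have "(\<lambda>m. q m powr \<alpha>) \<longlonglongrightarrow> 1 powr \<alpha>" using q(2) by (intro tendsto_intros) auto
    moreover have "c = (\<lambda>m. q m powr \<alpha>)" using c by auto
    ultimately show ?thesis by simp
  qed
  have hm[measurable]: "h \<in> borel_measurable borel" unfolding h_def by measurable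
  have "(\<lambda>m. \<integral>w. h w \<partial>N m) \<longlonglongrightarrow> (\<integral>w. h w \<partial>std_exponential)"
  proof (rule weak_conv_imp_bdd_ae_continuous_conv)
    show "real_distribution (N m)" for m
      unfolding N_def by (rule prob_space.real_distribution_distr[OF measure_pmf.prob_space_axioms]) simp
    show "real_distribution std_exponential" by (rule real_distribution_std_exponential)
    show "weak_conv_m N std_exponential"
      using qprob_weak_conv[OF q] by (simp add: N_def[abs_def] P_def)
    have "{x. \<not> isCont h x} \<subseteq> {0}"
    proof (intro subsetI, rule ccontr)
      fix x assume x: "x \<in> {x. \<not> isCont h x}" "x \<notin> {0}"
      have "isCont h x"
      proof (cases "x < 0")
        case True
        have "\<forall>\<^sub>F w in nhds x. h w = 0"
          using eventually_nhds_in_open[of "{..<0}" x] True by (auto elim!: eventually_mono simp: h_def)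
        then show ?thesis by (subst isCont_cong) auto
      next
        case False
        with x have "x > 0" by simp
        then have "\<forall>\<^sub>F w in nhds x. h w = exp (- (s * w powr (- \<alpha>)))"
          using eventually_nhds_in_open[of "{0<..}" x] by (auto elim!: eventually_mono simp: h_def)
        then show ?thesis
          using \<open>x > 0\<close> by (subst isCont_cong) (auto intro!: continuous_intros)
      qed
      then show False using x by simp
    qed
    moreover have "emeasure std_exponential {0} = 0"
    proof -
      have "emeasure std_exponential {0} = emeasure std_exponential {}"
        by (rule emeasure_eq_AE) (use AE_std_exponential_pos in \<open>auto elim!: eventually_mono\<close>)
      then show ?thesis by simp
    qed
    moreover have "emeasure std_exponential {x. \<not> isCont h x} \<le> emeasure std_exponential {0}"
      using calculation(1) by (intro emeasure_mono) auto
    ultimately show "emeasure std_exponential {x. \<not> isCont h x} = 0" by simp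
  qed (use h1 in auto)
  also have "(\<integral>w. h w \<partial>std_exponential) = frechet_laplace \<alpha> s"
    unfolding frechet_laplace_def
  proof (rule integral_cong_AE)
    show "AE w in std_exponential. h w = exp (- (s * w powr (- \<alpha>)))"
      using AE_std_exponential_pos by eventually_elim (simp add: h_def)
  qed auto
  finally have lim: "(\<lambda>m. \<integral>w. h w \<partial>N m) \<longlonglongrightarrow> frechet_laplace \<alpha> s" .
  have "\<bar>q_weights.qlaplace (q m) (c m) ((1 - q m) powr \<alpha>) s - (\<integral>w. h w \<partial>N m)\<bar> \<le> 8 * (1 - c m)" for m
  proof -
    interpret q_weights "q m" "c m" "(1 - q m) powr \<alpha>" by (rule W)
    have pmfP: "pmf (P m) j = qprob j" for j
      unfolding P_def by (rule pmf_of_sums[OF less_imp_le[OF qprob_pos] qprob_sums])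
    have arg: "s * (1 - q m) powr \<alpha> / c m ^ j = s * (q m ^ j / (1 - q m)) powr (- \<alpha>)" for j
    proof -
      have "(q m ^ j / (1 - q m)) powr (- \<alpha>) = (1 - q m) powr \<alpha> / (q m ^ j) powr \<alpha>"
        using qm[of m] by (simp add: powr_divide powr_minus field_simps)
      also have "(q m ^ j) powr \<alpha> = c m ^ j"
        using qm[of m] by (simp add: c powr_powr powr_realpow[symmetric] mult.commute)
      finally show ?thesis by simp
    qed
    have "(\<lambda>j. pmf (P m) j * h (q m ^ j / (1 - q m))) sums (\<integral>j. h (q m ^ j / (1 - q m)) \<partial>P m)"
      using h1 by (rule pmf_nat_expectation)
    moreover have "h (q m ^ j / (1 - q m)) = exp (- (s * (1 - q m) powr \<alpha> / c m ^ j))" for j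
      unfolding arg h_def using qm[of m] by (simp add: not_le)
    moreover have "(\<integral>j. h (q m ^ j / (1 - q m)) \<partial>P m) = (\<integral>w. h w \<partial>N m)"
      unfolding N_def by (subst integral_distr) auto
    ultimately have "(\<lambda>j. qprob j * exp (- (s * (1 - q m) powr \<alpha> / c m ^ j))) sums (\<integral>w. h w \<partial>N m)"
      by (simp add: pmfP)
    from sums_diff[OF qlaplace_sums[OF less_imp_le[OF s]] this]
    have 1: "(\<lambda>j. qprob j * (qexp (c m) (s * (1 - q m) powr \<alpha> / c m ^ j) - exp (- (s * (1 - q m) powr \<alpha> / c m ^ j))))
       sums (qlaplace s - (\<integral>w. h w \<partial>N m))" by (simp add: right_diff_distrib)
    have 2: "(\<lambda>j. qprob j * (8 * (1 - c m))) sums (1 * (8 * (1 - c m)))"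
      by (intro sums_mult2 qprob_sums)
    have le: "norm (qprob j * (qexp (c m) (s * (1 - q m) powr \<alpha> / c m ^ j) - exp (- (s * (1 - q m) powr \<alpha> / c m ^ j))))
        \<le> qprob j * (8 * (1 - c m))" for j
      using qprob_pos[of j] qexp_minus_exp[OF c0 qc(2) arg_nonneg[OF less_imp_le[OF s]], of j]
      by (simp add: abs_mult mult_left_mono less_imp_le)
    have "norm (\<Sum>j. qprob j * (qexp (c m) (s * (1 - q m) powr \<alpha> / c m ^ j) - exp (- (s * (1 - q m) powr \<alpha> / c m ^ j))))
      \<le> (\<Sum>j. qprob j * (8 * (1 - c m)))"
      using le sums_summable[OF 2] by (rule norm_suminf_le)
    then show ?thesis using sums_unique[OF 1] sums_unique[OF 2] by simp
  qed
  note bound = this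
  have "(\<lambda>m. 8 * (1 - c m)) \<longlonglongrightarrow> 8 * (1 - 1)" by (intro tendsto_intros clim)
  then have "(\<lambda>m. 8 * (1 - c m)) \<longlonglongrightarrow> 0" by simp
  moreover have "\<forall>\<^sub>F m in sequentially. norm (q_weights.qlaplace (q m) (c m) ((1 - q m) powr \<alpha>) s - (\<integral>w. h w \<partial>N m)) \<le> 8 * (1 - c m)"
    using bound by simp
  ultimately have "(\<lambda>m. q_weights.qlaplace (q m) (c m) ((1 - q m) powr \<alpha>) s - (\<integral>w. h w \<partial>N m)) \<longlonglongrightarrow> 0"
    by (rule Lim_null_comparison[rotated])
  from tendsto_add[OF this lim] show ?thesis by simp
qed

text \<open>Taking \<open>C m\<close> as the root of \<open>c\<close> of order \<open>Suc m\<close>, the quotient of the approximations at \<open>s\<close> and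
\<open>c * s\<close> runs over \<open>Suc m\<close> steps of the lattice with ratio \<open>C m\<close>.\<close>
lemma sub_laplace_frechet_quotient_powr:
  assumes \<alpha>: "0 < \<alpha>" "\<alpha> \<le> 1" and \<beta>: "0 < \<beta>" "\<beta> \<le> 1" and c: "0 < c" "c < 1"
  shows "sub_laplace (\<lambda>s. frechet_laplace \<alpha> (s powr \<beta>) / frechet_laplace \<alpha> (c * s powr \<beta>))"
proof -
  define C where "C m = c powr (1 / real (Suc m))" for m
  define q where "q m = C m powr (1 / \<alpha>)" for m
  have C: "0 < C m" "C m < 1" "C m ^ Suc m = c" for m
  proof -
    show "0 < C m" using c by (simp add: C_def)
    show "C m < 1" using c powr_less_mono2[of "1 / real (Suc m)" c 1] by (simp add: C_def)
    have "C m ^ Suc m = C m powr (real (Suc m))"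
      using powr_realpow[OF \<open>0 < C m\<close>, of "Suc m"] by (rule sym)
    then show "C m ^ Suc m = c" using c by (simp add: C_def powr_powr)
  qed
  have q: "0 < q m" "q m < 1" "q m \<le> C m" "C m = q m powr \<alpha>" for m
  proof -
    show "0 < q m" using C(1)[of m] by (simp add: q_def)
    show "q m < 1" using C[of m] \<alpha> powr_less_mono2[of "1 / \<alpha>" "C m" 1] by (simp add: q_def)
    have "q m \<le> C m powr 1" unfolding q_def using C[of m] \<alpha> by (intro powr_mono') auto
    then show "q m \<le> C m" using C[of m] by simp
    show "C m = q m powr \<alpha>" using C(1)[of m] \<alpha> by (simp add: q_def powr_powr)
  qed
  have Clim: "C \<longlonglongrightarrow> 1"
  proof -
    have "(\<lambda>m. 1 / real (Suc m)) \<longlonglongrightarrow> 0" by real_asymp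
    then have "(\<lambda>m. c powr (1 / real (Suc m))) \<longlonglongrightarrow> c powr 0" using c by (intro tendsto_intros) auto
    then show ?thesis using c by (simp add: C_def[abs_def])
  qed
  have qlim: "q \<longlonglongrightarrow> 1"
  proof -
    have "(\<lambda>m. C m powr (1 / \<alpha>)) \<longlonglongrightarrow> 1 powr (1 / \<alpha>)" using Clim by (intro tendsto_intros) auto
    then show ?thesis by (simp add: q_def[abs_def])
  qed
  have P: "q_parameter (q m)" for m using q by (simp add: q_parameter_def)
  have W: "q_weights (q m) (C m) ((1 - q m) powr \<alpha>)" for m
    using q[of m] C[of m] P[of m] by (simp add: q_weights_def q_weights_axioms_def)
  let ?f = "\<lambda>m. q_weights.qlaplace (q m) (C m) ((1 - q m) powr \<alpha>)"
  have lim: "(\<lambda>m. ?f m s) \<longlonglongrightarrow> frechet_laplace \<alpha> s" if "0 < s" for s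
    by (rule qlaplace_LIMSEQ_frechet_laplace[OF \<alpha>(1) P qlim q(4) W that])
  show ?thesis
  proof (rule sub_laplace_LIMSEQ)
    show "sub_laplace (\<lambda>s. ?f m (s powr \<beta>) / ?f m (c * s powr \<beta>))" for m
      using q_weights.sub_laplace_qlaplace_quotient[OF W \<beta>, of m "Suc m"] by (simp only: C(3))
    fix s :: real assume "0 < s"
    then show "(\<lambda>m. ?f m (s powr \<beta>) / ?f m (c * s powr \<beta>)) \<longlonglongrightarrow> frechet_laplace \<alpha> (s powr \<beta>) / frechet_laplace \<alpha> (c * s powr \<beta>)"
      using c frechet_laplace_pos[OF \<alpha>(1), of "c * s powr \<beta>"] by (intro tendsto_divide lim) auto
  qed
qed

lemma sub_laplace_frechet_quotient:
  assumes \<alpha>: "0 < \<alpha>" and c: "0 < c" "c < 1"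
  shows "sub_laplace (\<lambda>s. frechet_laplace \<alpha> s / frechet_laplace \<alpha> (c * s))"
proof (cases "\<alpha> \<le> 1")
  case True
  show ?thesis
    by (rule sub_laplace_cong[OF _ sub_laplace_frechet_quotient_powr[OF \<alpha> True, of 1 c]]) (use c in auto)
next
  case False
  define \<beta> where "\<beta> = 1 / \<alpha>"
  have \<beta>: "0 < \<beta>" "\<beta> \<le> 1" using \<alpha> False by (auto simp: \<beta>_def)
  have cb: "0 < c powr \<beta>" "c powr \<beta> < 1" using c \<beta> powr_less_mono2[of \<beta> c 1] by auto
  show ?thesis
  proof (rule sub_laplace_cong[OF _ sub_laplace_frechet_quotient_powr[OF \<beta> \<beta> cb]])
    fix s :: real assume "0 < s"
    then show "frechet_laplace \<beta> (s powr \<beta>) / frechet_laplace \<beta> (c powr \<beta> * s powr \<beta>) = frechet_laplace \<alpha> s / frechet_laplace \<alpha> (c * s)"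
      using frechet_laplace_powr[OF \<alpha>, of s] frechet_laplace_powr[OF \<alpha>, of "c * s"] c by (simp add: \<beta>_def powr_mult)
  qed
qed

lemma frechet_self_decomposable:
  assumes "\<xi> < 0" shows "self_decomposable (extreme_value_distribution \<xi>)"
  using assms
  by (intro self_decomposable_laplace[OF has_laplace_frechet] frechet_laplace_pos sub_laplace_frechet_quotient) auto

lemma frechet_infinitely_divisible:
  assumes "\<xi> < 0" shows "infinitely_divisible (extreme_value_distribution \<xi>)"
proof -
  have M: "has_laplace (extreme_value_distribution \<xi>) (frechet_laplace (- \<xi>))"
    by (rule has_laplace_frechet[OF assms])
  have root: "sub_laplace (\<lambda>s. frechet_laplace (- \<xi>) s powr t)" if "0 < t" for t
    using assms that
    by (intro sub_laplace_powr_of_quotients has_laplace_imp_sub_laplace[OF M] has_laplace_tendsto_1[OF M]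
      frechet_laplace_pos sub_laplace_frechet_quotient) auto
  show ?thesis by (rule infinitely_divisible_laplace[OF M has_laplace_pos[OF M] root])
qed

section \<open>Weibull distributions with shape parameter at least one\<close>

text \<open>A mixture of powers of \<open>G\<close> with negative binomial weights.\<close>
lemma sub_laplace_negative_binomial:
  assumes G: "sub_laplace G" and p: "0 < p" "p \<le> 1" and t: "0 < t"
  shows "sub_laplace (\<lambda>s. (p / (1 - (1 - p) * G s)) powr t)"
proof -
  define w where "w k = p powr t * (pochhammer t k / fact k) * (1 - p) ^ k" for k
  have S: "(\<lambda>k. w k * y ^ k) sums ((p / (1 - (1 - p) * y)) powr t)" if y: "0 \<le> y" "y \<le> 1" for y
  proof -
    have y': "(1 - p) * y \<le> 1 - p" "0 \<le> (1 - p) * y" using y p by (auto intro: mult_left_le)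
    then have "(\<lambda>k. (- t gchoose k) * (- ((1 - p) * y)) ^ k) sums (1 + - ((1 - p) * y)) powr (- t)"
      using p by (intro Generalised_Binomial_Theorem.gen_binomial_real) auto
    then have "(\<lambda>k. p powr t * ((- t gchoose k) * (- ((1 - p) * y)) ^ k)) sums (p powr t * (1 + - ((1 - p) * y)) powr (- t))"
      by (rule sums_mult)
    also have "(\<lambda>k. p powr t * ((- t gchoose k) * (- ((1 - p) * y)) ^ k)) = (\<lambda>k. w k * y ^ k)"
    proof
      fix k
      have "(- t gchoose k) * (- ((1 - p) * y)) ^ k = ((-1) ^ k * (-1) ^ k) * (pochhammer t k / fact k) * ((1 - p) ^ k * y ^ k)"
        by (subst power_minus) (simp add: gbinomial_pochhammer power_mult_distrib)
      also have "((-1) ^ k * (-1) ^ k :: real) = 1" by (simp add: power_mult_distrib[symmetric])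
      finally show "p powr t * ((- t gchoose k) * (- ((1 - p) * y)) ^ k) = w k * y ^ k"
        by (simp add: w_def)
    qed
    also have "p powr t * (1 + - ((1 - p) * y)) powr (- t) = (p / (1 - (1 - p) * y)) powr t"
    proof -
      have "0 \<le> 1 - (1 - p) * y" using y' p by linarith
      then show ?thesis using p by (simp add: powr_divide powr_minus_divide)
    qed
    finally show ?thesis .
  qed
  have w0: "0 \<le> w k" for k unfolding w_def using p pochhammer_nonneg[OF t, of k]
    by (intro mult_nonneg_nonneg divide_nonneg_nonneg zero_le_power) auto
  have "w sums 1" using S[of 1] p by simp
  then have "sub_laplace (\<lambda>s. \<Sum>k. w k * G s ^ k)"
    by (intro sub_laplace_mixture sub_laplace_power G w0) (auto simp: sums_iff)
  then show ?thesis
  proof (rule sub_laplace_cong[rotated])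
    fix s :: real assume "0 < s"
    then show "(\<Sum>k. w k * G s ^ k) = (p / (1 - (1 - p) * G s)) powr t"
      using S[of "G s"] sub_laplace_bounds[OF G] by (simp add: sums_iff)
  qed
qed

text \<open>The solution of the renewal equation \<open>kaluza_renewal\<close>, so that the generating function \<open>P\<close> of \<open>p\<close>
satisfies \<open>P z = p 0 + z * K z * P z\<close>, where \<open>K\<close> is the generating function of \<open>kaluza p\<close>.\<close>
fun kaluza :: "(nat \<Rightarrow> real) \<Rightarrow> nat \<Rightarrow> real" where
  "kaluza p m = (p (Suc m) - (\<Sum>n<m. kaluza p n * p (m - n))) / p 0"

declare kaluza.simps [simp del]

lemma kaluza_renewal:
  assumes "p 0 \<noteq> 0" shows "(\<Sum>n\<le>m. kaluza p n * p (m - n)) = p (Suc m)"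
  using assms by (simp add: lessThan_Suc_atMost[symmetric] kaluza.simps[of p m])

text \<open>Log-convexity means that the ratios \<open>p (Suc n) / p n\<close> increase. Scaling the renewal equation for
\<open>p m\<close> by the ratio at \<open>m\<close> and subtracting it from the one for \<open>p (Suc m)\<close> leaves only nonnegative
terms.\<close>
lemma kaluza_nonneg:
  assumes pos: "\<And>n. 0 < p n" and conv: "\<And>n. (p (Suc n))\<^sup>2 \<le> p n * p (Suc (Suc n))"
  shows "0 \<le> kaluza p m"
proof (induction m rule: less_induct)
  case (less m)
  have ratio: "p (Suc i) / p i \<le> p (Suc j) / p j" if "i \<le> j" for i j
    using that
  proof (induction j)
    case (Suc j)
    have "p (Suc j) / p j \<le> p (Suc (Suc j)) / p (Suc j)"
      using conv[of j] pos[of j] pos[of "Suc j"] by (simp add: field_simps power2_eq_square)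
    then show ?case using Suc by (cases "i = Suc j") auto
  qed simp
  show ?case
  proof (cases m)
    case 0
    then show ?thesis using pos[of 0] pos[of 1] by (subst kaluza.simps) (simp add: less_imp_le)
  next
    case (Suc k)
    \<comment> \<open>The ratio at \<open>m\<close> dominates all earlier ratios.\<close>
    define R where "R = p (Suc m) / p m"
    have "p (Suc m) = R * p m" using pos[of m] by (simp add: R_def)
    also have "p m = (\<Sum>n<m. kaluza p n * p (k - n))"
      using kaluza_renewal[of p k] pos[of 0] by (simp add: Suc lessThan_Suc_atMost)
    finally have "p (Suc m) - (\<Sum>n<m. kaluza p n * p (m - n)) = (\<Sum>n<m. kaluza p n * (R * p (k - n) - p (m - n)))"
      by (simp add: sum_distrib_left sum_subtractf right_diff_distrib mult_ac)
    also have "\<dots> \<ge> 0"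
    proof (intro sum_nonneg mult_nonneg_nonneg)
      fix n assume n: "n \<in> {..<m}"
      show "0 \<le> kaluza p n" using less n by simp
      have "p (Suc (k - n)) / p (k - n) \<le> R" unfolding R_def using Suc by (intro ratio) simp
      then show "0 \<le> R * p (k - n) - p (m - n)"
        using pos[of "k - n"] n Suc by (simp add: field_simps Suc_diff_le)
    qed
    finally have "0 \<le> p (Suc m) - (\<Sum>n<m. kaluza p n * p (m - n))" .
    then show ?thesis using pos[of 0] by (subst kaluza.simps) (rule divide_nonneg_pos)
  qed
qed

text \<open>The total mass of \<open>kaluza p\<close> is \<open>1 - p 0\<close>, so the law \<open>p\<close> is a geometric compound of the
normalised \<open>kaluza p\<close>, and its powers are negative binomial compounds.\<close>
lemma sub_laplace_log_convex_lattice: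
  assumes pos: "\<And>n. 0 < p n" and conv: "\<And>n. (p (Suc n))\<^sup>2 \<le> p n * p (Suc (Suc n))"
    and p: "p sums 1" and h: "0 < h" and t: "0 < t"
  shows "sub_laplace (\<lambda>s. (\<Sum>n. p n * exp (- (s * (h * real n)))) powr t)"
proof -
  define w where "w = kaluza p"
  have w0: "0 \<le> w n" for n unfolding w_def by (rule kaluza_nonneg[of p, OF pos conv])
  have p0: "p 0 \<noteq> 0" using pos[of 0] by simp
  have ren: "(\<Sum>n\<le>m. w n * p (m - n)) = p (Suc m)" for m
    unfolding w_def by (rule kaluza_renewal[of p, OF p0])
  have sp: "summable p" using p by (simp add: sums_iff)
  have wp: "w n \<le> p (Suc n) / p 0" for n
  proof -
    have "w n * p (n - n) \<le> (\<Sum>i\<le>n. w i * p (n - i))"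
      using pos w0 by (intro member_le_sum) (auto simp: less_imp_le)
    then show ?thesis unfolding ren using pos[of 0] by (simp add: field_simps)
  qed
  have sw: "summable w"
  proof (rule summable_comparison_test')
    show "summable (\<lambda>n. p (Suc n) / p 0)" using sp by (intro summable_divide) (simp add: summable_Suc_iff)
    show "norm (w n) \<le> p (Suc n) / p 0" if "0 \<le> n" for n using w0[of n] wp[of n] by simp
  qed
  have P: "summable (\<lambda>n. p n * z ^ n)" "summable (\<lambda>n. w n * z ^ n)"
    "(\<Sum>n. p n * z ^ n) = p 0 + z * (\<Sum>n. w n * z ^ n) * (\<Sum>n. p n * z ^ n)" if z: "0 \<le> z" "z \<le> 1" for z
  proof -
    show s1: "summable (\<lambda>n. p n * z ^ n)"
      by (rule summable_comparison_test'[OF sp, of 0]) (use z pos in \<open>auto simp: abs_mult less_imp_le intro!: mult_left_le power_le_one\<close>)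
    show s2: "summable (\<lambda>n. w n * z ^ n)"
      by (rule summable_comparison_test'[OF sw, of 0]) (use z w0 in \<open>auto simp: abs_mult intro!: mult_left_le power_le_one\<close>)
    have "(\<lambda>m. \<Sum>n\<le>m. w n * z ^ n * (p (m - n) * z ^ (m - n))) sums ((\<Sum>n. w n * z ^ n) * (\<Sum>n. p n * z ^ n))"
      using s1 s2 z pos w0 by (intro Cauchy_product_sums) (simp_all add: abs_mult less_imp_le)
    also have "(\<lambda>m. \<Sum>n\<le>m. w n * z ^ n * (p (m - n) * z ^ (m - n))) = (\<lambda>m. p (Suc m) * z ^ m)"
    proof
      fix m
      have "(\<Sum>n\<le>m. w n * z ^ n * (p (m - n) * z ^ (m - n))) = (\<Sum>n\<le>m. w n * p (m - n) * z ^ m)"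
        by (rule sum.cong) (auto simp: power_add[symmetric])
      then show "(\<Sum>n\<le>m. w n * z ^ n * (p (m - n) * z ^ (m - n))) = p (Suc m) * z ^ m"
        by (simp add: sum_distrib_right[symmetric] ren)
    qed
    finally have "(\<lambda>m. z * (p (Suc m) * z ^ m)) sums (z * ((\<Sum>n. w n * z ^ n) * (\<Sum>n. p n * z ^ n)))"
      by (rule sums_mult)
    then have "(\<lambda>m. p (Suc m) * z ^ Suc m) sums (z * ((\<Sum>n. w n * z ^ n) * (\<Sum>n. p n * z ^ n)))"
      by (simp add: mult_ac)
    then have "(\<Sum>m. p (Suc m) * z ^ Suc m) = z * ((\<Sum>n. w n * z ^ n) * (\<Sum>n. p n * z ^ n))"
      by (simp only: sums_iff)
    then show "(\<Sum>n. p n * z ^ n) = p 0 + z * (\<Sum>n. w n * z ^ n) * (\<Sum>n. p n * z ^ n)"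
      using suminf_split_head[OF s1] by (simp add: mult.assoc)
  qed
  have sum_w: "suminf w = 1 - p 0"
    using P(3)[of 1] p by (simp add: sums_iff)
  have p01: "0 < p 0" "p 0 < 1"
  proof -
    have "p 0 + p 1 \<le> (\<Sum>n. p n)" using sum_le_suminf[OF sp, of "{0,1}"] pos by (simp add: less_imp_le)
    then show "p 0 < 1" using pos[of 1] p by (simp add: sums_iff)
  qed (rule pos)
  define G where "G s = (\<Sum>n. w n / (1 - p 0) * exp (- (s * (h * real (Suc n)))))" for s
  have "sub_laplace G"
    unfolding G_def[abs_def]
  proof (rule sub_laplace_mixture)
    show "summable (\<lambda>n. w n / (1 - p 0))" by (rule summable_divide[OF sw])
    show "(\<Sum>n. w n / (1 - p 0)) \<le> 1" using suminf_divide[OF sw, of "1 - p 0"] sum_w p01 by simp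
  qed (use w0 p01 h in \<open>auto intro!: sub_laplace_exp\<close>)
  then have "sub_laplace (\<lambda>s. (p 0 / (1 - (1 - p 0) * G s)) powr t)"
    using p01 t by (intro sub_laplace_negative_binomial) auto
  then show ?thesis
  proof (rule sub_laplace_cong[rotated])
    fix s :: real assume s: "0 < s"
    define z where "z = exp (- (s * h))"
    have z: "0 \<le> z" "z \<le> 1" using s h by (auto simp: z_def)
    have zn: "exp (- (s * (h * real n))) = z ^ n" for n
      by (simp add: z_def exp_of_nat_mult[symmetric] mult_ac)
    have "(1 - p 0) * G s = (\<Sum>n. (1 - p 0) * (w n / (1 - p 0) * z ^ Suc n))"
    proof -
      have "(\<lambda>n. w n / (1 - p 0) * z ^ Suc n) = (\<lambda>n. z / (1 - p 0) * (w n * z ^ n))" by auto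
      then have "summable (\<lambda>n. w n / (1 - p 0) * z ^ Suc n)" using P(2)[OF z] by (simp only: summable_mult)
      then show ?thesis unfolding G_def zn by (rule suminf_mult[symmetric])
    qed
    also have "\<dots> = (\<Sum>n. z * (w n * z ^ n))" using p01 by (simp add: mult_ac)
    also have "\<dots> = z * (\<Sum>n. w n * z ^ n)" by (rule suminf_mult[OF P(2)[OF z]])
    finally have GW: "(1 - p 0) * G s = z * (\<Sum>n. w n * z ^ n)" .
    define S where "S = (\<Sum>n. p n * z ^ n)"
    have "S * (1 - (1 - p 0) * G s) = p 0"
      using P(3)[OF z] unfolding GW S_def[symmetric] by (simp add: algebra_simps)
    then have "S = p 0 / (1 - (1 - p 0) * G s)" using p0 by (metis mult_zero_right nonzero_eq_divide_eq)
    then show "(p 0 / (1 - (1 - p 0) * G s)) powr t = (\<Sum>n. p n * exp (- (s * (h * real n)))) powr t"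
      unfolding zn S_def by simp
  qed
qed

text \<open>With \<open>v = exp (- (h * x))\<close> the differences are the integrals of \<open>v ^ n * (1 - v)\<close>, and the
integral of \<open>v ^ n * (1 - v) * (r - v)\<^sup>2\<close> is a nonnegative quadratic polynomial in \<open>r\<close>.\<close>
lemma laplace_differences_log_convex:
  assumes N: "has_laplace N F" and h: "0 \<le> h"
  defines "F0 \<equiv> (\<lambda>s. \<integral>x. exp (- (s * x)) \<partial>N)"
  defines "p \<equiv> (\<lambda>n::nat. F0 (h * real n) - F0 (h * real (Suc n)))"
  assumes pos: "0 < p n"
  shows "(p (Suc n))\<^sup>2 \<le> p n * p (Suc (Suc n))"
proof -
  interpret real_distribution N using N by (simp add: has_laplace_def)
  have ae: "AE x in N. 0 \<le> x" using N by (simp add: has_laplace_def)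
  have i: "integrable N (\<lambda>x. exp (- (h * real n * x)))" for n
    using h by (intro has_laplace_integrable[OF real_distribution_axioms ae]) simp
  define r where "r = p (Suc n) / p n"
  define A where "A m = (\<lambda>x. exp (- (h * real m * x)) - exp (- (h * real (Suc m) * x)))" for m
  have pA: "p m = (\<integral>x. A m x \<partial>N)" and iA: "integrable N (A m)" for m
    unfolding p_def F0_def A_def using i[of m] i[of "Suc m"] by auto
  have "0 \<le> (\<integral>x. r\<^sup>2 * A n x - 2 * r * A (Suc n) x + A (Suc (Suc n)) x \<partial>N)"
  proof (rule integral_nonneg_AE)
    show "AE x in N. 0 \<le> r\<^sup>2 * A n x - 2 * r * A (Suc n) x + A (Suc (Suc n)) x"
      using ae
    proof eventually_elim
      case (elim x)
      define v where "v = exp (- (h * x))"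
      have v: "0 \<le> v" "v \<le> 1" using elim h by (auto simp: v_def)
      have Av: "A m x = v ^ m * (1 - v)" for m
      proof -
        have "exp (- (h * real k * x)) = v ^ k" for k
          by (simp add: v_def exp_of_nat_mult[symmetric] mult_ac)
        then show ?thesis unfolding A_def by (simp only:) (simp add: algebra_simps)
      qed
      have "r\<^sup>2 * A n x - 2 * r * A (Suc n) x + A (Suc (Suc n)) x = v ^ n * (1 - v) * (r - v)\<^sup>2"
        unfolding Av by (simp add: power2_eq_square algebra_simps)
      then show ?case using v by simp
    qed
  qed
  also have "\<dots> = r\<^sup>2 * p n - 2 * r * p (Suc n) + p (Suc (Suc n))"
    unfolding pA using iA[of n] iA[of "Suc n"] iA[of "Suc (Suc n)"] by simp
  also have "r\<^sup>2 * p n = (p (Suc n))\<^sup>2 / p n" using pos by (simp add: r_def power2_eq_square)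
  also have "2 * r * p (Suc n) = 2 * ((p (Suc n))\<^sup>2 / p n)" by (simp add: r_def power2_eq_square)
  finally have "(p (Suc n))\<^sup>2 / p n \<le> p (Suc (Suc n))" by simp
  then show ?thesis using pos by (simp add: field_simps)
qed

text \<open>Rounding down to the lattice of mesh \<open>h\<close> changes \<open>exp (- (s * x))\<close> by a factor between \<open>1\<close> and
\<open>exp (s * h)\<close>.\<close>
lemma laplace_lattice_bounds:
  assumes M: "real_distribution M" and ae: "AE x in M. 0 < x" and h: "0 < h" and s: "0 < s"
  defines "p \<equiv> (\<lambda>n. measure M {h * real n<..h * real (Suc n)})"
  shows "(\<integral>x. exp (- (s * x)) \<partial>M) \<le> (\<Sum>n. p n * exp (- (s * (h * real n))))"
    "exp (- (s * h)) * (\<Sum>n. p n * exp (- (s * (h * real n)))) \<le> (\<integral>x. exp (- (s * x)) \<partial>M)"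
proof -
  interpret real_distribution M by fact
  define A where "A n = {h * real n<..h * real (Suc n)}" for n
  have dis: "disjoint_family A"
    unfolding disjoint_family_on_def
  proof (intro ballI impI equals0I)
    fix m n x assume mn: "m \<noteq> n" and "x \<in> A m \<inter> A n"
    then have "h * real m < h * real (Suc n)" "h * real n < h * real (Suc m)"
      by (auto simp: A_def simp del: of_nat_Suc)
    then have "m < Suc n" "n < Suc m" using h by (simp_all del: of_nat_Suc)
    then show False using mn by simp
  qed
  have un: "(\<Union>n. A n) = {0<..}"
  proof (intro equalityI subsetI)
    fix x assume "x \<in> (\<Union>n. A n)"
    then obtain n where "h * real n < x" by (auto simp: A_def)
    moreover have "0 \<le> h * real n" using h by simp
    ultimately show "x \<in> {0<..}" by simp
  next
    fix x :: real assume "x \<in> {0<..}"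
    then have x: "0 < x" by simp
    obtain m where "x / h < real m" using reals_Archimedean2 by blast
    then have "x \<le> h * real m" using h by (simp add: field_simps)
    then have ex: "x \<le> h * real (Suc m)" using h by (simp add: algebra_simps)
    define k where "k = (LEAST k. x \<le> h * real (Suc k))"
    have k: "x \<le> h * real (Suc k)" unfolding k_def by (rule LeastI[of "\<lambda>k. x \<le> h * real (Suc k)", OF ex])
    have "h * real k < x"
    proof (cases k)
      case (Suc j)
      then have "\<not> x \<le> h * real (Suc j)" by (intro not_less_Least) (simp add: k_def)
      then show ?thesis by (simp add: Suc)
    qed (use x in simp)
    then show "x \<in> (\<Union>n. A n)" using k by (auto simp: A_def)
  qed
  have pA: "p n = measure M (A n)" for n by (simp add: p_def A_def)
  have "(\<lambda>n. measure M (A n)) sums measure M (\<Union>n. A n)"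
    by (rule finite_measure_UNION[OF _ dis]) (auto simp: A_def)
  then have sp: "summable p" by (simp add: sums_iff pA[abs_def])
  have "summable (\<lambda>n. p n * exp (- (s * (h * real n))))"
    by (rule summable_comparison_test'[OF sp, of 0])
      (use s h in \<open>auto simp: abs_mult pA intro!: mult_left_le\<close>)
  then have E: "(\<lambda>n. p n * exp (- (s * (h * real n)))) sums (\<Sum>n. p n * exp (- (s * (h * real n))))"
    by (rule summable_sums)
  define I where "I n = (\<integral>x. indicator (A n) x * exp (- (s * x)) \<partial>M)" for n
  have i: "integrable M (\<lambda>x. exp (- (s * x)))"
    by (rule has_laplace_integrable[OF M]) (use ae s in auto)
  have iA: "integrable M (\<lambda>x. indicator (A n) x * exp (- (s * x)))" for n
    using integrable_mult_indicator[OF _ i, of "A n"] by (simp add: A_def)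
  have iK: "integrable M (\<lambda>x. indicator (A n) x * K)" for n and K :: real
    by (rule integrable_const_bound[where B = "\<bar>K\<bar>"]) (auto simp: A_def indicator_def)
  have pe: "p n = (\<integral>x. indicator (A n) x \<partial>M)" for n by (simp add: p_def A_def)
  have up: "I n \<le> p n * exp (- (s * (h * real n)))" for n
  proof -
    have "I n \<le> (\<integral>x. indicator (A n) x * exp (- (s * (h * real n))) \<partial>M)"
      unfolding I_def using s
      by (intro integral_mono iA iK) (auto simp: A_def indicator_def)
    then show ?thesis by (simp add: pe)
  qed
  have lo: "exp (- (s * h)) * (p n * exp (- (s * (h * real n)))) \<le> I n" for n
  proof -
    have "(\<integral>x. indicator (A n) x * exp (- (s * (h * real (Suc n)))) \<partial>M) \<le> I n"
      unfolding I_def using s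
      by (intro integral_mono iA iK) (auto simp: A_def indicator_def)
    then show ?thesis by (simp add: pe exp_add[symmetric] algebra_simps)
  qed
  have "I sums (\<integral>x. (\<Sum>n. indicator (A n) x * exp (- (s * x))) \<partial>M)"
    unfolding I_def
  proof (rule sums_integral[OF iA])
    have ind: "(\<lambda>n. indicator (A n) x * exp (- (s * x))) sums (indicator (\<Union>n. A n) x * exp (- (s * x)))" for x
      using dis by (intro sums_mult2 indicator_sums) (auto simp: disjoint_family_on_def)
    show "AE x in M. summable (\<lambda>n. norm (indicator (A n) x * exp (- (s * x))))"
      using ind by (intro AE_I2) (simp add: abs_mult sums_iff)
    have "(\<integral>x. norm (indicator (A n) x * exp (- (s * x))) \<partial>M) = I n" for n
      unfolding I_def by (intro Bochner_Integration.integral_cong) (auto simp: abs_mult)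
    moreover have "0 \<le> I n" for n unfolding I_def by simp
    then have "summable I"
      by (intro summable_comparison_test'[OF sums_summable[OF E], of 0]) (use up in auto)
    ultimately show "summable (\<lambda>n. \<integral>x. norm (indicator (A n) x * exp (- (s * x))) \<partial>M)" by simp
  qed
  also have "(\<integral>x. (\<Sum>n. indicator (A n) x * exp (- (s * x))) \<partial>M) = (\<integral>x. exp (- (s * x)) \<partial>M)"
  proof (rule integral_cong_AE)
    show "AE x in M. (\<Sum>n. indicator (A n) x * exp (- (s * x))) = exp (- (s * x))"
      using ae
    proof eventually_elim
      case (elim x)
      have "(\<lambda>n. indicator (A n) x * exp (- (s * x))) sums (indicator (\<Union>n. A n) x * exp (- (s * x)))"
        using dis by (intro sums_mult2 indicator_sums) (auto simp: disjoint_family_on_def)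
      then show ?case using elim unfolding un by (simp add: sums_iff)
    qed
    show "(\<lambda>x. \<Sum>n. indicator (A n) x * exp (- (s * x))) \<in> borel_measurable M"
      unfolding A_def by measurable
  qed auto
  finally have I: "I sums (\<integral>x. exp (- (s * x)) \<partial>M)" .
  show "(\<integral>x. exp (- (s * x)) \<partial>M) \<le> (\<Sum>n. p n * exp (- (s * (h * real n))))"
    using sums_le[OF up I E] .
  show "exp (- (s * h)) * (\<Sum>n. p n * exp (- (s * (h * real n)))) \<le> (\<integral>x. exp (- (s * x)) \<partial>M)"
    using sums_le[OF lo sums_mult[OF E] I] .
qed

text \<open>The survival function \<open>T\<close> is the transform of a stable law \<open>N\<close>, which makes the lattice
approximations of \<open>M\<close> log-convex.\<close>
lemma weibull_infinitely_divisible: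
  assumes \<xi>: "1 \<le> \<xi>" shows "infinitely_divisible (extreme_value_distribution \<xi>)"
proof -
  define M where "M = extreme_value_distribution \<xi>"
  define \<beta> where "\<beta> = 1 / \<xi>"
  have \<beta>: "0 < \<beta>" "\<beta> \<le> 1" using \<xi> by (auto simp: \<beta>_def)
  have M: "real_distribution M" unfolding M_def by (rule real_distribution_extreme_value)
  then interpret M: real_distribution M .
  have aeM: "AE x in M. 0 < x" unfolding M_def using \<xi> by (intro AE_extreme_value_pos) simp
  define \<phi> where "\<phi> s = (\<integral>x. exp (- (s * x)) \<partial>M)" for s
  have L: "has_laplace M \<phi>"
    unfolding has_laplace_def \<phi>_def using M aeM by (auto simp: less_imp_le)
  define T where "T x = exp (- (x powr \<beta>))" for x :: real
  have "sub_laplace T"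
    using sub_laplace_stable[OF \<beta>, of 1] by (simp add: T_def[abs_def])
  moreover have "(T \<longlongrightarrow> 1) (at_right 0)"
    unfolding T_def using \<beta> by real_asymp
  ultimately obtain N where N: "has_laplace N T"
    using sub_laplace_imp_has_laplace by blast
  then interpret N: real_distribution N by (simp add: has_laplace_def)
  have T: "T x = (\<integral>y. exp (- (x * y)) \<partial>N)" if "0 \<le> x" for x
    using N that N.prob_space by (cases "x = 0") (auto simp: has_laplace_def T_def)
  have cdfM: "cdf M x = 1 - T x" if "0 \<le> x" for x
    using that \<xi> unfolding M_def cdf_extreme_value by (auto simp: extreme_value_cdf_def T_def \<beta>_def)
  define h where "h m = 1 / real (Suc m)" for m
  have h: "0 < h m" for m by (simp add: h_def)
  define p where "p m n = measure M {h m * real n<..h m * real (Suc n)}" for m n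
  have pT: "p m n = T (h m * real n) - T (h m * real (Suc n))" for m n
  proof -
    have "h m * real n < h m * real (Suc n)" using h[of m] by simp
    from M.cdf_diff_eq[OF this] h[of m] show ?thesis by (simp add: p_def cdfM less_imp_le del: of_nat_Suc)
  qed
  have ppos: "0 < p m n" for m n
    unfolding pT T_def using h[of m] \<beta> by (simp add: powr_less_mono2 del: of_nat_Suc)
  have pconv: "(p m (Suc n))\<^sup>2 \<le> p m n * p m (Suc (Suc n))" for m n
    using laplace_differences_log_convex[OF N less_imp_le[OF h[of m]], of n] ppos[of m n] h[of m]
    by (simp add: pT T less_imp_le del: of_nat_Suc)
  have psum: "p m sums 1" for m
  proof -
    have "(\<lambda>n. T (h m * real n)) \<longlonglongrightarrow> 0" unfolding T_def using h[of m] \<beta> by real_asymp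
    from telescope_sums'[OF this] show ?thesis
      using \<beta> by (simp add: pT[abs_def] T_def)
  qed
  define S where "S m s = (\<Sum>n. p m n * exp (- (s * (h m * real n))))" for m s
  have S: "(\<lambda>m. S m s) \<longlonglongrightarrow> \<phi> s" if s: "0 < s" for s
  proof (rule tendsto_sandwich)
    have lo: "\<phi> s \<le> S m s" and up: "exp (- (s * h m)) * S m s \<le> \<phi> s" for m
      using laplace_lattice_bounds[OF M aeM h[of m] s] by (simp_all only: \<phi>_def S_def p_def)
    show "\<forall>\<^sub>F m in sequentially. \<phi> s \<le> S m s" using lo by simp
    have "S m s \<le> exp (s * h m) * \<phi> s" for m
      using up[of m] by (simp add: exp_minus field_simps)
    then show "\<forall>\<^sub>F m in sequentially. S m s \<le> exp (s * h m) * \<phi> s" by simp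
    have "h \<longlonglongrightarrow> 0" unfolding h_def by real_asymp
    then have "(\<lambda>m. exp (s * h m) * \<phi> s) \<longlonglongrightarrow> exp (s * 0) * \<phi> s" by (intro tendsto_intros)
    then show "(\<lambda>m. exp (s * h m) * \<phi> s) \<longlonglongrightarrow> \<phi> s" by simp
  qed simp
  show ?thesis
    unfolding M_def[symmetric]
  proof (rule infinitely_divisible_laplace[OF L has_laplace_pos[OF L]])
    fix t :: real assume t: "0 < t"
    show "sub_laplace (\<lambda>s. \<phi> s powr t)"
    proof (rule sub_laplace_LIMSEQ)
      show "sub_laplace (\<lambda>s. S m s powr t)" for m
        unfolding S_def by (rule sub_laplace_log_convex_lattice[OF ppos pconv psum h t])
      show "(\<lambda>m. S m s powr t) \<longlonglongrightarrow> \<phi> s powr t" if "0 < s" for s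
        using has_laplace_pos[OF L that] by (intro tendsto_powr S that tendsto_const) auto
    qed
  qed
qed

section \<open>Weibull distributions with shape parameter below one\<close>

text \<open>If one summand is negative and the others are nonpositive, the sum is negative.\<close>
lemma convolution_power_nonneg:
  assumes N: "real_distribution N" and n: "1 \<le> n" and ae: "AE x in convolution_power N n. 0 \<le> x"
  shows "AE x in N. 0 \<le> x"
proof -
  interpret N: real_distribution N by fact
  obtain m where m: "n = Suc m" using n by (cases n) auto
  have P: "real_distribution (convolution_power N k)" for k by (rule real_distribution_convolution_power[OF N])
  interpret P: real_distribution "convolution_power N n" by (rule P)
  have "measure N {..<0} * measure N {..0} ^ m \<le> measure N {..<0} * measure (convolution_power N m) {..0}"
    using convolution_power_tails(2)[OF N, of 0 m] by (intro mult_left_mono) auto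
  also have "\<dots> \<le> measure (convolution_power N n) {..<0}"
    unfolding m convolution_power.simps by (intro measure_convolution_ge N P) auto
  also have "\<dots> = 0"
  proof -
    have "measure (convolution_power N n) {..<0} = measure (convolution_power N n) {}"
    proof (rule P.finite_measure_eq_AE)
      show "AE x in convolution_power N n. (x \<in> {..<0}) = (x \<in> {})"
        using ae by eventually_elim auto
    qed auto
    then show ?thesis by simp
  qed
  finally have "measure N {..<0} * measure N {..0} ^ m = 0"
    by (meson antisym measure_nonneg mult_nonneg_nonneg zero_le_power)
  moreover have "measure N {..<0} \<le> measure N {..0}" by (intro N.finite_measure_mono) auto
  ultimately have "measure N {..<0} = 0"
    using measure_nonneg[of N "{..<0}"] by (auto simp: antisym)
  then have "measure N {0..} = 1"
    using N.prob_compl[of "{..<0}"] by (simp add: Compl_eq_Diff_UNIV[symmetric] Compl_lessThan)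
  then show ?thesis by (subst (asm) N.prob_eq_1) auto
qed

text \<open>Let \<open>Y\<close> have law \<open>N\<close> and let \<open>y = 1 - exp (- Y)\<close>. Since \<open>y \<le> Y\<close> and \<open>y \<le> 1\<close>, the second moment of \<open>y\<close> is at most
\<open>\<epsilon>\<close> times its mean plus the mass of \<open>{\<epsilon>..}\<close>. After multiplication by \<open>n\<close>, the mean
becomes at most \<open>- ln (F 1)\<close>, and the second moment is at least the variance
\<open>G 2 - G 1 ^ 2\<close>, which contributes at least \<open>F 2 - F 1 ^ 2\<close>.\<close>
lemma root_tail_lower_bound:
  assumes N: "has_laplace N G" and n: "1 \<le> n" and F: "\<And>s. 0 < s \<Longrightarrow> F s = G s ^ n"
    and pos: "\<And>s. 0 < s \<Longrightarrow> 0 < F s" and \<epsilon>: "0 < \<epsilon>"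
  shows "F 2 - F 1 ^ 2 - (- ln (F 1)) * \<epsilon> \<le> real n * measure N {\<epsilon>..}"
proof -
  interpret real_distribution N using N by (simp add: has_laplace_def)
  have ae: "AE x in N. 0 \<le> x" using N by (simp add: has_laplace_def)
  have i: "integrable N (\<lambda>x. exp (- (s * x)))" if "0 < s" for s
    using has_laplace_integrable[OF real_distribution_axioms ae, of s] that by simp
  have i1: "integrable N (\<lambda>x. exp (- x))" using i[of 1] by simp
  have G: "G 1 = (\<integral>x. exp (- x) \<partial>N)" "G 2 = (\<integral>x. exp (- (2 * x)) \<partial>N)"
    using N by (auto simp: has_laplace_def)
  have sl: "sub_laplace G" by (rule has_laplace_imp_sub_laplace[OF N])
  have G1: "0 < G s" "G s \<le> 1" if "0 < s" for s
  proof -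
    show "G s \<le> 1" using sub_laplace_bounds[OF sl that] by simp
    have "G s \<noteq> 0"
      using pos[OF that] F[OF that] n by (auto simp: power_0_left)
    then show "0 < G s" using sub_laplace_bounds[OF sl that] by simp
  qed
  have I: "integrable N (\<lambda>x. indicator {\<epsilon>..} x :: real)"
    by (rule integrable_const_bound[where B = 1]) auto
  have "1 - 2 * G 1 + G 2 = (\<integral>x. 1 - 2 * exp (- x) + exp (- (2 * x)) \<partial>N)"
    using i1 i[of 2] prob_space by (simp add: G)
  also have "\<dots> \<le> (\<integral>x. \<epsilon> * (1 - exp (- x)) + indicator {\<epsilon>..} x \<partial>N)"
  proof (rule integral_mono_AE)
    show "AE x in N. 1 - 2 * exp (- x) + exp (- (2 * x)) \<le> \<epsilon> * (1 - exp (- x)) + indicator {\<epsilon>..} x"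
      using ae
    proof eventually_elim
      case (elim x)
      define y where "y = 1 - exp (- x)"
      have y: "0 \<le> y" "y \<le> 1" "y \<le> x" using elim exp_ge_add_one_self[of "- x"] by (auto simp: y_def)
      have "1 - 2 * exp (- x) + exp (- (2 * x)) = y * y"
        by (simp add: y_def algebra_simps exp_add[symmetric])
      also have "\<dots> \<le> \<epsilon> * y + indicator {\<epsilon>..} x"
      proof (cases "\<epsilon> \<le> x")
        case True
        have "y * y \<le> 1" using y by (intro mult_le_one) auto
        then show ?thesis using True y \<epsilon> by (simp add: add_increasing)
      next
        case False
        then show ?thesis using y by (simp add: mult_right_mono)
      qed
      finally show ?case by (simp add: y_def)
    qed
  qed (use i1 i[of 2] I in auto)
  also have "\<dots> = \<epsilon> * (1 - G 1) + measure N {\<epsilon>..}"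
    using i1 I prob_space by (simp add: G)
  finally have "1 - 2 * G 1 + G 2 \<le> \<epsilon> * (1 - G 1) + measure N {\<epsilon>..}" .
  moreover have "G 2 - G 1 ^ 2 \<le> 1 - 2 * G 1 + G 2"
    using zero_le_power2[of "1 - G 1"] by (simp add: power2_eq_square algebra_simps)
  ultimately have "G 2 - G 1 ^ 2 \<le> \<epsilon> * (1 - G 1) + measure N {\<epsilon>..}" by linarith
  then have "real n * (G 2 - G 1 ^ 2) \<le> real n * (\<epsilon> * (1 - G 1) + measure N {\<epsilon>..})"
    by (intro mult_left_mono) auto
  moreover have "F 2 - F 1 ^ 2 \<le> real n * (G 2 - G 1 ^ 2)"
  proof -
    have *: "u ^ n - v ^ n \<le> real n * (u - v)" if uv: "0 \<le> v" "v \<le> u" "u \<le> 1" for u v :: real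
    proof (induction n)
      case (Suc n)
      have "u ^ Suc n - v ^ Suc n = u * (u ^ n - v ^ n) + v ^ n * (u - v)" by (simp add: algebra_simps)
      also have "\<dots> \<le> 1 * (u ^ n - v ^ n) + 1 * (u - v)"
        using uv by (intro add_mono mult_right_mono) (auto intro: power_mono power_le_one)
      finally show ?case using Suc by (simp add: algebra_simps)
    qed simp
    have "0 \<le> (\<integral>x. (exp (- x) - G 1)\<^sup>2 \<partial>N)" by simp
    then have "G 1 ^ 2 \<le> G 2" unfolding has_laplace_variance(2)[OF N] by simp
    from *[OF _ this] have "G 2 ^ n - (G 1 ^ 2) ^ n \<le> real n * (G 2 - G 1 ^ 2)" using G1[of 2] by simp
    then show ?thesis using F[of 1] F[of 2] by (simp add: power_mult[symmetric] mult.commute)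
  qed
  moreover have "real n * (1 - G 1) \<le> - ln (F 1)"
  proof -
    have "ln (G 1) \<le> G 1 - 1" using G1[of 1] by (intro ln_le_minus_one) auto
    then have "real n * (1 - G 1) \<le> real n * (- ln (G 1))" by (intro mult_left_mono) auto
    then show ?thesis using F[of 1] G1[of 1] by (simp add: ln_realpow)
  qed
  then have "\<epsilon> * (real n * (1 - G 1)) \<le> \<epsilon> * (- ln (F 1))" using \<epsilon> by (intro mult_left_mono) auto
  ultimately show ?thesis by (simp add: algebra_simps)
qed

text \<open>The constants \<open>\<delta>\<close> and \<open>\<epsilon>\<close> come from the variance of \<open>exp (- X)\<close>, which is positive because the
distribution function takes a value strictly between \<open>0\<close> and \<open>1\<close>.\<close>
lemma weibull_not_infinitely_divisible:
  assumes \<xi>: "0 < \<xi>" "\<xi> < 1" shows "\<not> infinitely_divisible (extreme_value_distribution \<xi>)"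
proof
  define M where "M = extreme_value_distribution \<xi>"
  define a where "a = 1 / \<xi>"
  have a: "1 < a" using \<xi> by (simp add: a_def)
  assume "infinitely_divisible (extreme_value_distribution \<xi>)"
  then have ID: "\<exists>N. real_distribution N \<and> M = convolution_power N n" if "1 \<le> n" for n
    using that by (auto simp: infinitely_divisible_def M_def)
  have M: "real_distribution M" unfolding M_def by (rule real_distribution_extreme_value)
  then interpret M: real_distribution M .
  have aeM: "AE x in M. 0 \<le> x"
    unfolding M_def using AE_extreme_value_pos[of \<xi>] \<xi> by (auto simp: less_imp_le)
  define F where "F s = (\<integral>x. exp (- (s * x)) \<partial>M)" for s
  have L: "has_laplace M F" unfolding has_laplace_def F_def using M aeM by auto
  have Fpos: "0 < F s" if "0 < s" for s by (rule has_laplace_pos[OF L that])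
  have cdfM: "cdf M x = 1 - exp (- (x powr a))" if "0 < x" for x
    using that \<xi> unfolding M_def cdf_extreme_value by (simp add: extreme_value_cdf_def a_def)
  have \<kappa>: "0 < F 2 - F 1 ^ 2"
  proof (rule ccontr)
    assume "\<not> 0 < F 2 - F 1 ^ 2"
    moreover have "0 \<le> (\<integral>x. (exp (- x) - F 1)\<^sup>2 \<partial>M)" by simp
    ultimately have 0: "(\<integral>x. (exp (- x) - F 1)\<^sup>2 \<partial>M) = 0" unfolding has_laplace_variance(2)[OF L] by linarith
    then have "AE x in M. (exp (- x) - F 1)\<^sup>2 = 0"
      using has_laplace_variance(1)[OF L] by (subst (asm) integral_nonneg_eq_0_iff_AE) auto
    then have k: "AE x in M. x = - ln (F 1)"
    proof eventually_elim
      case (elim x)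
      then have "F 1 = exp (- x)" by simp
      then show ?case by simp
    qed
    have "cdf M 1 = (if - ln (F 1) \<le> 1 then 1 else 0)"
    proof (cases "- ln (F 1) \<le> 1")
      case True
      have "measure M {..1} = 1"
      proof (subst M.prob_eq_1)
        show "AE x in M. x \<in> {..1}" using k by eventually_elim (use True in simp)
      qed auto
      then show ?thesis using True by (simp add: cdf_def)
    next
      case False
      have "measure M {..1} = measure M {}"
      proof (rule M.finite_measure_eq_AE)
        show "AE x in M. (x \<in> {..1}) = (x \<in> {})" using k by eventually_elim (use False in simp)
      qed auto
      then show ?thesis using False by (simp add: cdf_def)
    qed
    then show False using cdfM[of 1] by (simp split: if_splits)
  qed
  define l where "l = - ln (F 1)"
  have l: "0 \<le> l"
    using sub_laplace_bounds(2)[OF has_laplace_imp_sub_laplace[OF L], of 1] Fpos[of 1] by (simp add: l_def)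
  define \<delta> where "\<delta> = (F 2 - F 1 ^ 2) / 2"
  define \<epsilon> where "\<epsilon> = \<delta> / (l + 1)"
  have \<delta>2: "2 * \<delta> = F 2 - F 1 ^ 2" by (simp only: \<delta>_def) simp
  have \<delta>: "0 < \<delta>" using \<kappa> by (simp add: \<delta>_def)
  have \<epsilon>: "0 < \<epsilon>" "l * \<epsilon> \<le> \<delta>" using \<delta> l by (auto simp: \<epsilon>_def field_simps)
  have key: "(\<delta> / real n) ^ n \<le> exp (- ((real n * \<epsilon> / 2) powr a))" if n: "1 \<le> n" for n
  proof -
    obtain N where N: "real_distribution N" and MN: "M = convolution_power N n" using ID[OF n] by blast
    interpret N: real_distribution N by fact
    have "AE x in N. 0 \<le> x" using aeM unfolding MN by (rule convolution_power_nonneg[OF N n])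
    then have LN: "has_laplace N (\<lambda>s. \<integral>x. exp (- (s * x)) \<partial>N)"
      using N by (simp add: has_laplace_def)
    have FN: "F s = (\<integral>x. exp (- (s * x)) \<partial>N) ^ n" if "0 < s" for s
      using has_laplace_convolution_power[OF LN, of n] that unfolding MN[symmetric] has_laplace_def F_def by simp
    have "F 2 - F 1 ^ 2 - (- ln (F 1)) * \<epsilon> \<le> real n * measure N {\<epsilon>..}"
      by (rule root_tail_lower_bound[OF LN n FN Fpos \<epsilon>(1)])
    then have "2 * \<delta> - l * \<epsilon> \<le> real n * measure N {\<epsilon>..}"
      by (simp only: \<delta>2 l_def)
    then have "\<delta> \<le> real n * measure N {\<epsilon>..}" using \<epsilon>(2) by linarith
    then have "\<delta> / real n \<le> measure N {\<epsilon>..}" using n by (simp add: field_simps)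
    then have "(\<delta> / real n) ^ n \<le> measure N {\<epsilon>..} ^ n" using \<delta> by (intro power_mono) auto
    also have "\<dots> \<le> measure M {real n * \<epsilon>..}"
      unfolding MN by (rule convolution_power_tails(1)[OF N])
    also have "\<dots> \<le> measure M (UNIV - {..real n * \<epsilon> / 2})"
    proof (rule M.finite_measure_mono)
      have "0 < real n * \<epsilon>" using n \<epsilon> by simp
      then show "{real n * \<epsilon>..} \<subseteq> UNIV - {..real n * \<epsilon> / 2}" by auto
    qed auto
    also have "\<dots> = 1 - cdf M (real n * \<epsilon> / 2)"
      using M.prob_compl[of "{..real n * \<epsilon> / 2}"] by (simp add: cdf_def)
    also have "\<dots> = exp (- ((real n * \<epsilon> / 2) powr a))"
      using n \<epsilon> by (subst cdfM) auto
    finally show ?thesis .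
  qed
  have "filterlim (\<lambda>n::nat. (real n * \<epsilon> / 2) powr a + real n * (ln \<delta> - ln (real n))) at_top sequentially"
    using a \<epsilon>(1) by real_asymp
  then have "\<forall>\<^sub>F n in sequentially. 1 \<le> (real n * \<epsilon> / 2) powr a + real n * (ln \<delta> - ln (real n))"
    by (simp add: filterlim_at_top)
  then obtain n where n: "1 \<le> n" "1 \<le> (real n * \<epsilon> / 2) powr a + real n * (ln \<delta> - ln (real n))"
    using eventually_happens'[OF sequentially_bot eventually_conj[OF _ eventually_ge_at_top[of 1]]] by blast
  have "ln ((\<delta> / real n) ^ n) \<le> ln (exp (- ((real n * \<epsilon> / 2) powr a)))"
    using key[OF n(1)] \<delta> n(1) by (subst ln_le_cancel_iff) auto
  then have "real n * (ln \<delta> - ln (real n)) \<le> - ((real n * \<epsilon> / 2) powr a)"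
    using \<delta> n(1) by (simp add: ln_realpow ln_div)
  then show False using n(2) by linarith
qed

section \<open>The Gumbel distribution\<close>

lemma char_convolution:
  assumes "real_distribution M" "real_distribution N"
  shows "char (M \<star> N) t = char M t * char N t"
  using prob_space.char_distr_add[OF pair_real_distribution(1,4)[OF assms]]
  unfolding convolution_conv_distr pair_real_distribution(2,3)[OF assms] .

lemma char_convolution_power:
  assumes "real_distribution N" shows "char (convolution_power N n) t = char N t ^ n"
proof (induction n)
  case 0
  show ?case by (simp add: char_def integral_return)
next
  case (Suc n)
  then show ?case
    by (simp add: char_convolution[OF assms real_distribution_convolution_power[OF assms]])
qed

lemma convolution_power_eqI:
  assumes "real_distribution M" "real_distribution N" "\<And>t. char M t = char N t ^ n"
  shows "M = convolution_power N n"
  using assms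
  by (intro Levy_uniqueness real_distribution_convolution_power) (auto simp: fun_eq_iff char_convolution_power)

lemma char_affine:
  assumes "real_distribution M"
  shows "char (distr M borel (\<lambda>x. a * x + b)) t = iexp (t * b) * char M (a * t)"
proof -
  interpret real_distribution M by fact
  show ?thesis
    unfolding char_def
    by (subst integral_distr) (auto simp: ring_distribs exp_add mult_ac)
qed

lemma infinitely_divisible_affine:
  assumes M: "infinitely_divisible M"
  shows "infinitely_divisible (distr M borel (\<lambda>x. a * x + b))"
  unfolding infinitely_divisible_def
proof (intro conjI allI impI)
  have dM: "real_distribution M" using M by (simp add: infinitely_divisible_def)
  have aff: "real_distribution (distr P borel (\<lambda>x. a * x + c))" if "real_distribution P" for P c
  proof -
    interpret real_distribution P by fact
    show ?thesis by (rule real_distribution_distr) simp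
  qed
  show "real_distribution (distr M borel (\<lambda>x. a * x + b))" by (rule aff[OF dM])
  fix n :: nat assume n: "1 \<le> n"
  then obtain N where N: "real_distribution N" "M = convolution_power N n"
    using M by (auto simp: infinitely_divisible_def)
  have "distr M borel (\<lambda>x. a * x + b) = convolution_power (distr N borel (\<lambda>x. a * x + b / n)) n"
  proof (rule convolution_power_eqI[OF aff[OF dM] aff[OF N(1)]])
    fix t
    have "char (distr M borel (\<lambda>x. a * x + b)) t = iexp (t * b) * char N (a * t) ^ n"
      using char_affine[OF dM, of a b t] char_convolution_power[OF N(1), of n "a * t"] N(2) by simp
    also have "iexp (t * b) = iexp (t * (b / n)) ^ n"
      using n by (simp add: exp_of_nat_mult[symmetric])
    finally show "char (distr M borel (\<lambda>x. a * x + b)) t = char (distr N borel (\<lambda>x. a * x + b / n)) t ^ n"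
      using char_affine[OF N(1), of a "b / n" t] by (simp add: power_mult_distrib)
  qed
  then show "\<exists>N. real_distribution N \<and> distr M borel (\<lambda>x. a * x + b) = convolution_power N n"
    using aff[OF N(1)] by blast
qed

text \<open>If all summands exceed \<open>b'\<close> in absolute value with the same sign, so does their sum; hence the
tails of \<open>N k\<close> are at most the roots of order \<open>n\<close> of the tails of \<open>M k\<close>.\<close>
lemma tight_roots:
  assumes M: "tight M" and N: "\<And>k. real_distribution (N k)" "\<And>k. M k = convolution_power (N k) n"
    and n: "1 \<le> n"
  shows "tight N"
  unfolding tight_def
proof (intro conjI allI impI)
  show "real_distribution (N k)" for k by (rule N)
  fix \<epsilon> :: real assume \<epsilon>: "0 < \<epsilon>"
  then have "0 < (\<epsilon> / 2) ^ n" by simp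
  then obtain a b where ab: "a < b" "\<And>k. 1 - (\<epsilon> / 2) ^ n < measure (M k) {a<..b}"
    using M unfolding tight_def by blast
  define a' where "a' = - (\<bar>a\<bar> + 1)"
  define b' where "b' = \<bar>b\<bar> + 1"
  have "real n * a' \<le> a'" "b' \<le> real n * b'"
    using n mult_right_mono[of 1 "real n" "\<bar>a\<bar> + 1"] mult_right_mono[of 1 "real n" "\<bar>b\<bar> + 1"]
    by (simp_all add: a'_def b'_def algebra_simps)
  then have na: "real n * a' \<le> a" "b < real n * b'" by (auto simp: a'_def b'_def)
  have "1 - \<epsilon> < measure (N k) {a'<..b'}" for k
  proof -
    interpret N: real_distribution "N k" by (rule N)
    have "real_distribution (M k)" using M by (simp add: tight_def)
    then interpret M: real_distribution "M k" .
    have small: "measure (M k) A < (\<epsilon> / 2) ^ n" if "A \<inter> {a<..b} = {}" "A \<in> sets borel" for A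
    proof -
      have "measure (M k) A + measure (M k) {a<..b} = measure (M k) (A \<union> {a<..b})"
        using that by (intro M.finite_measure_Union[symmetric]) auto
      also have "\<dots> \<le> 1" by (rule M.prob_le_1)
      finally show ?thesis using ab(2)[of k] by linarith
    qed
    have "measure (N k) {b'..} ^ n < (\<epsilon> / 2) ^ n"
    proof -
      have "{real n * b'..} \<inter> {a<..b} = {}" using na by auto
      then have "measure (M k) {real n * b'..} < (\<epsilon> / 2) ^ n" by (intro small) auto
      then show ?thesis
        using convolution_power_tails(1)[OF N(1), of k b' n] unfolding N(2)[symmetric] by linarith
    qed
    then have 1: "measure (N k) {b'..} < \<epsilon> / 2" by (rule power_less_imp_less_base) (use \<epsilon> in simp)
    have "measure (N k) {..a'} ^ n < (\<epsilon> / 2) ^ n"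
    proof -
      have "{..real n * a'} \<inter> {a<..b} = {}" using na by auto
      then have "measure (M k) {..real n * a'} < (\<epsilon> / 2) ^ n" by (intro small) auto
      then show ?thesis
        using convolution_power_tails(2)[OF N(1), of k a' n] unfolding N(2)[symmetric] by linarith
    qed
    then have 2: "measure (N k) {..a'} < \<epsilon> / 2" by (rule power_less_imp_less_base) (use \<epsilon> in simp)
    have "{..a'} \<union> {a'<..b'} \<union> {b'..} = UNIV" by auto
    then have "1 \<le> measure (N k) ({..a'} \<union> {a'<..b'}) + measure (N k) {b'..}"
      using measure_Un_le[of "{..a'} \<union> {a'<..b'}" "N k" "{b'..}"] N.prob_space by simp
    moreover have "measure (N k) ({..a'} \<union> {a'<..b'}) \<le> measure (N k) {..a'} + measure (N k) {a'<..b'}"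
      by (rule measure_Un_le) auto
    ultimately show ?thesis using 1 2 by linarith
  qed
  moreover have "a' < b'" by (simp add: a'_def b'_def)
  ultimately show "\<exists>a b. a < b \<and> (\<forall>k. 1 - \<epsilon> < measure (N k) {a<..b})" by blast
qed

lemma infinitely_divisible_weak_limit:
  assumes ID: "\<And>k. infinitely_divisible (M k)" and M: "tight M" and P: "real_distribution P"
    and lim: "weak_conv_m M P"
  shows "infinitely_divisible P"
  unfolding infinitely_divisible_def
proof (intro conjI allI impI)
  fix n :: nat assume n: "1 \<le> n"
  have dM: "real_distribution (M k)" for k using M by (simp add: tight_def)
  have "\<exists>N. real_distribution N \<and> M k = convolution_power N n" for k
    using ID[of k] n by (simp add: infinitely_divisible_def)
  then obtain N where N: "\<And>k. real_distribution (N k)" "\<And>k. M k = convolution_power (N k) n" by metis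
  from tight_imp_convergent_subsubsequence[OF tight_roots[OF M N n] strict_mono_id]
  obtain r Q where r: "strict_mono (r :: nat \<Rightarrow> nat)" and Q: "real_distribution Q"
    and w: "weak_conv_m (\<lambda>k. N (r k)) Q" by (auto simp: comp_def)
  have "P = convolution_power Q n"
  proof (rule convolution_power_eqI[OF P Q])
    fix t
    have "(\<lambda>k. char (M k) t) \<longlonglongrightarrow> char P t" by (rule levy_continuity1[OF dM P lim])
    from LIMSEQ_subseq_LIMSEQ[OF this r]
    have "(\<lambda>k. char (N (r k)) t ^ n) \<longlonglongrightarrow> char P t"
      by (simp add: comp_def N(2) char_convolution_power[OF N(1)])
    moreover have "(\<lambda>k. char (N (r k)) t ^ n) \<longlonglongrightarrow> char Q t ^ n"
      by (intro tendsto_power levy_continuity1[OF N(1) Q w])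
    ultimately show "char P t = char Q t ^ n" by (rule LIMSEQ_unique)
  qed
  with Q show "\<exists>N. real_distribution N \<and> P = convolution_power N n" by blast
qed (rule P)

text \<open>The functions \<open>m * (w powr (- 1 / m) - 1)\<close> tend to \<open>- ln w\<close>, and Bernoulli's inequality bounds
the tails of the approximating laws uniformly in \<open>m\<close>.\<close>
lemma gumbel_infinitely_divisible: "infinitely_divisible (extreme_value_distribution 0)"
proof -
  define X where "X k = extreme_value_distribution (- (1 / real (Suc k)))" for k
  define m where "m k = real (Suc k)" for k
  define M where "M k = distr (X k) borel (\<lambda>x. m k * x + - m k)" for k
  have m: "0 < m k" for k by (simp add: m_def)
  have dX: "real_distribution (X k)" for k unfolding X_def by (rule real_distribution_extreme_value)
  have dM: "real_distribution (M k)" for k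
  proof -
    interpret real_distribution "X k" by (rule dX)
    show ?thesis unfolding M_def by (rule real_distribution_distr) simp
  qed
  have IDM: "infinitely_divisible (M k)" for k
    unfolding M_def X_def by (intro infinitely_divisible_affine frechet_infinitely_divisible) simp
  have cdfM: "cdf (M k) x = (if 1 + x / m k \<le> 0 then 0 else exp (- ((1 + x / m k) powr (- m k))))" for k x
  proof -
    interpret real_distribution "X k" by (rule dX)
    have "cdf (M k) x = measure (X k) {y. m k * y + - m k \<le> x}"
      unfolding M_def cdf_def by (subst measure_distr) (auto simp: vimage_def)
    also have "{y. m k * y + - m k \<le> x} = {..1 + x / m k}"
      using m[of k] by (auto simp: field_simps)
    also have "measure (X k) {..1 + x / m k} = extreme_value_cdf (- (1 / m k)) (1 + x / m k)"
      unfolding X_def m_def cdf_extreme_value[symmetric] by (simp add: cdf_def)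
    finally show ?thesis using m[of k] by (simp add: extreme_value_cdf_def)
  qed
  have bern: "1 + x \<le> (1 + x / m k) powr m k" if "0 \<le> x" for x k
  proof -
    have "1 + real (Suc k) * (x / m k) \<le> (1 + x / m k) ^ Suc k"
      using that m[of k] by (intro Bernoulli_inequality) (auto intro: order_trans[of _ 0])
    also have "\<dots> = (1 + x / m k) powr real (Suc k)"
      using that m[of k] by (intro powr_realpow[symmetric]) (simp add: add_pos_nonneg)
    finally show ?thesis using m[of k] by (simp add: m_def)
  qed
  have upper: "1 - 1 / (1 + x) \<le> cdf (M k) x" if "0 < x" for x k
  proof -
    have "0 < 1 + x / m k" using that m[of k] by (simp add: add_pos_pos)
    moreover have "(1 + x / m k) powr (- m k) \<le> 1 / (1 + x)"
      using bern[of x k] that by (simp add: powr_minus_divide frac_le)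
    then have "1 - 1 / (1 + x) \<le> exp (- ((1 + x / m k) powr (- m k)))"
      using exp_ge_add_one_self[of "- ((1 + x / m k) powr (- m k))"] by linarith
    ultimately show ?thesis by (simp add: cdfM)
  qed
  have lower: "cdf (M k) (- x) \<le> 1 / (1 + x)" if "0 < x" for x k
  proof (cases "1 + - x / m k \<le> 0")
    case True
    then show ?thesis using that by (simp add: cdfM)
  next
    case False
    define v where "v = 1 + - x / m k"
    have v: "0 < v" using False by (simp add: v_def)
    have "(1 + x / m k) * v \<le> 1" by (simp add: v_def algebra_simps)
    then have "1 + x / m k \<le> 1 / v" using v by (simp add: pos_le_divide_eq)
    then have "(1 + x / m k) powr m k \<le> (1 / v) powr m k"
      using m[of k] that by (intro powr_mono2) (auto simp: add_nonneg_nonneg)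
    also have "(1 / v) powr m k = v powr (- m k)" using v by (simp add: powr_divide powr_minus_divide)
    finally have "1 + x \<le> v powr (- m k)" using bern[of x k] that by simp
    also have "\<dots> \<le> exp (v powr (- m k))" using exp_ge_add_one_self[of "v powr (- m k)"] by linarith
    finally have "exp (- (v powr (- m k))) \<le> 1 / (1 + x)" using that by (simp add: exp_minus field_simps)
    then show ?thesis using False by (simp add: cdfM v_def)
  qed
  have "tight M"
    unfolding tight_def
  proof (intro conjI allI impI dM)
    fix \<epsilon> :: real assume \<epsilon>: "0 < \<epsilon>"
    define x where "x = 2 / \<epsilon>"
    have x: "0 < x" "1 / (1 + x) < \<epsilon> / 2" using \<epsilon> by (auto simp: x_def field_simps)
    have "1 - \<epsilon> < measure (M k) {- x<..x}" for k
    proof -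
      interpret real_distribution "M k" by (rule dM)
      show ?thesis
        using cdf_diff_eq[of "- x" x] upper[OF x(1), of k] lower[OF x(1), of k] x by linarith
    qed
    then show "\<exists>a b. a < b \<and> (\<forall>k. 1 - \<epsilon> < measure (M k) {a<..b})"
      using x(1) by (intro exI[of _ "- x"] exI[of _ x]) auto
  qed
  moreover have "weak_conv_m M (extreme_value_distribution 0)"
    unfolding weak_conv_m_def weak_conv_def cdf_extreme_value
  proof (intro allI impI)
    fix x :: real
    have "(\<lambda>k. 1 + x / m k) \<longlonglongrightarrow> 1" unfolding m_def by real_asymp
    then have "\<forall>\<^sub>F k in sequentially. 0 < 1 + x / m k" by (intro order_tendstoD(1)) auto
    then have ev: "\<forall>\<^sub>F k in sequentially. exp (- ((1 + x / m k) powr (- m k))) = cdf (M k) x"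
      by eventually_elim (simp add: cdfM)
    have "(\<lambda>k. exp (- ((1 + x / m k) powr (- m k)))) \<longlonglongrightarrow> exp (- exp (- x))"
      unfolding m_def by real_asymp
    then show "(\<lambda>k. cdf (M k) x) \<longlonglongrightarrow> extreme_value_cdf 0 x"
      using ev by (simp add: extreme_value_cdf_def Lim_transform_eventually)
  qed
  ultimately show ?thesis
    by (intro infinitely_divisible_weak_limit[OF IDM _ real_distribution_extreme_value])
qed

section \<open>Conclusion\<close>

theorem mainTheorem2:
  shows "(\<forall>\<xi>::real. \<xi> < 0 \<longrightarrow> self_decomposable (extreme_value_distribution \<xi>)) \<and>
    (\<forall>\<xi>::real. infinitely_divisible (extreme_value_distribution \<xi>) \<longleftrightarrow> \<xi> \<notin> {0<..<1})"
proof (intro conjI allI impI)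
  fix \<xi> :: real
  show "self_decomposable (extreme_value_distribution \<xi>)" if "\<xi> < 0"
    using that by (rule frechet_self_decomposable)
  consider "\<xi> < 0" | "\<xi> = 0" | "0 < \<xi>" "\<xi> < 1" | "1 \<le> \<xi>" by linarith
  then show "infinitely_divisible (extreme_value_distribution \<xi>) \<longleftrightarrow> \<xi> \<notin> {0<..<1}"
    by cases (use frechet_infinitely_divisible gumbel_infinitely_divisible
      weibull_not_infinitely_divisible weibull_infinitely_divisible in auto)
qed

end
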